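(* Let $\Lambda$ be a bounded subset of $\mathcal Q^+$, $C,\lambda\ge0$, and let $\delta_{p,h}Y(x)=A^{(q,h)}(x)Y(x)$, $(q,h)\in\Lambda$, $A^{(q,h)}(x)=\sum_{s\ge 0}A_s^{(q,h)}/\langle x\rangle_s^{(q,h)}$, be a non-resonant family of systems that is Fuchsian $(C,\lambda)$ on $\Lambda$. Let $c_1,\dots,c_m\in\mathbb C$ with $c_i-c_j\notin\mathbb Z\setminus\{0\}$, let $r_1,\dots,r_m\geq 1$ be integers with sum $n$, and put $J_0^{(q,h)}=\mathrm{diag}(A^{(q,h)}_{c_1,r_1},\dots,A^{(q,h)}_{c_m,r_m})$ for $(q,h)\in\mathcal Q^+$. Suppose that for every $(q,h)\in\Lambda$ there is $P^{(q,h)}\in GL_n(\mathbb C)$ with $P^{(q,h)}J_0^{(q,h)}=A_0^{(q,h)}P^{(q,h)}$, the families $(P^{(q,h)})_{\Lambda}$ and $((P^{(q,h)})^{-1})_\Lambda$ being bounded. Let $F^{(q,h)}(x)$ be the unique formal series of $(q,h)$-factorials with constant term $I$ such that $(A^{(q,h)})^{F^{(q,h)}}=A_0^{(q,h)}$, let $C',\lambda'$ be such that the family $(F^{(q,h)})_{(q,h)\in\Lambda}$ is Fuchsian $(C',\lambda')$ on $\Lambda$, and let $\mathcal X_{can}^{(q,h)}(x)=F^{(q,h)}(x)\mathcal E_{A_0^{(q,h)}}(x)$ (the canonical solution). Let $(q_0,h_0)\in\overline\Lambda\cap\partial\mathcal Q^+$, and consider one of the following situations for $(q,h)\in\Lambda$,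 $(q,h)\to(q_0,h_0)$: C1: $q_0>1$, $h_0=0$; C2: $q_0=1$, $h_0>0$; C3: $(q_0,h_0)=(1,0)$ and $(q,h)\to(1,0)$ in such a way that $\frac h{q-1}\to\ell$ with $\ell\in\,]0,+\infty[$. Suppose that in this situation: (i) for every $s\ge0$, $A_s^{(q,h)}$ has a limit $A_s$ (and set $A_0^{(q_0,h_0)}=A_0$); (ii) there are conjugating matrices $P^{(q,h)}$ which converge, as $(q,h)\to(q_0,h_0)$, to a matrix conjugating $A_0^{(q_0,h_0)}$ to $J_0^{(q_0,h_0)}$, i.e. to some $P_0\in GL_n(\mathbb C)$ with $P_0J_0^{(q_0,h_0)}=A_0P_0$. Then: 1. The series of $(q_0,h_0)$-factorials $A(x)=\sum_{s\ge0}A_s/\langle x\rangle_s^{(q_0,h_0)}$ converges in $V^{(q_0,h_0)}(\lambda)$ in cases C1 and C2, and in $V_\ell(\lambda)$ in case C3. 2. If the $(q_0,h_0)$-difference system $\delta_{p_0,h_0}Y=A(x)Y$ ($p_0=1/q_0$) is Fuchsian and non-resonant, let $\mathcal X_{can}^{(q_0,h_0)}(x)=F^{(q_0,h_0)}(x)\mathcal E_{A_0}(x)$ be its canonical solution, where $F^{(q_0,h_0)}$ is the unique series of $(q_0,h_0)$-factorials with constant term $I$ such that $A^{F^{(q_0,h_0)}}=A_0$ and $\mathcal E_{A_0}(x)=P_0\mathcal E_{J_0^{(q_0,h_0)}}(x)P_0^{-1}$. Then: - C1: with $h_n=(1-p_0)p_0^n$, the sequence $(\mathcal X_{can}^{(q_0,h_n)}(x))_{n\ge0}$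 converges to $\mathcal X_{can}^{(q_0,0)}(x)$, uniformly on every compact subset of $\{|x|>\lambda'\}\setminus\bigcup_{i=1}^m(c_i+h_0\mathbb N^* )$; - C2: the family $\mathcal X_{can}^{(q,h)}(x)$ tends to $\mathcal X_{can}^{(1,h_0)}(x)$, uniformly on every compact subset of $\{\Re x>\lambda'\}\setminus\bigcup_{i=1}^m(c_i+h_0\mathbb N^* )$; - C3: the family $\mathcal X_{can}^{(q,h)}(x)$ tends to $\mathcal X_{can}^{(1,0)}(x)$, uniformly on every compact subset of $V_\ell(\lambda')\setminus\mathbb R^+$.
   Context: Throughout $q\ge1$ and $h\ge0$ are real, $p=1/q$, $\mathcal Q^+=[1,+\infty[\times[0,+\infty[$, $\partial\mathcal Q^+$ is its boundary (points with $q=1$ or $h=0$), $\mathbb N^*=\{1,2,\dots\}$, $\mathbb R^+=[0,+\infty[$. For $\lambda\in\mathbb C$: $[\lambda]_q=\frac{q^\lambda-1}{q-1}$ if $q>1$, $[\lambda]_1=\lambda$. For an integer $s\ge0$ put $\langle x\rangle_s^{(q,h)}=\prod_{k=0}^{s-1}(q^kx+h[k]_q)$ (equal to $1$ for $s=0$). A (formal) series of $(q,h)$-factorials is $\sum_{s\ge0}A_s/\langle x\rangle_s^{(q,h)}$. Operator: $\delta_{p,h}f(x)=p(x-h)\dfrac{f(px-ph)-f(x)}{(p-1)x-ph}$ if $(q,h)\ne(1,0)$, and $\delta_{1,0}=x\frac{d}{dx}$. Gauge transformation: $A^F(x)=F(px-ph)^{-1}[A(x)F(x)-\delta_{p,h}F(x)]$.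 Norms: $\|\cdot\|$ on $M_n(\mathbb C)$ and $|\cdot|$ on $\mathbb C^n$ are fixed with $|AX|\le\|A\||X|$ and $\|I\|=1$. A family of matrices $A^{(q,h)}(x)=\sum_{s\ge0}A_s^{(q,h)}/\langle x\rangle_s^{(q,h)}$, $(q,h)\in\Lambda$, is Fuchsian $(C,\lambda)$ on $\Lambda$ if $\|A_s^{(q,h)}\|\le Cq^{s-1}\langle\lambda\rangle_{s-1}^{(q,h)}$ for all $s\ge1$ and $(q,h)\in\Lambda$. The family of systems $\delta_{p,h}Y=A^{(q,h)}Y$ is Fuchsian $(C,\lambda)$ on $\Lambda$ if moreover $I+(1-q)A_0^{(q,h)}$ is invertible for all $(q,h)\in\Lambda$. It is non-resonant if, for all $(q,h)\in\Lambda$ and every eigenvalue $c$ of $A_0^{(q,h)}$, $q^sc-[s]_q$ is not an eigenvalue of $A_0^{(q,h)}$ for any integer $s\neq0$. For a single system, take $\Lambda$ to be one point (with some $C,\lambda$). Domains: $V^{(q,h)}(\lambda)=\{x\in\mathbb C: |x-\frac{h}{1-q}|>|\lambda-\frac h{1-q}|\}$ if $q>1$; $V^{(1,h)}(\lambda)=\{\Re x>\Re\lambda\}$ if $h>0$; $V^{(1,0)}(\lambda)=\{|x|>|\lambda|\}$. For $\ell\in[0,+\infty[$, $V_\ell(\lambda)=\{|x+\ell|>\lambda+\ell\}$ ($\lambda\geq 0$). Special functions: $(x;p)_\infty=\prod_{j\ge0}(1-p^jx)$; $\Theta_q(x)=\sum_{n\in\mathbb Z}(-1)^nq^{-n(n-1)/2}x^n$;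 $\Gamma$ is Euler's Gamma function. For $c\in\mathbb C$, $e_c^{(q,h)}(x)=\left(\frac h{1-p}\right)^c\frac{((1-p)\frac xh+p;p)_\infty}{(p^c((1-p)\frac xh+p);p)_\infty}$ if $q>1,h>0$; $e_c^{(1,h)}(x)=h^c\frac{\Gamma(1+c-x/h)}{\Gamma(1-x/h)}$ if $h>0$; $e_c^{(q,0)}(x)=\frac{\Theta_q(x)}{\Theta_q(q^{-c}x)}$ if $q>1$; $e_c^{(1,0)}(x)=(-x)^c$ (a determination of the logarithm being fixed). For $k\ge0$, $\ell_{c,k}^{(q,h)}=\frac1{k!}\frac{\partial^k}{\partial c^k}e_c^{(q,h)}$. Matrices: $N_r$ is the $r\times r$ matrix with $1$'s on the first superdiagonal and $0$ elsewhere. $\mathcal L_{c,r}^{(q,h)}(x)=\sum_{j=0}^{r-1}\ell_{c,j}^{(q,h)}(x)N_r^j$. $A_{c,r}^{(q,h)}=-[-c]_qI_r+\frac{q^{-c}}{1-q}(q^{-N_r}-I_r)$ if $q>1$, and $A_{c,r}^{(1,h)}=cI_r+N_r$. For $J_0^{(q,h)}=\mathrm{diag}(A^{(q,h)}_{c_1,r_1},\dots,A^{(q,h)}_{c_m,r_m})$, put $\mathcal E_{J_0^{(q,h)}}(x)=\mathrm{diag}(\mathcal L^{(q,h)}_{c_1,r_1}(x),\dots,\mathcal L^{(q,h)}_{c_m,r_m}(x))$, and if $A_0^{(q,h)}=PJ_0^{(q,h)}P^{-1}$ with $P\in GL_n(\mathbb C)$, $\mathcal E_{A_0^{(q,h)}}(x)=P\mathcal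 E_{J_0^{(q,h)}}(x)P^{-1}$ (independent of the choice of $P$).
   Formalization: The excluded sets c_i+h_0N* are replaced by the actual poles of the limit functions: the spirals q_0^{c_i+Z} in C1 and the points h_0(c_i+N* ) in C2; with the sets as printed the claim fails (e.g. C2 with n=1, c=1/2, h_0=2 has a pole at x=3). *)

theory Defs
  imports
    "HOL-Analysis.Analysis"
    "HOL-Computational_Algebra.Formal_Power_Series"
begin

section \<open>Parameters, $q$-brackets and $(q,h)$-factorials\<close>

definition Qplus :: "(real \<times> real) set" where
  "Qplus = {1..} \<times> {0..}"

definition qbracket :: "real \<Rightarrow> 'a \<Rightarrow> 'a::{ln, real_normed_field}" where
  "qbracket q l = (if q = 1 then l else (of_real q powr l - 1) / (of_real q - 1))"

definition qh_fact :: "real \<Rightarrow> real \<Rightarrow> nat \<Rightarrow> 'a \<Rightarrow> 'a::{ln, real_normed_field}" where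
  "qh_fact q h s x = (\<Prod>k<s. of_real q ^ k * x + of_real h * qbracket q (of_nat k))"

definition V_dom :: "real \<Rightarrow> real \<Rightarrow> complex \<Rightarrow> complex set" where
  "V_dom q h l =
    (if q > 1 then {x. cmod (x - of_real (h / (1 - q))) > cmod (l - of_real (h / (1 - q)))}
     else if h > 0 then {x. Re x > Re l}
     else {x. cmod x > cmod l})"

definition V_ell :: "real \<Rightarrow> real \<Rightarrow> complex set" where
  "V_ell l lam = {x. cmod (x + of_real l) > lam + l}"


section \<open>Matrices and norms\<close>

definition mscale :: "complex \<Rightarrow> complex^'n^'n \<Rightarrow> complex^'n^'n" where
  "mscale a A = (\<chi> i j. a * A $ i $ j)"

definition eigenval :: "complex^'n^'n \<Rightarrow> complex \<Rightarrow> bool" where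
  "eigenval A c \<longleftrightarrow> (\<exists>v. v \<noteq> 0 \<and> A *v v = c *s v)"

definition compatible_norms ::
    "(complex^'n^'n \<Rightarrow> real) \<Rightarrow> (complex^'n \<Rightarrow> real) \<Rightarrow> bool" where
  "compatible_norms nM nV \<longleftrightarrow>
    (\<forall>v. nV v = 0 \<longleftrightarrow> v = 0) \<and> (\<forall>a v. nV (a *s v) = cmod a * nV v) \<and>
    (\<forall>v w. nV (v + w) \<le> nV v + nV w) \<and>
    (\<forall>A. nM A = 0 \<longleftrightarrow> A = 0) \<and> (\<forall>a A. nM (mscale a A) = cmod a * nM A) \<and>
    (\<forall>A B. nM (A + B) \<le> nM A + nM B) \<and>
    (\<forall>A v. nV (A *v v) \<le> nM A * nV v) \<and> nM (mat 1) = 1"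


section \<open>Series of $(q,h)$-factorials\<close>

text \<open>A formal series of $(q,h)$-factorials is its coefficient sequence.\<close>

definition fseries_term ::
    "real \<Rightarrow> real \<Rightarrow> (nat \<Rightarrow> complex^'n^'n) \<Rightarrow> complex \<Rightarrow> nat \<Rightarrow> complex^'n^'n" where
  "fseries_term q h A x s = mscale (1 / qh_fact q h s x) (A s)"

definition fseries_sum ::
    "real \<Rightarrow> real \<Rightarrow> (nat \<Rightarrow> complex^'n^'n) \<Rightarrow> complex \<Rightarrow> complex^'n^'n" where
  "fseries_sum q h A x = (\<Sum>s. fseries_term q h A x s)"

text \<open>
  Formal operations. Since $q^k \neq 0$, the factorial $1/\langle x\rangle_s$ is $z^s$ times a unit of
  the ring of formal power series in $z = 1/x$. The formal series of $(q,h)$-factorials are thereby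
  identified with the formal power series in $z$, where products, the substitution of
  $px - ph$ for $x$ (that is, of $qz/(1 - hz)$ for $z$) and the operator are computed.
\<close>

definition inv_fact_fps :: "real \<Rightarrow> real \<Rightarrow> nat \<Rightarrow> complex fps" where
  "inv_fact_fps q h s =
    (\<Prod>k<s. fps_X / (fps_const (of_real q ^ k) + fps_const (of_real h * qbracket q (of_nat k)) * fps_X))"

definition fseries_fps ::
    "real \<Rightarrow> real \<Rightarrow> (nat \<Rightarrow> complex^'n^'n) \<Rightarrow> complex fps^'n^'n" where
  "fseries_fps q h A =
    (\<chi> i j. Abs_fps (\<lambda>n. \<Sum>s\<le>n. A s $ i $ j * fps_nth (inv_fact_fps q h s) n))"

definition shift_fps :: "real \<Rightarrow> real \<Rightarrow> complex fps \<Rightarrow> complex fps" where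
  "shift_fps q h f = fps_compose f (fps_const (of_real q) * fps_X / (1 - fps_const (of_real h) * fps_X))"

text \<open>
  In terms of $z$, the coefficient $p(x-h)/((p-1)x-ph)$ of the operator is
  $p(1-hz)/((p-1)-phz)$. For $q = 1$, $h > 0$ the denominator has order one, and so has the
  difference in the numerator at least, so that the division of power series is exact.
\<close>

definition delta_fps :: "real \<Rightarrow> real \<Rightarrow> complex fps \<Rightarrow> complex fps" where
  "delta_fps q h f =
    (if (q, h) = (1, 0) then - (fps_X * fps_deriv f)
     else let p = complex_of_real (1 / q) in
       fps_const p * (1 - fps_const (of_real h) * fps_X) * (shift_fps q h f - f)
         / (fps_const (p - 1) - fps_const (p * of_real h) * fps_X))"

definition map_entries :: "('a \<Rightarrow> 'b) \<Rightarrow> 'a^'n^'n \<Rightarrow> 'b^'n^'n" where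
  "map_entries g M = (\<chi> i j. g (M $ i $ j))"

definition gauge_fps ::
    "real \<Rightarrow> real \<Rightarrow> complex fps^'n^'n \<Rightarrow> complex fps^'n^'n \<Rightarrow> complex fps^'n^'n" where
  "gauge_fps q h A F =
    matrix_inv (map_entries (shift_fps q h) F) ** (A ** F - map_entries (delta_fps q h) F)"

definition canonical_gauge ::
    "real \<Rightarrow> real \<Rightarrow> (nat \<Rightarrow> complex^'n^'n) \<Rightarrow> (nat \<Rightarrow> complex^'n^'n) \<Rightarrow> bool" where
  "canonical_gauge q h A F \<longleftrightarrow>
    F 0 = mat 1 \<and>
    invertible (map_entries (shift_fps q h) (fseries_fps q h F)) \<and>
    gauge_fps q h (fseries_fps q h A) (fseries_fps q h F) = map_entries fps_const (A 0)"


section \<open>Fuchsian and non-resonant families\<close>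

definition fuchsian_matrices ::
    "(complex^'n^'n \<Rightarrow> real) \<Rightarrow> (real \<times> real) set \<Rightarrow> real \<Rightarrow> real \<Rightarrow>
      (real \<Rightarrow> real \<Rightarrow> nat \<Rightarrow> complex^'n^'n) \<Rightarrow> bool" where
  "fuchsian_matrices nM \<Lambda> C lam A \<longleftrightarrow>
    (\<forall>(q, h) \<in> \<Lambda>. \<forall>s\<ge>1. nM (A q h s) \<le> C * q ^ (s - 1) * qh_fact q h (s - 1) lam)"

definition fuchsian_systems ::
    "(complex^'n^'n \<Rightarrow> real) \<Rightarrow> (real \<times> real) set \<Rightarrow> real \<Rightarrow> real \<Rightarrow>
      (real \<Rightarrow> real \<Rightarrow> nat \<Rightarrow> complex^'n^'n) \<Rightarrow> bool" where
  "fuchsian_systems nM \<Lambda> C lam A \<longleftrightarrow>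
    fuchsian_matrices nM \<Lambda> C lam A \<and>
    (\<forall>(q, h) \<in> \<Lambda>. invertible (mat 1 + mscale (1 - of_real q) (A q h 0)))"

definition nonresonant ::
    "(real \<times> real) set \<Rightarrow> (real \<Rightarrow> real \<Rightarrow> nat \<Rightarrow> complex^'n^'n) \<Rightarrow> bool" where
  "nonresonant \<Lambda> A \<longleftrightarrow>
    (\<forall>(q, h) \<in> \<Lambda>. \<forall>c. eigenval (A q h 0) c \<longrightarrow>
      (\<forall>s::int. s \<noteq> 0 \<longrightarrow>
        \<not> eigenval (A q h 0) (of_real q powi s * c - qbracket q (of_int s))))"


section \<open>Special functions\<close>

definition qpoch_inf :: "real \<Rightarrow> complex \<Rightarrow> complex" where
  "qpoch_inf p x = prodinf (\<lambda>j. 1 - of_real p ^ j * x)"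

definition Theta :: "real \<Rightarrow> complex \<Rightarrow> complex" where
  "Theta q x =
    (\<Sum>\<^sub>\<infinity>n::int. (-1) powi n * of_real q powi (- (n * (n - 1) div 2)) * x powi n)"

text \<open>For $(q,h) = (1,0)$ the principal determination of the logarithm is the fixed one.\<close>

definition e_fun :: "real \<Rightarrow> real \<Rightarrow> complex \<Rightarrow> complex \<Rightarrow> complex" where
  "e_fun q h c x =
    (if q > 1 \<and> h > 0 then
       let p = 1 / q; a = of_real (1 - p) * x / of_real h + of_real p in
         of_real (h / (1 - p)) powr c * qpoch_inf p a / qpoch_inf p (of_real p powr c * a)
     else if h > 0 then
       of_real h powr c * Gamma (1 + c - x / of_real h) / Gamma (1 - x / of_real h)
     else if q > 1 then
       Theta q x / Theta q (of_real q powr (- c) * x)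
     else (- x) powr c)"

definition ell_fun :: "real \<Rightarrow> real \<Rightarrow> complex \<Rightarrow> nat \<Rightarrow> complex \<Rightarrow> complex" where
  "ell_fun q h c k x = (deriv ^^ k) (\<lambda>c'. e_fun q h c' x) c / fact k"


section \<open>Block matrices\<close>

text \<open>
  An $r \times r$ block is a function on pairs of indices, of which only those below $r$ matter.
  A block diagonal matrix with $m$ blocks of sizes $r_0, \dots, r_{m-1}$ lives on an index type whose
  elements are numbered by a bijection \<open>\<iota>\<close> onto the pairs (block, position in the block).
\<close>

primrec N_pow :: "nat \<Rightarrow> nat \<Rightarrow> nat \<Rightarrow> nat \<Rightarrow> complex" where
  "N_pow r 0 i j = (if i = j then 1 else 0)"
| "N_pow r (Suc k) i j = (\<Sum>l<r. N_pow r k i l * (if j = Suc l then 1 else 0))"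

definition L_block :: "real \<Rightarrow> real \<Rightarrow> complex \<Rightarrow> nat \<Rightarrow> complex \<Rightarrow> nat \<Rightarrow> nat \<Rightarrow> complex" where
  "L_block q h c r x i j = (\<Sum>k<r. ell_fun q h c k x * N_pow r k i j)"

text \<open>$q^{-N} = \exp(-\ln q\, N)$, a finite sum as $N$ is nilpotent.\<close>

definition q_pow_minus_N :: "real \<Rightarrow> nat \<Rightarrow> nat \<Rightarrow> nat \<Rightarrow> complex" where
  "q_pow_minus_N q r i j = (\<Sum>k<r. of_real (- ln q) ^ k / fact k * N_pow r k i j)"

definition A_block :: "real \<Rightarrow> complex \<Rightarrow> nat \<Rightarrow> nat \<Rightarrow> nat \<Rightarrow> complex" where
  "A_block q c r i j =
    (if q > 1 then
       - qbracket q (- c) * N_pow r 0 i j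
         + of_real q powr (- c) / (1 - of_real q) * (q_pow_minus_N q r i j - N_pow r 0 i j)
     else c * N_pow r 0 i j + N_pow r 1 i j)"

definition block_diag ::
    "('n \<Rightarrow> nat \<times> nat) \<Rightarrow> (nat \<Rightarrow> nat \<Rightarrow> nat \<Rightarrow> complex) \<Rightarrow> complex^'n^'n" where
  "block_diag \<iota> B =
    (\<chi> a b. if fst (\<iota> a) = fst (\<iota> b) then B (fst (\<iota> a)) (snd (\<iota> a)) (snd (\<iota> b)) else 0)"

definition J0 ::
    "('n \<Rightarrow> nat \<times> nat) \<Rightarrow> (nat \<Rightarrow> complex) \<Rightarrow> (nat \<Rightarrow> nat) \<Rightarrow> real \<Rightarrow> complex^'n^'n" where
  "J0 \<iota> c r q = block_diag \<iota> (\<lambda>i. A_block q (c i) (r i))"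

definition E_J0 ::
    "('n \<Rightarrow> nat \<times> nat) \<Rightarrow> (nat \<Rightarrow> complex) \<Rightarrow> (nat \<Rightarrow> nat) \<Rightarrow> real \<Rightarrow> real \<Rightarrow> complex \<Rightarrow>
      complex^'n^'n" where
  "E_J0 \<iota> c r q h x = block_diag \<iota> (\<lambda>i. L_block q h (c i) (r i) x)"

text \<open>\<open>P\<close> is a matrix conjugating the constant term of the system to \<open>J0\<close>.\<close>

definition X_can ::
    "('n \<Rightarrow> nat \<times> nat) \<Rightarrow> (nat \<Rightarrow> complex) \<Rightarrow> (nat \<Rightarrow> nat) \<Rightarrow> real \<Rightarrow> real \<Rightarrow>
      (nat \<Rightarrow> complex^'n^'n) \<Rightarrow> complex^'n^'n \<Rightarrow> complex \<Rightarrow> complex^'n^'n" where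
  "X_can \<iota> c r q h F P x = fseries_sum q h F x ** (P ** E_J0 \<iota> c r q h x ** matrix_inv P)"

definition conjugates :: "complex^'n^'n \<Rightarrow> complex^'n^'n \<Rightarrow> complex^'n^'n \<Rightarrow> bool" where
  "conjugates P J A \<longleftrightarrow> invertible P \<and> P ** J = A ** P"


section \<open>Confluence\<close>

text \<open>
  The modes of approach of $(q_0,h_0)$ within \<open>\<Lambda>\<close>. At $(1,0)$ one requires moreover
  $h/(q-1) \to l$; for $l > 0$ this excludes $q = 1$, where the quotient is $0$ by convention.
\<close>

definition confluence_filter ::
    "(real \<times> real) set \<Rightarrow> real \<Rightarrow> real \<Rightarrow> real \<Rightarrow> (real \<times> real) filter" where
  "confluence_filter \<Lambda> q0 h0 l =
    (if (q0, h0) = (1, 0)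
     then inf (inf (nhds (q0, h0)) (principal \<Lambda>)) (filtercomap (\<lambda>(q, h). h / (q - 1)) (nhds l))
     else inf (nhds (q0, h0)) (principal \<Lambda>))"

definition locally_uniform_limit ::
    "complex set \<Rightarrow> ('i \<Rightarrow> complex \<Rightarrow> complex^'n^'n) \<Rightarrow> (complex \<Rightarrow> complex^'n^'n) \<Rightarrow> 'i filter \<Rightarrow> bool"
  where
  "locally_uniform_limit D f g \<Phi> \<longleftrightarrow> (\<forall>K. compact K \<and> K \<subseteq> D \<longrightarrow> uniform_limit K f g \<Phi>)"

text \<open>
  The poles in $x$ of the functions $e_c$ and of their derivatives with respect to $c$: the spiral
  $q^{c+\mathbb{Z}}$ of zeros of $\Theta_q(q^{-c}x)$ for $h = 0$, and the poles
  $h(c + \mathbb{N}^*)$ of $\Gamma(1 + c - x/h)$ for $q = 1$.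
\<close>

definition spiral_poles :: "real \<Rightarrow> complex \<Rightarrow> complex set" where
  "spiral_poles q c = range (\<lambda>k::int. of_real q powr (c + of_int k))"

definition gamma_poles :: "real \<Rightarrow> complex \<Rightarrow> complex set" where
  "gamma_poles h c = (\<lambda>k::nat. of_real h * (c + of_nat k)) ` {1..}"

end

theory Submission
  imports Defs "HOL-Complex_Analysis.Complex_Analysis"
begin

text \<open>
  The canonical solution is a product of a series of factorials $F$ and of a matrix of derivatives in
  $c$ of the functions $e_c$; the two factors converge for different reasons.

  Series. On the domains of the theorem the factors of $\langle x\rangle_s$ dominate those of
  $\langle X\rangle_s$ for a real $X > \lambda$, and the majorant
  $q^s\langle\lambda\rangle_s/\langle X\rangle_{s+1}$ telescopes, with tails that are uniform in
  $(q,h)$. It then suffices that every coefficient of $F$ converges. In $z = 1/x$ the gauge equation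
  is a recursion whose $N$-th step is the Sylvester equation
  $(A_0 + [N]_q) f_N - f_N (q^N A_0) = \dots$, with right-hand side depending on earlier coefficients;
  non-resonance of the limit system makes its left-hand side injective at the limit.

  Special functions. By Cauchy's inequality it suffices that $e_c(x)$ converges uniformly for $x$ in
  a compact set and $c$ near the exponent. For $h \to 0$ along $h_n$ the quotient of infinite
  products is shifted by $p^n$ into a quotient of truncated theta products. For $q \to 1$, $h \to h_0$
  it is a quotient of $p$-Gamma functions, written as Weierstrass-type products with dominated
  factors. At $(1,0)$ its logarithm is a Riemann sum for $-c \int_0^1 a/(1-ua)\,du = c \log(1-a)$.
\<close>


section \<open>Infinite series and products with uniform tails\<close>

text \<open>The difficulty is uniformity in \<open>(q,h)\<close>, in \<open>x\<close> and in the
  exponent at once. The estimates are stated for an arbitrary filter, so that a sequence and the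
  two-parameter approaches share one proof. The poles of \<open>e_c\<close> move with the exponent;
  hence numerator and denominator are treated separately on a fixed disc of exponents, and the disc
  is shrunk only when the quotient is formed. As \<open>p\<close> tends to 1 the infinite products
  degenerate. In the variable \<open>w\<close>, on which their argument depends affinely, the
  divergent powers of \<open>1 - p\<close> separate from a convergent product, and in the quotient
  only the exponential of a quantity of order \<open>(1 - p) ln (1 - p)\<close> survives. For
  \<open>h\<close> tending to 0 a general \<open>h\<close> would shift the products by a
  non-integral number of steps; along \<open>h_n = (1 - p) p^n\<close> the shift is integral and the
  powers of \<open>p^c\<close> cancel exactly. The limit is then a quotient of products, whereas
  \<open>e_c\<close> is defined by the series \<open>Theta\<close>, so Jacobi's triple product
  identity is established on the way. The Fuchsian bound of the limit gauge series is inherited from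
  the family, and one majorant serves for both.\<close>

lemma suminf_tail_bound:
  fixes f :: "nat \<Rightarrow> 'b::banach"
  assumes tail: "\<And>N n. (\<Sum>k=N..<n. norm (f k)) \<le> \<rho> N"
  shows "summable f" "norm (suminf f - (\<Sum>k<N. f k)) \<le> \<rho> N" "norm (suminf f) \<le> \<rho> 0"
proof -
  have bd: "(\<Sum>k<n. norm (f (k + N))) \<le> \<rho> N" for n N
    using tail[of N "n + N"] sum.shift_bounds_nat_ivl[of "\<lambda>k. norm (f k)" 0 N n]
    by (simp add: atLeast0LessThan)
  have sn: "summable (\<lambda>k. norm (f (k + N)))" for N
    by (rule summableI_nonneg_bounded[OF _ bd]) auto
  then show s: "summable f"
    using summable_norm_cancel[of f] sn[of 0] by simp
  have "norm (suminf f - (\<Sum>k<N. f k)) = norm (\<Sum>k. f (k + N))" for N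
    using suminf_split_initial_segment[OF s, of N] by simp
  also have "\<dots> N \<le> (\<Sum>k. norm (f (k + N)))" for N
    by (rule summable_norm[OF sn])
  also have "\<dots> N \<le> \<rho> N" for N
    by (rule suminf_le_const[OF sn bd])
  finally show *: "norm (suminf f - (\<Sum>k<N. f k)) \<le> \<rho> N" for N .
  show "norm (suminf f) \<le> \<rho> 0" using *[of 0] by simp
qed

text \<open>An epsilon/3 argument. The majorant \<open>\<rho>\<close> bounds blocks of norms rather
  than single terms: the bounds for factorial series telescope, their terms depend on the
  parameters, and only the sum over a block has a common bound.\<close>

lemma uniform_limit_suminf_tail:
  fixes t :: "nat \<Rightarrow> 'i \<Rightarrow> 'x \<Rightarrow> 'b::banach"
  assumes lim: "\<And>k. uniform_limit X (t k) (t0 k) \<Phi>"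
    and tail: "\<forall>\<^sub>F i in \<Phi>. \<forall>x\<in>X. \<forall>N n. (\<Sum>k=N..<n. norm (t k i x)) \<le> \<rho> N"
    and tail0: "\<And>x N n. x \<in> X \<Longrightarrow> (\<Sum>k=N..<n. norm (t0 k x)) \<le> \<rho> N"
    and \<rho>: "\<rho> \<longlonglongrightarrow> 0"
  shows "uniform_limit X (\<lambda>i x. \<Sum>k. t k i x) (\<lambda>x. \<Sum>k. t0 k x) \<Phi>"
proof (rule uniform_limitI)
  fix e :: real assume e: "e > 0"
  then have "\<forall>\<^sub>F N in sequentially. \<rho> N < e / 3"
    using \<rho> by (intro order_tendstoD) auto
  then obtain N where N: "\<rho> N < e / 3"
    by (auto simp: eventually_sequentially)
  have "uniform_limit X (\<lambda>i x. \<Sum>k<N. t k i x) (\<lambda>x. \<Sum>k<N. t0 k x) \<Phi>"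
    by (induction N) (simp_all add: uniform_limit_const uniform_limit_add lim)
  then have "\<forall>\<^sub>F i in \<Phi>. \<forall>x\<in>X. dist (\<Sum>k<N. t k i x) (\<Sum>k<N. t0 k x) < e / 3"
    using e by (intro uniform_limitD) auto
  with tail show "\<forall>\<^sub>F i in \<Phi>. \<forall>x\<in>X. dist (\<Sum>k. t k i x) (\<Sum>k. t0 k x) < e"
  proof eventually_elim
    case (elim i)
    show ?case
    proof
      fix x assume x: "x \<in> X"
      have "norm ((\<Sum>k. t k i x) - (\<Sum>k<N. t k i x)) \<le> \<rho> N"
        using elim x by (intro suminf_tail_bound(2)) auto
      moreover have "norm ((\<Sum>k. t0 k x) - (\<Sum>k<N. t0 k x)) \<le> \<rho> N"
        using tail0[OF x] by (intro suminf_tail_bound(2)) auto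
      ultimately show "dist (\<Sum>k. t k i x) (\<Sum>k. t0 k x) < e"
        using N elim x norm_triangle_lt[of "(\<Sum>k. t k i x) - (\<Sum>k<N. t k i x)" "(\<Sum>k<N. t k i x) - (\<Sum>k<N. t0 k x)" "2*e/3"]
          norm_triangle_lt[of "(\<Sum>k. t k i x) - (\<Sum>k<N. t0 k x)" "(\<Sum>k<N. t0 k x) - (\<Sum>k. t0 k x)" e]
        by (auto simp: dist_norm norm_minus_commute)
    qed
  qed
qed

text \<open>The product is rewritten as the series of its increments
  \<open>P (Suc k) - P k = P k * (\<psi> k - 1)\<close>, each of norm at most
  \<open>exp (suminf m) * m k\<close>. No logarithm is taken, so factors may vanish; this matters
  for functions with zeros such as 1/Gamma.\<close>

lemma prod_dominated:
  fixes \<psi> :: "nat \<Rightarrow> complex"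
  assumes m: "summable m" and le: "\<And>k. cmod (\<psi> k - 1) \<le> m k"
  defines "P \<equiv> \<lambda>n. \<Prod>k<n. \<psi> k"
  shows "convergent_prod \<psi>"
    and "cmod (P n) \<le> exp (suminf m)"
    and "(\<Sum>k=N..<n. cmod (P (Suc k) - P k)) \<le> exp (suminf m) * (suminf m - (\<Sum>k<N. m k))"
    and "prodinf \<psi> = 1 + (\<Sum>n. P (Suc n) - P n)"
    and "cmod (prodinf \<psi> - P N) \<le> exp (suminf m) * (suminf m - (\<Sum>k<N. m k))"
proof -
  have m0: "m k \<ge> 0" for k using le[of k] norm_ge_zero[of "\<psi> k - 1"] by linarith
  have sm: "sum m A \<le> suminf m" if "finite A" for A
    using that m m0 by (intro sum_le_suminf) auto
  have "summable (\<lambda>k. norm (\<psi> k - 1))"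
    by (rule summable_comparison_test'[OF m, of 0]) (use le in auto)
  then show cp: "convergent_prod \<psi>"
    using abs_convergent_prod_imp_convergent_prod summable_imp_abs_convergent_prod by blast
  show Pb: "cmod (P n) \<le> exp (suminf m)" for n
  proof -
    have "cmod (\<psi> k) \<le> exp (m k)" for k
      using norm_triangle_ineq[of "\<psi> k - 1" 1] le[of k] exp_ge_add_one_self[of "m k"]
      by (simp only: norm_one diff_add_cancel)
    then have "cmod (P n) \<le> (\<Prod>k<n. exp (m k))"
      unfolding P_def prod_norm[symmetric] by (intro prod_mono) auto
    also have "\<dots> = exp (\<Sum>k<n. m k)" by (simp add: exp_sum)
    finally show ?thesis using sm[of "{..<n}"] by (meson exp_le_cancel_iff finite_lessThan order_trans)
  qed
  show tl: "(\<Sum>k=N..<n. cmod (P (Suc k) - P k)) \<le> exp (suminf m) * (suminf m - (\<Sum>k<N. m k))" for N n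
  proof -
    have "P (Suc k) - P k = P k * (\<psi> k - 1)" for k
      by (simp add: P_def algebra_simps)
    then have "cmod (P (Suc k) - P k) \<le> exp (suminf m) * m k" for k
      using mult_mono[OF Pb[of k] le[of k]] by (simp add: norm_mult)
    then have "(\<Sum>k=N..<n. cmod (P (Suc k) - P k)) \<le> (\<Sum>k=N..<n. exp (suminf m) * m k)"
      by (intro sum_mono)
    also have "\<dots> = exp (suminf m) * sum m {N..<n}" by (simp add: sum_distrib_left)
    also have "sum m {N..<n} \<le> suminf m - (\<Sum>k<N. m k)"
    proof -
      have "sum m {N..<n} + sum m {..<N} = sum m ({N..<n} \<union> {..<N})"
        by (intro sum.union_disjoint[symmetric]) auto
      also have "\<dots> \<le> suminf m" by (intro sm) auto
      finally show ?thesis by simp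
    qed
    finally show ?thesis by simp
  qed
  have tele: "(\<Sum>k<n. P (Suc k) - P k) = P n - 1" for n
    using sum_lessThan_telescope[of P n] by (simp add: P_def)
  have "(\<lambda>n. P n) \<longlonglongrightarrow> prodinf \<psi>"
    using convergent_prod_LIMSEQ[OF cp] unfolding P_def
    by (subst (asm) lessThan_Suc_atMost[symmetric]) (rule LIMSEQ_imp_Suc)
  moreover have "(\<lambda>n. P n) \<longlonglongrightarrow> 1 + (\<Sum>n. P (Suc n) - P n)"
    using summable_LIMSEQ[OF suminf_tail_bound(1)[of "\<lambda>k. P (Suc k) - P k", OF tl]]
    unfolding tele by (drule_tac tendsto_add[OF tendsto_const[of 1]]) simp
  ultimately show eq: "prodinf \<psi> = 1 + (\<Sum>n. P (Suc n) - P n)"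
    by (rule LIMSEQ_unique)
  show "cmod (prodinf \<psi> - P N) \<le> exp (suminf m) * (suminf m - (\<Sum>k<N. m k))"
    using suminf_tail_bound(2)[of "\<lambda>k. P (Suc k) - P k", OF tl, of N]
    unfolding eq tele by (simp add: algebra_simps)
qed

lemma dominated_tail_tendsto_0:
  fixes m :: "nat \<Rightarrow> real"
  assumes "summable m"
  shows "(\<lambda>N. exp (suminf m) * (suminf m - (\<Sum>k<N. m k))) \<longlonglongrightarrow> 0"
  using tendsto_mult[OF tendsto_const[of "exp (suminf m)"] tendsto_diff[OF tendsto_const[of "suminf m"] summable_LIMSEQ[OF assms]]]
  by simp

text \<open>Through the series of increments this becomes a statement on uniform tails. Products of
  uniform limits require bounded limits; the bound \<open>exp (suminf m)\<close> on the partial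
  products of \<open>\<psi>0\<close> is the same for every length.\<close>

lemma uniform_limit_prodinf_dominated:
  fixes \<psi> :: "nat \<Rightarrow> 'i \<Rightarrow> 'x \<Rightarrow> complex"
  assumes m: "summable m"
    and lim: "\<And>k. uniform_limit X (\<psi> k) (\<psi>0 k) \<Phi>"
    and le: "\<forall>\<^sub>F i in \<Phi>. \<forall>x\<in>X. \<forall>k. cmod (\<psi> k i x - 1) \<le> m k"
    and le0: "\<And>x k. x \<in> X \<Longrightarrow> cmod (\<psi>0 k x - 1) \<le> m k"
  shows "uniform_limit X (\<lambda>i x. prodinf (\<lambda>k. \<psi> k i x)) (\<lambda>x. prodinf (\<lambda>k. \<psi>0 k x)) \<Phi>"
proof -
  have P: "uniform_limit X (\<lambda>i x. \<Prod>k<n. \<psi> k i x) (\<lambda>x. \<Prod>k<n. \<psi>0 k x) \<Phi>" for n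
  proof (induction n)
    case (Suc n)
    have "bounded ((\<lambda>x. \<Prod>k<n. \<psi>0 k x) ` X)"
      by (rule boundedI[of _ "exp (suminf m)"]) (auto intro!: prod_dominated(2)[OF m] le0)
    moreover have "bounded (\<psi>0 n ` X)"
    proof (rule boundedI[of _ "1 + m n"])
      fix y assume "y \<in> \<psi>0 n ` X"
      then obtain x where x: "x \<in> X" "y = \<psi>0 n x" by auto
      then show "norm y \<le> 1 + m n"
        using norm_triangle_ineq[of "y - 1" 1] le0[of x n] by simp
    qed
    ultimately show ?case
      using uniform_lim_mult[OF Suc.IH lim] by simp
  qed (simp add: uniform_limit_const)
  have le': "\<forall>\<^sub>F i in \<Phi>. \<forall>x\<in>X. prodinf (\<lambda>k. \<psi> k i x) = 1 + (\<Sum>n. (\<Prod>k<Suc n. \<psi> k i x) - (\<Prod>k<n. \<psi> k i x))"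
    using le by eventually_elim (intro ballI prod_dominated(4)[OF m], blast)
  have "uniform_limit X (\<lambda>i x. 1 + (\<Sum>n. (\<Prod>k<Suc n. \<psi> k i x) - (\<Prod>k<n. \<psi> k i x)))
          (\<lambda>x. 1 + (\<Sum>n. (\<Prod>k<Suc n. \<psi>0 k x) - (\<Prod>k<n. \<psi>0 k x))) \<Phi>"
  proof (intro uniform_limit_add uniform_limit_const uniform_limit_suminf_tail)
    show "uniform_limit X (\<lambda>i x. (\<Prod>k<Suc n. \<psi> k i x) - (\<Prod>k<n. \<psi> k i x)) (\<lambda>x. (\<Prod>k<Suc n. \<psi>0 k x) - (\<Prod>k<n. \<psi>0 k x)) \<Phi>" for n
      by (intro uniform_limit_minus P)
    show "\<forall>\<^sub>F i in \<Phi>. \<forall>x\<in>X. \<forall>N n. (\<Sum>n = N..<n. norm ((\<Prod>k<Suc n. \<psi> k i x) - (\<Prod>k<n. \<psi> k i x)))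
            \<le> exp (suminf m) * (suminf m - (\<Sum>k<N. m k))"
      using le by eventually_elim (intro ballI allI prod_dominated(3)[OF m], blast)
    show "(\<Sum>n = N..<n. norm ((\<Prod>k<Suc n. \<psi>0 k x) - (\<Prod>k<n. \<psi>0 k x)))
            \<le> exp (suminf m) * (suminf m - (\<Sum>k<N. m k))" if "x \<in> X" for x N n
      using prod_dominated(3)[OF m le0[OF that]] by blast
  qed (rule dominated_tail_tendsto_0[OF m])
  then show ?thesis
    using prod_dominated(4)[OF m le0] le' by (subst uniform_limit_cong[OF le']) auto
qed

lemma uniform_limit_bound_eventually:
  fixes f :: "'i \<Rightarrow> 'x \<Rightarrow> 'b::real_normed_vector"
  assumes lim: "uniform_limit X f g \<Phi>" and M: "\<And>x. x \<in> X \<Longrightarrow> norm (g x) \<le> M"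
  shows "\<forall>\<^sub>F i in \<Phi>. \<forall>x\<in>X. norm (f i x) \<le> M + 1"
  using uniform_limitD[OF lim zero_less_one]
proof eventually_elim
  case (elim i)
  show ?case
  proof
    fix x assume "x \<in> X"
    then show "norm (f i x) \<le> M + 1"
      using elim M[of x] norm_triangle_ineq2[of "f i x" "g x"] by (force simp: dist_norm)
  qed
qed

lemma compact_continuous_bound:
  fixes f :: "'x::topological_space \<Rightarrow> 'b::real_normed_vector"
  assumes "compact K" "continuous_on K f"
  obtains M where "\<And>x. x \<in> K \<Longrightarrow> norm (f x) \<le> M"
  using compact_imp_bounded[OF compact_continuous_image[OF assms(2,1)]] unfolding bounded_iff by auto

lemma cball_subset_cball_0: "cball c r \<subseteq> cball (0 :: complex) (cmod c + r)"
proof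
  fix y assume "y \<in> cball c r"
  then show "y \<in> cball 0 (cmod c + r)" using norm_triangle_ineq2[of y c] by (simp add: dist_norm norm_minus_commute)
qed


section \<open>Convergence of series of $(q,h)$-factorials\<close>

text \<open>Compactness of \<open>K\<close> turns joint continuity into closeness for all
  \<open>x\<close> at once as the parameter nears \<open>p0\<close>. The set \<open>S\<close>
  records the parameters at which a formula makes sense (non-zero denominators, logarithms of
  positive reals).\<close>

lemma uniform_limit_joint_continuous:
  fixes G :: "'p::topological_space \<times> 'x::topological_space \<Rightarrow> 'b::metric_space"
  assumes cont: "continuous_on (S \<times> K) G" and K: "compact K"
    and p: "(p \<longlongrightarrow> p0) \<Phi>" "\<forall>\<^sub>F i in \<Phi>. p i \<in> S" "p0 \<in> S"
  shows "uniform_limit K (\<lambda>i x. G (p i, x)) (\<lambda>x. G (p0, x)) \<Phi>"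
proof (rule uniform_limitI)
  fix e :: real assume e: "e > 0"
  obtain X0 where X0: "p0 \<in> X0" "open X0" "\<And>q. q \<in> X0 \<inter> S \<Longrightarrow> \<forall>t\<in>K. dist (G (q, t)) (G (p0, t)) \<le> e / 2"
    using continuous_on_prod_compactE[OF cont K p(3), of "e / 2"] e by (metis half_gt_zero)
  have "\<forall>\<^sub>F i in \<Phi>. p i \<in> X0"
    using p(1) X0 by (auto dest: topological_tendstoD)
  with p(2) show "\<forall>\<^sub>F i in \<Phi>. \<forall>x\<in>K. dist (G (p i, x)) (G (p0, x)) < e"
  proof eventually_elim
    case (elim i)
    show ?case
    proof
      fix x assume "x \<in> K"
      then have "dist (G (p i, x)) (G (p0, x)) \<le> e / 2" using elim X0(3)[of "p i"] by blast
      then show "dist (G (p i, x)) (G (p0, x)) < e" using e by linarith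
    qed
  qed
qed

text \<open>The bracket of a natural number as a polynomial in \<open>q\<close>, so that continuity
  at \<open>q = 1\<close> is visible; the case distinction in \<open>qbracket\<close> conceals
  it.\<close>

definition qnum :: "real \<Rightarrow> nat \<Rightarrow> real" where
  "qnum q k = (\<Sum>j<k. q ^ j)"

lemma qnum_nonneg: "q \<ge> 1 \<Longrightarrow> qnum q k \<ge> 0"
  by (auto simp: qnum_def intro!: sum_nonneg)

lemma qnum_one [simp]: "qnum 1 k = real k"
  by (simp add: qnum_def)

lemma qnum_closed: "q \<noteq> 1 \<Longrightarrow> qnum q k = (q ^ k - 1) / (q - 1)"
  by (simp add: qnum_def geometric_sum)

lemma qnum_le: "q \<ge> 1 \<Longrightarrow> qnum q k \<le> real k * q ^ k"
  unfolding qnum_def using sum_bounded_above[of "{..<k}" "\<lambda>j. q ^ j" "q ^ k"]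
  by (simp add: power_increasing)

lemma qbracket_of_nat:
  assumes "q \<ge> 1"
  shows "qbracket q (of_nat k :: real) = qnum q k"
    and "qbracket q (of_nat k :: complex) = of_real (qnum q k)"
proof -
  show "qbracket q (of_nat k :: real) = qnum q k"
    using assms by (auto simp: qbracket_def qnum_closed powr_realpow)
  have "complex_of_real q powr of_nat k = complex_of_real q ^ k"
    using assms by (subst powr_nat) auto
  then show "qbracket q (of_nat k :: complex) = of_real (qnum q k)"
    by (auto simp: qbracket_def qnum_closed)
qed

lemma continuous_on_qnum [continuous_intros]:
  "continuous_on S f \<Longrightarrow> continuous_on S (\<lambda>x. qnum (f x) k)"
  unfolding qnum_def by (intro continuous_intros)

lemma qh_fact_real: "q \<ge> 1 \<Longrightarrow> qh_fact q h s (x::real) = (\<Prod>k<s. q ^ k * x + h * qnum q k)"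
  by (simp add: qh_fact_def qbracket_of_nat)

lemma qh_fact_complex:
  "q \<ge> 1 \<Longrightarrow> qh_fact q h s (x::complex) = (\<Prod>k<s. of_real q ^ k * x + of_real (h * qnum q k))"
  by (simp add: qh_fact_def qbracket_of_nat)

text \<open>The domains of the theorem enter the estimates of series only through this relation: a
  real \<open>X\<close> replaces \<open>x\<close> in every factor, and what remains are real
  products.\<close>

definition factors_ge :: "real \<Rightarrow> real \<Rightarrow> real \<Rightarrow> complex \<Rightarrow> bool" where
  "factors_ge q h X x \<longleftrightarrow> (\<forall>k. q ^ k * X + h * qnum q k \<le> cmod (of_real q ^ k * x + of_real (h * qnum q k)))"

lemma factors_ge_half_plane:
  assumes "h \<ge> 0" "X \<le> Re x"
  shows "factors_ge 1 h X x"
  unfolding factors_ge_def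
proof
  fix k
  have "1 ^ k * X + h * qnum 1 k \<le> Re (of_real 1 ^ k * x + of_real (h * qnum 1 k))"
    using assms by simp
  then show "1 ^ k * X + h * qnum 1 k \<le> cmod (of_real 1 ^ k * x + of_real (h * qnum 1 k))"
    using complex_Re_le_cmod order_trans by blast
qed

text \<open>With \<open>L = h/(q - 1)\<close> the factor of index \<open>k\<close> is
  \<open>q^k (x + L) - L\<close>, a dilation about \<open>- L\<close>, which is the centre
  \<open>h/(1 - q)\<close> of the domain. The reverse triangle inequality then compares
  \<open>x\<close> with the real point \<open>X\<close>.\<close>

lemma factors_ge_disc:
  assumes "q > 1" "h \<ge> 0" "X \<le> cmod (x + of_real (h / (q - 1))) - h / (q - 1)"
  shows "factors_ge q h X x"
  unfolding factors_ge_def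
proof
  fix k
  define L where "L = h / (q - 1)"
  have L: "h * qnum q k = q ^ k * L - L" "L \<ge> 0"
    using assms by (simp_all add: L_def qnum_closed diff_divide_distrib right_diff_distrib mult.commute)
  have "of_real q ^ k * x + of_real (h * qnum q k) = of_real (q ^ k) * (x + of_real L) - of_real L"
    unfolding L by (simp add: algebra_simps)
  then have "cmod (of_real q ^ k * x + of_real (h * qnum q k)) \<ge> q ^ k * cmod (x + of_real L) - L"
    using norm_triangle_ineq2[of "of_real (q ^ k) * (x + of_real L)" "of_real L"] assms L(2)
    by (simp add: norm_mult norm_power)
  moreover have "q ^ k * (X + L) \<le> q ^ k * cmod (x + of_real L)"
    using assms by (intro mult_left_mono) (auto simp: L_def)
  ultimately show "q ^ k * X + h * qnum q k \<le> cmod (of_real q ^ k * x + of_real (h * qnum q k))"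
    unfolding L(1) by (simp add: algebra_simps)
qed

lemma factors_ge_at_1_0: "X \<le> cmod x \<Longrightarrow> factors_ge 1 0 X x"
  by (simp add: factors_ge_def)

lemma qh_fact_ge:
  assumes "q \<ge> 1" "h \<ge> 0" "X > 0" "factors_ge q h X x"
  shows "0 < qh_fact q h s X" "qh_fact q h s X \<le> cmod (qh_fact q h s x)"
proof -
  have pos: "0 < q ^ k * X + h * qnum q k" for k
    using assms qnum_nonneg[of q k] by (intro add_pos_nonneg mult_pos_pos mult_nonneg_nonneg) auto
  then show "0 < qh_fact q h s X"
    using assms by (simp add: qh_fact_real prod_pos)
  have "(\<Prod>k<s. q ^ k * X + h * qnum q k) \<le> (\<Prod>k<s. cmod (of_real q ^ k * x + of_real (h * qnum q k)))"
    using assms(4) pos by (intro prod_mono) (auto simp: factors_ge_def less_imp_le)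
  then show "qh_fact q h s X \<le> cmod (qh_fact q h s x)"
    using assms unfolding qh_fact_real[OF assms(1)] qh_fact_complex[OF assms(1)] prod_norm by simp
qed

text \<open>
  The quotients $\langle\lambda\rangle_N/\langle X\rangle_N$ grow with $h$ and decrease with $q$, so
  that those of $(1,H)$ are a common bound.
\<close>

definition fact_quot :: "real \<Rightarrow> real \<Rightarrow> real \<Rightarrow> nat \<Rightarrow> real" where
  "fact_quot H lam X N = (\<Prod>k<N. (lam + H * real k) / (X + H * real k))"

text \<open>The factors are \<open>1 - y k\<close> with \<open>y k\<close> at least a constant times
  \<open>1/(k + 1)\<close>, so the divergence of the harmonic series forces the product to
  0.\<close>

lemma fact_quot_tendsto_0:
  assumes "0 \<le> lam" "lam < X" "H > 0"
  shows "fact_quot H lam X \<longlonglongrightarrow> 0"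
proof -
  define y where "y k = (X - lam) / (X + H * real k)" for k
  define S where "S N = (\<Sum>k<N. y k)" for N
  have pos: "X + H * real k > 0" for k using assms by (intro add_pos_nonneg) auto
  have y0: "y k > 0" for k using pos[of k] assms by (simp add: y_def)
  have S0: "S N \<ge> 0" for N unfolding S_def by (intro sum_nonneg less_imp_le y0)
  have nn: "fact_quot H lam X N \<ge> 0" for N
    unfolding fact_quot_def using pos assms by (intro prod_nonneg ballI divide_nonneg_pos add_nonneg_nonneg) auto
  have fac: "(lam + H * real k) / (X + H * real k) = 1 - y k" for k
    using pos[of k] by (simp add: y_def field_simps)
  \<comment> \<open>A substitute for the estimate of the product by \<open>exp (- S N)\<close>: the
    induction rests on the polynomial inequality
    \<open>(1 - y)(1 + S + y) \<le> 1 + S\<close>.\<close>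
  have le1: "fact_quot H lam X N * (1 + S N) \<le> 1" for N
  proof (induction N)
    case 0 then show ?case by (simp add: S_def fact_quot_def)
  next
    case (Suc N)
    have "(1 - y N) * (1 + S N + y N) = 1 + S N - y N * (S N + y N)"
      by (simp add: algebra_simps)
    also have "\<dots> \<le> 1 + S N" using y0[of N] S0[of N] by simp
    finally have "fact_quot H lam X N * ((1 - y N) * (1 + S N + y N)) \<le> fact_quot H lam X N * (1 + S N)"
      using nn by (intro mult_left_mono)
    then show ?case using Suc fac[of N] by (simp add: fact_quot_def S_def mult.assoc add.assoc)
  qed
  have Sharm: "S N \<ge> (X - lam) / (X + H) * harm N" for N
  proof -
    have "(X - lam) / (X + H) * inverse (real (Suc k)) \<le> y k" for k
    proof -
      have "X + H * real k \<le> (X + H) * real (Suc k)"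
        using assms by (simp add: algebra_simps)
      then have "(X - lam) / ((X + H) * real (Suc k)) \<le> y k"
        unfolding y_def using assms pos[of k] by (intro divide_left_mono mult_pos_pos) auto
      then show ?thesis by (simp add: divide_inverse)
    qed
    then have "(\<Sum>k<N. (X - lam) / (X + H) * inverse (real (Suc k))) \<le> S N"
      unfolding S_def by (intro sum_mono)
    moreover have "harm N = (\<Sum>k<N. inverse (real (Suc k)))"
      unfolding harm_def by (rule sum.reindex_bij_witness[of _ Suc "\<lambda>k. k - 1"]) auto
    ultimately show ?thesis by (simp add: sum_distrib_left)
  qed
  have "filterlim (\<lambda>N. (X - lam) / (X + H) * harm N) at_top sequentially"
    using assms by (intro filterlim_tendsto_pos_mult_at_top[OF tendsto_const _ harm_at_top]) auto
  then have "filterlim S at_top sequentially"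
    by (rule filterlim_at_top_mono) (intro always_eventually allI Sharm)
  then have "(\<lambda>N. inverse (1 + S N)) \<longlonglongrightarrow> 0"
    by (intro tendsto_inverse_0_at_top filterlim_tendsto_add_at_top[OF tendsto_const])
  moreover have "fact_quot H lam X N \<le> inverse (1 + S N)" for N
    using le1[of N] S0[of N] by (simp add: field_simps)
  ultimately show ?thesis
    by (intro tendsto_sandwich[of "\<lambda>_. 0" "fact_quot H lam X" _ "\<lambda>N. inverse (1 + S N)"]) (auto simp: nn)
qed

text \<open>After division by \<open>q^k\<close> both factors have the form
  \<open>(lam + t) / (X + t)\<close>, which increases in \<open>t\<close> because
  \<open>lam < X\<close>; and \<open>h * qnum q k / q^k\<close> is at most
  \<open>H * k\<close>.\<close>

lemma qh_fact_quot_le: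
  assumes q: "q \<ge> 1" and h: "0 \<le> h" "h \<le> H" and lam: "0 \<le> lam" "lam < X"
  shows "qh_fact q h N lam / qh_fact q h N X \<le> fact_quot H lam X N"
  unfolding qh_fact_real[OF q] fact_quot_def prod_dividef[symmetric]
proof (rule prod_mono, rule conjI)
  fix k
  define a where "a = h * qnum q k"
  have a0: "a \<ge> 0" using h q by (simp add: a_def qnum_nonneg)
  have qk: "q ^ k \<ge> 1" using q by simp
  have "a \<le> H * (real k * q ^ k)"
    unfolding a_def using h qnum_le[OF q, of k] qnum_nonneg[OF q, of k] by (intro mult_mono) auto
  then have "(X - lam) * (a - H * real k * q ^ k) \<le> 0"
    using lam by (intro mult_nonneg_nonpos) auto
  then have "(q ^ k * lam + a) * (X + H * real k) \<le> (lam + H * real k) * (q ^ k * X + a)"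
    by (simp add: algebra_simps)
  moreover have "0 < q ^ k * X + a" "0 < X + H * real k"
    using a0 qk lam h by (intro add_pos_nonneg mult_pos_pos; auto)+
  ultimately show "(q ^ k * lam + h * qnum q k) / (q ^ k * X + h * qnum q k) \<le> (lam + H * real k) / (X + H * real k)"
    unfolding a_def by (simp add: divide_simps mult.commute)
  show "0 \<le> (q ^ k * lam + h * qnum q k) / (q ^ k * X + h * qnum q k)"
    using a0 qk lam by (auto simp: a_def intro!: divide_nonneg_nonneg add_nonneg_nonneg)
qed

lemma norm_mscale: "norm (mscale a A) = cmod a * norm A"
proof -
  have "norm (mscale a A $ i) = cmod a * norm (A $ i)" for i
    by (simp add: mscale_def norm_vec_def norm_mult L2_set_right_distrib)
  then show ?thesis
    by (simp add: norm_vec_def L2_set_right_distrib)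
qed

text \<open>
  With $t_s = \langle\lambda\rangle_s/\langle X\rangle_s$ one has
  $q^s\langle\lambda\rangle_s/\langle X\rangle_{s+1} = (t_s-t_{s+1})/(X-\lambda)$, a telescoping sum.
\<close>

lemma fseries_tail:
  assumes q: "q \<ge> 1" and h: "0 \<le> h" "h \<le> H" and lam: "0 \<le> lam" "lam < X"
    and x: "factors_ge q h X x" and K: "K \<ge> 0"
    and A: "\<And>s. norm (A (Suc s)) \<le> K * (q ^ s * qh_fact q h s lam)"
  shows "(\<Sum>k=N..<n. norm (fseries_term q h A x (Suc k))) \<le> K / (X - lam) * fact_quot H lam X N"
proof (cases "N \<le> n")
  case True
  define t where "t s = qh_fact q h s lam / qh_fact q h s X" for s
  have X: "X > 0" using lam by simp
  note pos = qh_fact_ge(1)[OF q h(1) X x] and le = qh_fact_ge(2)[OF q h(1) X x]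
  have lam0: "0 \<le> qh_fact q h s lam" for s
    using q h lam by (auto simp: qh_fact_real qnum_nonneg intro!: prod_nonneg)
  have t0: "t s \<ge> 0" for s using pos[of s] lam0[of s] by (simp add: t_def)
  have term_le: "norm (fseries_term q h A x (Suc k)) \<le> K / (X - lam) * (t k - t (Suc k))" for k
  proof -
    let ?y = "q ^ k * X + h * qnum q k"
    have y: "?y > 0" using X q h qnum_nonneg[OF q, of k] by (intro add_pos_nonneg mult_pos_pos) auto
    have S: "qh_fact q h (Suc k) X = qh_fact q h k X * ?y"
      "qh_fact q h (Suc k) lam = qh_fact q h k lam * (q ^ k * lam + h * qnum q k)"
      using q by (simp_all add: qh_fact_real)
    have "t (Suc k) = t k * ((q ^ k * lam + h * qnum q k) / ?y)"
      by (simp add: t_def S)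
    also have "(q ^ k * lam + h * qnum q k) / ?y = 1 - q ^ k * (X - lam) / ?y"
      using y by (simp add: field_simps)
    finally have tt: "t k - t (Suc k) = (X - lam) * (t k * q ^ k / ?y)" by (simp add: algebra_simps)
    have "norm (fseries_term q h A x (Suc k)) = norm (A (Suc k)) / cmod (qh_fact q h (Suc k) x)"
      by (simp add: fseries_term_def norm_mscale norm_divide)
    also have "\<dots> \<le> K * (q ^ k * qh_fact q h k lam) / qh_fact q h (Suc k) X"
      using A[of k] le[of "Suc k"] pos[of "Suc k"] K lam0[of k] q by (intro frac_le) auto
    also have "\<dots> = K * (t k * q ^ k / ?y)"
      by (simp add: S t_def)
    also have "\<dots> = K / (X - lam) * (t k - t (Suc k))"
      unfolding tt using lam by simp
    finally show ?thesis .
  qed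
  have "(\<Sum>k=N..<n. norm (fseries_term q h A x (Suc k))) \<le> (\<Sum>k=N..<n. K / (X - lam) * (t k - t (Suc k)))"
    by (intro sum_mono term_le)
  also have "\<dots> = K / (X - lam) * (t N - t n)"
    using sum_Suc_diff'[OF True, of "\<lambda>k. - t k"] unfolding sum_distrib_left[symmetric] by simp
  also have "\<dots> \<le> K / (X - lam) * t N"
    using K lam t0[of n] by (intro mult_left_mono) auto
  also have "\<dots> \<le> K / (X - lam) * fact_quot H lam X N"
    using K lam qh_fact_quot_le[OF q h lam] by (intro mult_left_mono) (auto simp: t_def)
  finally show ?thesis .
next
  case False
  have "0 \<le> fact_quot H lam X N"
    unfolding fact_quot_def using h lam by (intro prod_nonneg ballI divide_nonneg_nonneg add_nonneg_nonneg) auto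
  then show ?thesis using False K lam by simp
qed

lemma continuous_on_mscale [continuous_intros]:
  "continuous_on S f \<Longrightarrow> continuous_on S g \<Longrightarrow> continuous_on S (\<lambda>x. mscale (f x) (g x))"
  unfolding mscale_def by (intro continuous_intros)

text \<open>The term of index 0 is treated apart, because the Fuchsian bound starts at index 1. The
  boundedness of the limit is recorded for the later product with the special functions.\<close>

lemma uniform_limit_fseries_sum:
  fixes F :: "'i \<Rightarrow> nat \<Rightarrow> complex^'n^'n" and q h :: "'i \<Rightarrow> real"
  assumes K: "compact K" and lam: "0 \<le> lam" "lam < X" and B: "B \<ge> 0"
    and lim: "(q \<longlongrightarrow> q0) \<Phi>" "(h \<longlongrightarrow> h0) \<Phi>" "\<And>s. ((\<lambda>i. F i s) \<longlongrightarrow> F0 s) \<Phi>"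
    and ev: "\<forall>\<^sub>F i in \<Phi>. q i \<ge> 1 \<and> h i \<ge> 0 \<and> h i \<le> H \<and> (\<forall>x\<in>K. factors_ge (q i) (h i) X x)
       \<and> (\<forall>s. norm (F i (Suc s)) \<le> B * (q i ^ s * qh_fact (q i) (h i) s lam))"
    and q0: "q0 \<ge> 1" and h0: "h0 \<ge> 0" "h0 \<le> H" and dom0: "\<And>x. x \<in> K \<Longrightarrow> factors_ge q0 h0 X x"
    and F0: "\<And>s. norm (F0 (Suc s)) \<le> B * (q0 ^ s * qh_fact q0 h0 s lam)"
    and H: "H > 0"
  shows "uniform_limit K (\<lambda>i x. fseries_sum (q i) (h i) (F i) x) (fseries_sum q0 h0 F0) \<Phi>"
    and "bounded (fseries_sum q0 h0 F0 ` K)"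
proof -
  define \<rho> where "\<rho> N = B / (X - lam) * fact_quot H lam X N" for N
  have \<rho>: "\<rho> \<longlonglongrightarrow> 0"
    unfolding \<rho>_def by (rule tendsto_mult_right_zero[OF fact_quot_tendsto_0[OF lam H]])
  \<comment> \<open>The parameters are triples \<open>(q, h, coefficient)\<close>: a term of the
    series is jointly continuous in the triple and \<open>x\<close>, which settles the dependence on
    all of them in one step.\<close>
  define S where "S = {p :: real \<times> real \<times> (complex^'n^'n). fst p \<ge> 1 \<and> fst (snd p) \<ge> 0 \<and> (\<forall>x\<in>K. factors_ge (fst p) (fst (snd p)) X x)}"
  have X: "X > 0" using lam by simp
  have term_lim: "uniform_limit K (\<lambda>i x. fseries_term (q i) (h i) (F i) x s) (\<lambda>x. fseries_term q0 h0 F0 x s) \<Phi>" for s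
  proof -
    define G where "G = (\<lambda>(p :: real \<times> real \<times> (complex^'n^'n), x). mscale (1 / (\<Prod>k<s. of_real (fst p) ^ k * x + of_real (fst (snd p) * qnum (fst p) k))) (snd (snd p)))"
    have nz: "(\<Prod>k<s. of_real (fst p) ^ k * x + of_real (fst (snd p) * qnum (fst p) k)) \<noteq> (0::complex)"
      if "p \<in> S" "x \<in> K" for p x
    proof -
      have "qh_fact (fst p) (fst (snd p)) s x \<noteq> 0"
        using qh_fact_ge[of "fst p" "fst (snd p)" X x s] that X by (auto simp: S_def)
      then show ?thesis using that by (subst (asm) qh_fact_complex) (auto simp: S_def)
    qed
    have "continuous_on (S \<times> K) G"
      unfolding G_def split_beta
    proof (intro continuous_intros ballI)
      fix z assume "z \<in> S \<times> K"
      then show "(\<Prod>k<s. of_real (fst (fst z)) ^ k * snd z + of_real (fst (snd (fst z)) * qnum (fst (fst z)) k)) \<noteq> (0::complex)"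
        using nz[of "fst z" "snd z"] by (auto simp: mem_Times_iff)
    qed
    then have "uniform_limit K (\<lambda>i x. G ((q i, h i, F i s), x)) (\<lambda>x. G ((q0, h0, F0 s), x)) \<Phi>"
    proof (rule uniform_limit_joint_continuous[OF _ K])
      show "((\<lambda>i. (q i, h i, F i s)) \<longlongrightarrow> (q0, h0, F0 s)) \<Phi>"
        by (intro tendsto_intros lim)
      show "\<forall>\<^sub>F i in \<Phi>. (q i, h i, F i s) \<in> S"
        using ev by eventually_elim (auto simp: S_def)
      show "(q0, h0, F0 s) \<in> S" using q0 h0 dom0 by (auto simp: S_def)
    qed
    moreover have "G ((a, b, M), x) = mscale (1 / qh_fact a b s x) M" if "a \<ge> 1" for a b M x
      using that by (simp add: G_def qh_fact_complex)
    ultimately show ?thesis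
      unfolding fseries_term_def
      by (elim uniform_limit_cong[THEN iffD1, rotated 2])
        (use ev q0 in \<open>auto elim!: eventually_mono\<close>)
  qed
  have tail: "\<forall>\<^sub>F i in \<Phi>. \<forall>x\<in>K. \<forall>N n. (\<Sum>k=N..<n. norm (fseries_term (q i) (h i) (F i) x (Suc k))) \<le> \<rho> N"
    using ev unfolding \<rho>_def by eventually_elim (intro ballI allI fseries_tail lam B; auto)
  have tail0: "(\<Sum>k=N..<n. norm (fseries_term q0 h0 F0 x (Suc k))) \<le> \<rho> N" if "x \<in> K" for x N n
    unfolding \<rho>_def using that by (intro fseries_tail lam B q0 h0 dom0 F0)
  have sum_split: "fseries_sum a b M x = fseries_term a b M x 0 + (\<Sum>k. fseries_term a b M x (Suc k))"
    if "\<And>N n. (\<Sum>k=N..<n. norm (fseries_term a b M x (Suc k))) \<le> \<rho> N" for a b x and M :: "nat \<Rightarrow> complex^'n^'n"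
  proof -
    have "summable (\<lambda>k. fseries_term a b M x (Suc k))"
      by (rule suminf_tail_bound(1)[OF that])
    then have "summable (fseries_term a b M x)" by (subst (asm) summable_Suc_iff)
    then show ?thesis unfolding fseries_sum_def by (rule suminf_split_head[THEN eq_diff_eq[THEN iffD1], symmetric, unfolded add.commute[of "suminf _"]])
  qed
  have "uniform_limit K (\<lambda>i x. fseries_term (q i) (h i) (F i) x 0 + (\<Sum>k. fseries_term (q i) (h i) (F i) x (Suc k)))
     (\<lambda>x. fseries_term q0 h0 F0 x 0 + (\<Sum>k. fseries_term q0 h0 F0 x (Suc k))) \<Phi>"
    by (intro uniform_limit_add term_lim uniform_limit_suminf_tail[OF _ tail tail0 \<rho>])
  moreover have "\<forall>\<^sub>F i in \<Phi>. \<forall>x\<in>K. fseries_sum (q i) (h i) (F i) x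
      = fseries_term (q i) (h i) (F i) x 0 + (\<Sum>k. fseries_term (q i) (h i) (F i) x (Suc k))"
    using tail by eventually_elim (use sum_split in blast)
  ultimately show "uniform_limit K (\<lambda>i x. fseries_sum (q i) (h i) (F i) x) (fseries_sum q0 h0 F0) \<Phi>"
    using sum_split[OF tail0] by (subst uniform_limit_cong) auto
  show "bounded (fseries_sum q0 h0 F0 ` K)"
  proof (rule boundedI)
    fix y assume "y \<in> fseries_sum q0 h0 F0 ` K"
    then obtain x where x: "x \<in> K" "y = fseries_sum q0 h0 F0 x" by auto
    have "norm y \<le> norm (fseries_term q0 h0 F0 x 0) + norm (\<Sum>k. fseries_term q0 h0 F0 x (Suc k))"
      unfolding x sum_split[OF tail0[OF x(1)]] by (rule norm_triangle_ineq)
    also have "norm (\<Sum>k. fseries_term q0 h0 F0 x (Suc k)) \<le> \<rho> 0"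
      by (rule suminf_tail_bound(3)[OF tail0[OF x(1)]])
    also have "norm (fseries_term q0 h0 F0 x 0) = norm (F0 0)"
      by (simp add: fseries_term_def norm_mscale qh_fact_def)
    finally show "norm y \<le> norm (F0 0) + \<rho> 0" by simp
  qed
qed


section \<open>The Sylvester equation\<close>

lemma bounded_bilinear_matrix_mul:
  "bounded_bilinear ((**) :: complex^'n^'n \<Rightarrow> complex^'n^'n \<Rightarrow> complex^'n^'n)"
  unfolding bilinear_conv_bounded_bilinear[symmetric] bilinear_def
  by (auto intro!: linearI simp: matrix_matrix_mult_def vec_eq_iff sum.distrib algebra_simps scaleR_sum_right)

lemma mscale_mult_left: "mscale a A ** B = mscale a (A ** B)"
  by (simp add: mscale_def matrix_matrix_mult_def vec_eq_iff sum_distrib_left mult.assoc)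

lemma mscale_mult_right: "A ** mscale a B = mscale a (A ** B)"
  by (simp add: mscale_def matrix_matrix_mult_def vec_eq_iff sum_distrib_left mult_ac)

lemma mscale_mult_vec: "mscale a A *v x = a *s (A *v x)"
  by (simp add: mscale_def matrix_vector_mult_def vec_eq_iff sum_distrib_left mult_ac)

lemma mscale_mscale: "mscale a (mscale b A) = mscale (a * b) A"
  by (simp add: mscale_def vec_eq_iff mult.assoc)

lemma mscale_0 [simp]: "mscale 0 A = 0" "mscale a 0 = 0"
  by (simp_all add: mscale_def vec_eq_iff)

lemma mscale_1 [simp]: "mscale 1 A = A"
  by (simp add: mscale_def vec_eq_iff)

lemma mscale_add_left: "mscale (a + b) A = mscale a A + mscale b A"
  by (simp add: mscale_def vec_eq_iff algebra_simps)

lemma mscale_diff_left: "mscale (a - b) A = mscale a A - mscale b A"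
  by (simp add: mscale_def vec_eq_iff algebra_simps)

lemma mscale_of_real: "mscale (complex_of_real a) A = a *\<^sub>R A"
  by (simp add: mscale_def vec_eq_iff scaleR_conv_of_real[where 'a = complex])

lemma mscale_eq_0_iff: "mscale a A = 0 \<longleftrightarrow> a = 0 \<or> A = 0"
  by (auto simp: mscale_def vec_eq_iff)

text \<open>The action of a polynomial $p$ on $M$ by $M \mapsto M\,p(V)$.\<close>

primrec rpow :: "complex^'n^'n \<Rightarrow> complex^'n^'n \<Rightarrow> nat \<Rightarrow> complex^'n^'n" where
  "rpow M V 0 = M"
| "rpow M V (Suc k) = rpow M V k ** V"

definition pact :: "complex^'n^'n \<Rightarrow> complex^'n^'n \<Rightarrow> complex poly \<Rightarrow> complex^'n^'n" where
  "pact M V p = (\<Sum>k\<le>degree p. mscale (coeff p k) (rpow M V k))"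

lemma pact_altdef:
  assumes "degree p \<le> n"
  shows "pact M V p = (\<Sum>k\<le>n. mscale (coeff p k) (rpow M V k))"
  unfolding pact_def using assms
  by (intro sum.mono_neutral_left) (auto simp: coeff_eq_0)

lemma pact_diff: "pact M V (p - r) = pact M V p - pact M V r"
proof -
  let ?n = "max (degree p) (degree r)"
  have "pact M V (p - r) = (\<Sum>k\<le>?n. mscale (coeff (p - r) k) (rpow M V k))"
    by (rule pact_altdef) (simp add: degree_diff_le_max)
  then show ?thesis
    by (simp add: pact_altdef[of p ?n] pact_altdef[of r ?n] mscale_diff_left sum_subtractf)
qed

lemma pact_smult: "pact M V (smult a p) = mscale a (pact M V p)"
proof -
  have s: "(\<Sum>k\<in>S. mscale a (f k)) = mscale a (sum f S)" for S and f :: "nat \<Rightarrow> complex^'n^'n"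
    by (simp add: mscale_def vec_eq_iff sum_distrib_left)
  show ?thesis
    by (simp add: pact_altdef[of "smult a p" "degree p"] degree_smult_le pact_def mscale_mscale[symmetric] s)
qed

lemma pact_pCons_0: "pact M V (pCons 0 p) = pact M V p ** V"
proof -
  have "pact M V (pCons 0 p) = (\<Sum>k\<le>Suc (degree p). mscale (coeff (pCons 0 p) k) (rpow M V k))"
    by (rule pact_altdef) (rule degree_pCons_le)
  also have "\<dots> = (\<Sum>k\<le>degree p. mscale (coeff p k) (rpow M V k ** V))"
    by (subst sum.atMost_Suc_shift) simp
  also have "\<dots> = pact M V p ** V"
    by (simp add: pact_def bounded_bilinear.sum_left[OF bounded_bilinear_matrix_mul] mscale_mult_left)
  finally show ?thesis .
qed

text \<open>On the matrix side, multiplication by a linear factor is the step from \<open>Y\<close>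
  to \<open>Y (V - c)\<close>; it is used to extract an eigenvector from a root.\<close>

lemma pact_root_factor: "pact M V ([:- c, 1:] * p) = pact M V p ** V - mscale c (pact M V p)"
proof -
  have "[:- c, 1:] * p = pCons 0 p - smult c p" by simp
  then show ?thesis by (simp only: pact_diff pact_smult pact_pCons_0)
qed

text \<open>The \<open>d + 1\<close> matrices \<open>M V^k\<close>, \<open>k \<le> d\<close>, lie in
  a space of real dimension \<open>d\<close>. If they are distinct they form a dependent set; if two
  of them coincide, the set does not show the dependence, and a difference of monomials serves
  instead.\<close>

lemma ex_annihilating_poly:
  fixes M V :: "complex^'n^'n"
  shows "\<exists>p. p \<noteq> 0 \<and> pact M V p = 0"
proof -
  define d where "d = DIM(complex^'n^'n)"
  show ?thesis
  proof (cases "inj_on (rpow M V) {..d}")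
    case False
    then obtain i j where ij: "i \<noteq> j" "rpow M V i = rpow M V j" by (auto simp: inj_on_def)
    have pm: "pact M V (monom 1 k) = rpow M V k" for k
      by (simp add: pact_def degree_monom_eq if_distrib[of "\<lambda>a. mscale a _"] cong: if_cong)
    have "pact M V (monom 1 i - monom 1 j) = 0" unfolding pact_diff pm using ij by simp
    moreover have "monom 1 i - monom 1 j \<noteq> (0 :: complex poly)"
      using ij(1) by (auto simp: poly_eq_iff)
    ultimately show ?thesis by blast
  next
    case True
    then have "card (rpow M V ` {..d}) > d" by (simp add: card_image)
    then have "dependent (rpow M V ` {..d})" by (intro dependent_biggerset) (simp add: d_def)
    then obtain u v where u: "v \<in> rpow M V ` {..d}" "u v \<noteq> 0" "(\<Sum>w\<in>rpow M V ` {..d}. u w *\<^sub>R w) = 0"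
      by (subst (asm) dependent_finite) auto
    obtain k where k: "k \<le> d" "v = rpow M V k" using u by auto
    define p where "p = (\<Sum>k\<le>d. monom (complex_of_real (u (rpow M V k))) k)"
    have c: "coeff p j = (if j \<le> d then of_real (u (rpow M V j)) else 0)" for j
      by (simp add: p_def coeff_sum)
    have "p \<noteq> 0" using k u(2) c[of k] by auto
    have "degree p \<le> d" by (rule degree_le) (simp add: c)
    then have "pact M V p = (\<Sum>k\<le>d. u (rpow M V k) *\<^sub>R rpow M V k)"
      by (simp add: pact_altdef[of p d] c mscale_of_real)
    also have "\<dots> = 0" using u(3) by (simp add: sum.reindex[OF True])
    finally show ?thesis using \<open>p \<noteq> 0\<close> by blast
  qed
qed

text \<open>Any non-zero column of \<open>Y\<close> is an eigenvector.\<close>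

lemma eigenval_if_left_mult:
  assumes "Y \<noteq> 0" "U ** Y = mscale c Y"
  shows "eigenval U c"
proof -
  obtain i j where ij: "Y $ i $ j \<noteq> 0" using assms(1) by (auto simp: vec_eq_iff)
  define v where "v = (\<chi> k. Y $ k $ j)"
  have "v \<noteq> 0" using ij by (auto simp: v_def vec_eq_iff)
  moreover have "(U *v v) $ k = (U ** Y) $ k $ j" for k
    by (simp add: v_def matrix_vector_mult_def matrix_matrix_mult_def)
  then have "U *v v = c *s v"
    unfolding assms(2) by (simp add: vec_eq_iff mscale_def v_def)
  ultimately show ?thesis unfolding eigenval_def by blast
qed

text \<open>The rows of \<open>Y\<close> are only left eigenvectors. Instead of transposing, one
  observes that if \<open>V - c\<close> had trivial kernel it would be invertible, and
  \<open>Y (V - c) = 0\<close> would give \<open>Y = 0\<close>.\<close>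

lemma eigenval_if_right_mult:
  assumes "Y \<noteq> 0" "Y ** V = mscale c Y"
  shows "eigenval V c"
proof (rule ccontr)
  assume nev: "\<not> eigenval V c"
  define W where "W = V - mscale c (mat 1)"
  have "x = 0" if "W *v x = 0" for x
  proof -
    have "V *v x = c *s x"
      using that by (simp add: W_def matrix_vector_mult_diff_rdistrib mscale_mult_vec)
    then show ?thesis using nev unfolding eigenval_def by blast
  qed
  then obtain B where "B ** W = mat 1" using matrix_left_invertible_ker[of W] by blast
  then have B: "W ** B = mat 1" by (simp add: matrix_left_right_inverse)
  have "Y ** W = 0"
    unfolding W_def bounded_bilinear.diff_right[OF bounded_bilinear_matrix_mul] mscale_mult_right assms(2) by simp
  then have "Y ** (W ** B) = 0" by (simp add: matrix_mul_assoc bounded_bilinear.zero_left[OF bounded_bilinear_matrix_mul])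
  then show False using assms(1) B by simp
qed

text \<open>
  The solutions $M$ of $UM = MV$ form a space stable under $M \mapsto MV$; an eigenvector $Y$ of this
  map satisfies $UY = YV = cY$.
\<close>

lemma sylvester_unique:
  fixes M U V :: "complex^'n^'n"
  assumes eq: "U ** M = M ** V" and nev: "\<And>c. eigenval U c \<Longrightarrow> eigenval V c \<Longrightarrow> False"
  shows "M = 0"
proof (rule ccontr)
  assume M: "M \<noteq> 0"
  \<comment> \<open>An annihilating polynomial of minimal degree: dividing a root \<open>c\<close>
    out of it leaves a \<open>g\<close> that no longer annihilates, so \<open>Y = M g(V)\<close> is
    non-zero and satisfies \<open>Y V = c Y\<close>.\<close>
  obtain p where p: "p \<noteq> 0" "pact M V p = 0"
    and min: "\<And>g. g \<noteq> 0 \<Longrightarrow> pact M V g = 0 \<Longrightarrow> degree p \<le> degree g"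
    using ex_has_least_nat[of "\<lambda>p. p \<noteq> 0 \<and> pact M V p = 0" _ degree] ex_annihilating_poly[of M V] by metis
  have "degree p \<noteq> 0"
  proof
    assume d: "degree p = 0"
    then have "mscale (coeff p 0) M = 0" using p(2) by (simp add: pact_def)
    then show False using M p(1) d by (auto simp: mscale_eq_0_iff leading_coeff_0_iff[symmetric])
  qed
  then have "\<exists>i\<in>{1..degree p}. coeff p i \<noteq> 0"
    using p(1) by (intro bexI[of _ "degree p"]) auto
  then obtain c where "poly p c = 0"
    using fundamental_theorem_of_algebra[of "coeff p" "degree p"] by (auto simp: poly_altdef)
  then obtain g where g: "p = [:- c, 1:] * g" by (metis dvdE poly_eq_0_iff_dvd)
  have g0: "g \<noteq> 0" using g p(1) by auto
  have "degree p = Suc (degree g)" unfolding g using g0 by (subst degree_mult_eq) auto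
  then have Y0: "pact M V g \<noteq> 0" using min[of g] g0 by auto
  have YV: "pact M V g ** V = mscale c (pact M V g)"
    using p(2) unfolding g pact_root_factor by simp
  have U: "U ** rpow M V k = rpow M V k ** V" for k
    by (induction k) (simp_all add: eq matrix_mul_assoc)
  have "U ** pact M V g = pact M V g ** V"
    unfolding pact_def bounded_bilinear.sum_left[OF bounded_bilinear_matrix_mul]
      bounded_bilinear.sum_right[OF bounded_bilinear_matrix_mul] by (simp add: mscale_mult_left mscale_mult_right U)
  then show False using nev[of c] eigenval_if_left_mult[OF Y0] eigenval_if_right_mult[OF Y0] YV by metis
qed

lemma linear_sylvester: "linear (\<lambda>M :: complex^'n^'n. U ** M - M ** V)"
  using bounded_bilinear_matrix_mul[unfolded bilinear_conv_bounded_bilinear[symmetric] bilinear_def, where ?'n = 'n]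
  by (intro linear_compose_sub) auto

text \<open>The limit operator \<open>T\<close> is injective, hence bounded below by some
  \<open>B > 0\<close>. Once the perturbation \<open>\<kappa> i\<close> is below
  \<open>B / 2\<close>, the perturbed operators are bounded below by \<open>B / 2\<close>; so the
  solutions \<open>M i\<close> converge without an a priori bound on them.\<close>

lemma sylvester_tendsto:
  fixes M U V :: "'i \<Rightarrow> complex^'n^'n"
  assumes U: "(U \<longlongrightarrow> U0) \<Phi>" and V: "(V \<longlongrightarrow> V0) \<Phi>"
    and R: "((\<lambda>i. U i ** M i - M i ** V i) \<longlongrightarrow> U0 ** M0 - M0 ** V0) \<Phi>"
    and nev: "\<And>c. eigenval U0 c \<Longrightarrow> eigenval V0 c \<Longrightarrow> False"
  shows "(M \<longlongrightarrow> M0) \<Phi>"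
proof -
  define T where "T X = U0 ** X - X ** V0" for X
  interpret bb: bounded_bilinear "(**) :: complex^'n^'n \<Rightarrow> complex^'n^'n \<Rightarrow> complex^'n^'n"
    by (rule bounded_bilinear_matrix_mul)
  have lin: "linear T" unfolding T_def[abs_def] by (rule linear_sylvester)
  have "inj T"
    unfolding linear_injective_0[OF lin] T_def by (auto intro: sylvester_unique[OF _ nev, of U0 _ V0])
  then obtain B where B: "B > 0" "\<And>X. B * norm X \<le> norm (T X)"
    using linear_inj_bounded_below_pos[OF lin] by blast
  obtain K where K': "K > 0" "\<forall>(X :: complex^'n^'n) (Y :: complex^'n^'n). norm (X ** Y) \<le> norm X * norm Y * K"
    using bb.pos_bounded by (elim exE conjE)
  note K = K'(1) K'(2)[rule_format]
  define \<kappa> where "\<kappa> i = K * (norm (U i - U0) + norm (V i - V0))" for i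
  have \<kappa>: "norm ((U i ** X - X ** V i) - T X) \<le> \<kappa> i * norm X" for i X
  proof -
    have "(U i ** X - X ** V i) - T X = (U i - U0) ** X - X ** (V i - V0)"
      by (simp add: T_def bb.diff_left bb.diff_right)
    then have "norm ((U i ** X - X ** V i) - T X) \<le> norm ((U i - U0) ** X) + norm (X ** (V i - V0))"
      using norm_triangle_ineq4 by metis
    also have "\<dots> \<le> \<kappa> i * norm X"
      using K(2)[of "U i - U0" X] K(2)[of X "V i - V0"] by (simp add: \<kappa>_def algebra_simps)
    finally show ?thesis .
  qed
  have "((\<lambda>i. K * (norm (U i - U0) + norm (V i - V0))) \<longlongrightarrow> K * (norm (U0 - U0) + norm (V0 - V0))) \<Phi>"
    by (intro tendsto_intros U V)
  then have \<kappa>0: "(\<kappa> \<longlongrightarrow> 0) \<Phi>" by (simp add: \<kappa>_def[abs_def])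
  define R where "R i = norm ((U i ** M i - M i ** V i) - (U0 ** M0 - M0 ** V0))" for i
  have "((\<lambda>i. R i + \<kappa> i * norm M0) \<longlongrightarrow> 0 + 0 * norm M0) \<Phi>"
    unfolding R_def by (intro tendsto_add tendsto_mult \<kappa>0 tendsto_const tendsto_norm_zero) (use assms(3) in \<open>simp add: LIM_zero\<close>)
  then have lim: "((\<lambda>i. 2 / B * (R i + \<kappa> i * norm M0)) \<longlongrightarrow> 0) \<Phi>"
    by (intro tendsto_mult_right_zero) simp
  have "\<forall>\<^sub>F i in \<Phi>. \<kappa> i < B / 2"
    using \<kappa>0 B(1) by (intro order_tendstoD) auto
  then have "\<forall>\<^sub>F i in \<Phi>. norm (M i - M0) \<le> 2 / B * (R i + \<kappa> i * norm M0)"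
  proof eventually_elim
    case (elim i)
    let ?X = "M i - M0"
    have "B * norm ?X \<le> norm (T ?X)" by (rule B)
    also have "\<dots> \<le> norm (U i ** ?X - ?X ** V i) + \<kappa> i * norm ?X"
      using \<kappa>[of i ?X] norm_triangle_ineq2[of "T ?X" "U i ** ?X - ?X ** V i"] by (simp add: norm_minus_commute)
    \<comment> \<open>With \<open>T_i\<close> the operator of index \<open>i\<close>, this is
      \<open>T_i (M i - M0) = (T_i (M i) - T M0) - (T_i M0 - T M0)\<close>. The first difference
      tends to 0 by hypothesis, the second is at most \<open>\<kappa> i * norm M0\<close>.\<close>
    also have "U i ** ?X - ?X ** V i = ((U i ** M i - M i ** V i) - (U0 ** M0 - M0 ** V0)) - ((U i ** M0 - M0 ** V i) - T M0)"
      by (simp add: T_def bb.diff_left bb.diff_right)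
    also have "norm \<dots> \<le> R i + \<kappa> i * norm M0"
      unfolding R_def using \<kappa>[of i M0] norm_triangle_ineq4 add_left_mono order_trans by blast
    also have "\<kappa> i * norm ?X \<le> B / 2 * norm ?X" using elim by (intro mult_right_mono) auto
    finally have "B / 2 * norm ?X \<le> R i + \<kappa> i * norm M0" by simp
    then show ?case using B(1) by (simp add: field_simps)
  qed
  then have "((\<lambda>i. M i - M0) \<longlongrightarrow> 0) \<Phi>" by (rule Lim_null_comparison[OF _ lim])
  then show ?thesis by (rule LIM_zero_cancel)
qed


section \<open>Recursion for the gauge transformation\<close>

text \<open>
  Linear operators on power series are given by the images $b_n$ of the monomials $z^n$, where $b_n$
  has order at least $n$.
\<close>

definition fps_op :: "(nat \<Rightarrow> complex fps) \<Rightarrow> complex fps \<Rightarrow> complex fps" where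
  "fps_op b f = Abs_fps (\<lambda>N. \<Sum>n\<le>N. fps_nth f n * fps_nth (b n) N)"

lemma fps_op_nth: "fps_nth (fps_op b f) N = (\<Sum>n\<le>N. fps_nth f n * fps_nth (b n) N)"
  by (simp add: fps_op_def)

text \<open>Because \<open>b n\<close> starts at order \<open>n\<close>, the truncated sums may all
  run to the same bound and be exchanged with the Cauchy product.\<close>

lemma fps_mult_fps_op:
  assumes "\<And>n k. k < n \<Longrightarrow> fps_nth (b n) k = 0"
  shows "w * fps_op b f = fps_op (\<lambda>n. w * b n) f"
proof (rule fps_ext)
  fix N
  have inner: "(\<Sum>n\<le>N - i. fps_nth f n * fps_nth (b n) (N - i)) = (\<Sum>n\<le>N. fps_nth f n * fps_nth (b n) (N - i))" for i
    using assms by (intro sum.mono_neutral_left) auto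
  have "fps_nth (w * fps_op b f) N = (\<Sum>i=0..N. fps_nth w i * (\<Sum>n\<le>N. fps_nth f n * fps_nth (b n) (N - i)))"
    unfolding fps_mult_nth fps_op_nth inner ..
  also have "\<dots> = (\<Sum>n\<le>N. \<Sum>i=0..N. fps_nth w i * (fps_nth f n * fps_nth (b n) (N - i)))"
    unfolding sum_distrib_left by (rule sum.swap)
  also have "\<dots> = fps_nth (fps_op (\<lambda>n. w * b n) f) N"
    by (simp add: fps_op_nth fps_mult_nth sum_distrib_left mult_ac)
  finally show "fps_nth (w * fps_op b f) N = fps_nth (fps_op (\<lambda>n. w * b n) f) N" .
qed

text \<open>The unit \<open>v\<close> for which \<open>px - ph\<close> in place of \<open>x\<close>
  amounts to \<open>z v\<close> in place of \<open>z\<close>.\<close>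

definition sub_ratio :: "real \<Rightarrow> real \<Rightarrow> complex fps" where
  "sub_ratio q h = fps_const (of_real q) * inverse (1 - fps_const (of_real h) * fps_X)"

lemma shift_fps_eq_fps_op:
  "shift_fps q h = fps_op (\<lambda>n. fps_X ^ n * sub_ratio q h ^ n)"
proof
  fix f
  have *: "fps_const (of_real q) * fps_X / (1 - fps_const (of_real h) * fps_X) = fps_X * sub_ratio q h"
    by (subst fps_divide_unit) (simp_all add: sub_ratio_def mult_ac)
  show "shift_fps q h f = fps_op (\<lambda>n. fps_X ^ n * sub_ratio q h ^ n) f"
    unfolding shift_fps_def * by (simp add: fps_eq_iff fps_compose_nth fps_op_nth atLeast0AtMost power_mult_distrib)
qed

text \<open>
  With $v = q/(1-hz)$ the operator sends $z^n$ to $-z^n(1 + v + \dots + v^{n-1})$, also for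
  $(q,h) = (1,0)$.
\<close>

definition delta_image :: "real \<Rightarrow> real \<Rightarrow> nat \<Rightarrow> complex fps" where
  "delta_image q h n = - (fps_X ^ n * (\<Sum>j<n. sub_ratio q h ^ j))"

text \<open>With \<open>u = 1 - h z\<close> one has \<open>u v = q\<close>, so the denominator is
  \<open>W = - p u (v - 1)\<close>, and the geometric sum turns \<open>W * b n\<close> into the
  numerator at \<open>z^n\<close>. The division is performed by cancelling \<open>W\<close>, which
  need not be a unit. It vanishes only at \<open>(1, 0)\<close>, where \<open>v = 1\<close> and the
  image of \<open>z^n\<close> is \<open>- n z^n\<close>.\<close>

lemma delta_fps_eq_fps_op:
  assumes q: "q \<ge> 1"
  shows "delta_fps q h = fps_op (delta_image q h)"
proof
  fix f
  define u where "u = (1 - fps_const (of_real h) * fps_X :: complex fps)"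
  define v where "v = sub_ratio q h"
  define b where "b = delta_image q h"
  have uv: "u * v = fps_const (of_real q)"
  proof -
    have "u * inverse u = 1" by (rule inverse_mult_eq_1') (simp add: u_def)
    then show ?thesis unfolding v_def sub_ratio_def u_def[symmetric] by (simp add: mult.left_commute)
  qed
  show "delta_fps q h f = fps_op b f"
  proof (cases "(q, h) = (1, 0)")
    case True
    then have "v = 1" by (simp add: v_def sub_ratio_def)
    then have bn: "b n = - (fps_X ^ n * fps_const (of_nat n))" for n
      by (simp add: b_def delta_image_def v_def fps_of_nat)
    have "fps_nth (- (fps_X * fps_deriv f)) N = fps_nth (fps_op b f) N" for N
      by (cases N) (simp_all add: fps_op_nth bn if_distrib[of "\<lambda>a. _ * a"] fps_X_power_mult_nth cong: if_cong)
    then show ?thesis using True by (simp add: delta_fps_def fps_eq_iff)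
  next
    case False
    define p where "p = complex_of_real (1 / q)"
    define W where "W = fps_const (p - 1) - fps_const (p * of_real h) * fps_X"
    have pq: "p * of_real q = 1" using q by (simp add: p_def)
    have "fps_const p * u * (v - 1) = fps_const p * (u * v) - fps_const p * u"
      by (simp add: algebra_simps)
    also have "\<dots> = - W"
      unfolding W_def uv fps_const_mult pq
      by (simp add: u_def algebra_simps flip: fps_const_sub fps_const_mult)
    finally have W: "W = - (fps_const p * u * (v - 1))" by simp
    have "W \<noteq> 0"
    proof
      assume "W = 0"
      then have "fps_nth W 0 = 0" "fps_nth W 1 = 0" by simp_all
      then have "p = 1" "p * of_real h = 0" by (simp_all add: W_def)
      then show False using False pq by simp
    qed
    have Wb: "W * b n = fps_const p * u * (fps_X ^ n * v ^ n - fps_X ^ n)" for n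
    proof -
      have "W * b n = fps_const p * u * fps_X ^ n * ((v - 1) * (\<Sum>j<n. v ^ j))"
        unfolding W b_def delta_image_def v_def[symmetric] by (simp only: mult_minus_left mult_minus_right minus_minus mult_ac)
      then show ?thesis unfolding power_diff_1_eq[symmetric] by (simp add: algebra_simps)
    qed
    have sf: "shift_fps q h f - f = fps_op (\<lambda>n. fps_X ^ n * v ^ n - fps_X ^ n) f"
      unfolding shift_fps_eq_fps_op v_def
      by (simp add: fps_eq_iff fps_op_nth right_diff_distrib sum_subtractf if_distrib[of "\<lambda>a. _ * a"] cong: if_cong)
    have low: "fps_nth (b n) k = 0" "fps_nth (fps_X ^ n * v ^ n - fps_X ^ n) k = 0" if "k < n" for n k
      using that by (simp_all add: b_def delta_image_def fps_X_power_mult_nth)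
    have "W * fps_op b f = fps_op (\<lambda>n. W * b n) f"
      by (rule fps_mult_fps_op) (simp add: low)
    also have "\<dots> = fps_const p * u * (shift_fps q h f - f)"
      unfolding sf Wb by (rule fps_mult_fps_op[symmetric]) (simp add: low del: fps_sub_nth)
    finally have "delta_fps q h f = W * fps_op b f / W"
      using False by (auto simp: delta_fps_def Let_def p_def u_def W_def)
    then show ?thesis using \<open>W \<noteq> 0\<close> by simp
  qed
qed

section \<open>Coefficientwise convergence of formal power series\<close>

definition fps_tendsto :: "('i \<Rightarrow> complex fps) \<Rightarrow> complex fps \<Rightarrow> 'i filter \<Rightarrow> bool" where
  "fps_tendsto f g \<Phi> \<longleftrightarrow> (\<forall>n. ((\<lambda>i. fps_nth (f i) n) \<longlongrightarrow> fps_nth g n) \<Phi>)"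

lemma fps_tendsto_const: "fps_tendsto (\<lambda>_. f) f \<Phi>"
  by (simp add: fps_tendsto_def)

lemma fps_tendsto_fps_const: "(a \<longlongrightarrow> a0) \<Phi> \<Longrightarrow> fps_tendsto (\<lambda>i. fps_const (a i)) (fps_const a0) \<Phi>"
  by (simp add: fps_tendsto_def)

lemma fps_tendsto_uminus: "fps_tendsto f f0 \<Phi> \<Longrightarrow> fps_tendsto (\<lambda>i. - f i) (- f0) \<Phi>"
  by (simp add: fps_tendsto_def tendsto_minus)

lemma fps_tendsto_mult:
  "fps_tendsto f f0 \<Phi> \<Longrightarrow> fps_tendsto g g0 \<Phi> \<Longrightarrow> fps_tendsto (\<lambda>i. f i * g i) (f0 * g0) \<Phi>"
  unfolding fps_tendsto_def fps_mult_nth by (intro allI tendsto_sum tendsto_mult) auto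

lemma fps_tendsto_sum:
  "(\<And>k. k \<in> S \<Longrightarrow> fps_tendsto (f k) (f0 k) \<Phi>) \<Longrightarrow> fps_tendsto (\<lambda>i. \<Sum>k\<in>S. f k i) (\<Sum>k\<in>S. f0 k) \<Phi>"
  unfolding fps_tendsto_def fps_sum_nth by (intro allI tendsto_sum) auto

lemma fps_tendsto_prod:
  "(\<And>k. k \<in> S \<Longrightarrow> fps_tendsto (f k) (f0 k) \<Phi>) \<Longrightarrow> fps_tendsto (\<lambda>i. \<Prod>k\<in>S. f k i) (\<Prod>k\<in>S. f0 k) \<Phi>"
  by (induction S rule: infinite_finite_induct) (auto intro: fps_tendsto_const fps_tendsto_mult)

lemma fps_tendsto_power: "fps_tendsto f f0 \<Phi> \<Longrightarrow> fps_tendsto (\<lambda>i. f i ^ n) (f0 ^ n) \<Phi>"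
  by (induction n) (auto intro: fps_tendsto_const fps_tendsto_mult)

text \<open>The geometric series displays every coefficient of the inverse as a rational function of
  \<open>a\<close> and \<open>b\<close>, from which continuity in the parameters is read
  off.\<close>

lemma fps_inverse_linear:
  assumes "a \<noteq> 0"
  shows "inverse (fps_const a + fps_const b * fps_X) = Abs_fps (\<lambda>n. (- b / a) ^ n / (a :: complex))"
proof (rule fps_inverse_unique, rule fps_ext)
  fix n
  show "fps_nth ((fps_const a + fps_const b * fps_X) * Abs_fps (\<lambda>n. (- b / a) ^ n / a)) n = fps_nth 1 n"
  proof -
    have "fps_nth ((fps_const a + fps_const b * fps_X) * Abs_fps (\<lambda>n. (- b / a) ^ n / a)) n
        = a * ((- b / a) ^ n / a) + b * (if n = 0 then 0 else (- b / a) ^ (n - 1) / a)"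
      by (simp add: distrib_right mult.assoc)
    also have "\<dots> = fps_nth 1 n"
      using assms by (cases n) simp_all
    finally show ?thesis .
  qed
qed

lemma fps_tendsto_inverse_linear:
  assumes "(a \<longlongrightarrow> a0) \<Phi>" "(b \<longlongrightarrow> b0) \<Phi>" "a0 \<noteq> 0"
  shows "fps_tendsto (\<lambda>i. inverse (fps_const (a i) + fps_const (b i) * fps_X)) (inverse (fps_const a0 + fps_const b0 * fps_X)) \<Phi>"
  unfolding fps_tendsto_def
proof
  fix n
  have "((\<lambda>i. (- b i / a i) ^ n / a i) \<longlongrightarrow> (- b0 / a0) ^ n / a0) \<Phi>"
    by (intro tendsto_intros assms)
  moreover have "\<forall>\<^sub>F i in \<Phi>. a i \<noteq> 0" using assms by (intro tendsto_imp_eventually_ne)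
  then have "\<forall>\<^sub>F i in \<Phi>. (- b i / a i) ^ n / a i = fps_nth (inverse (fps_const (a i) + fps_const (b i) * fps_X)) n"
    by eventually_elim (simp add: fps_inverse_linear)
  ultimately show "((\<lambda>i. fps_nth (inverse (fps_const (a i) + fps_const (b i) * fps_X)) n) \<longlongrightarrow>
      fps_nth (inverse (fps_const a0 + fps_const b0 * fps_X)) n) \<Phi>"
    using assms(3) by (simp add: fps_inverse_linear tendsto_cong)
qed

lemma fps_tendsto_sub_ratio:
  assumes "(q \<longlongrightarrow> q0) \<Phi>" "(h \<longlongrightarrow> h0) \<Phi>"
  shows "fps_tendsto (\<lambda>i. sub_ratio (q i) (h i)) (sub_ratio q0 h0) \<Phi>"
proof -
  have *: "1 - fps_const (of_real h) * fps_X = fps_const 1 + fps_const (- of_real h :: complex) * fps_X" for h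
    by (simp flip: fps_const_neg)
  show ?thesis unfolding sub_ratio_def *
    by (intro fps_tendsto_mult fps_tendsto_fps_const fps_tendsto_inverse_linear tendsto_intros assms) auto
qed

lemma inv_fact_fps_altdef:
  assumes "q \<ge> 1"
  shows "inv_fact_fps q h s =
    (\<Prod>k<s. fps_X * inverse (fps_const (of_real q ^ k) + fps_const (of_real (h * qnum q k)) * fps_X))"
  unfolding inv_fact_fps_def using assms
  by (intro prod.cong refl) (subst fps_divide_unit; simp add: qbracket_of_nat)

lemma fps_tendsto_inv_fact:
  assumes "(q \<longlongrightarrow> q0) \<Phi>" "(h \<longlongrightarrow> h0) \<Phi>" "\<forall>\<^sub>F i in \<Phi>. q i \<ge> 1" "q0 \<ge> 1"
  shows "fps_tendsto (\<lambda>i. inv_fact_fps (q i) (h i) s) (inv_fact_fps q0 h0 s) \<Phi>"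
proof -
  have qn: "((\<lambda>i. qnum (q i) k) \<longlongrightarrow> qnum q0 k) \<Phi>" for k
    unfolding qnum_def by (intro tendsto_intros assms)
  have "fps_tendsto (\<lambda>i. \<Prod>k<s. fps_X * inverse (fps_const (of_real (q i) ^ k) + fps_const (of_real (h i * qnum (q i) k)) * fps_X))
      (inv_fact_fps q0 h0 s) \<Phi>"
    unfolding inv_fact_fps_altdef[OF assms(4)]
    by (intro fps_tendsto_prod fps_tendsto_mult fps_tendsto_const fps_tendsto_inverse_linear tendsto_intros assms qn)
      (use assms in auto)
  then show ?thesis unfolding fps_tendsto_def
    by (elim all_forward tendsto_cong[THEN iffD1, rotated], use assms(3) in eventually_elim) (simp add: inv_fact_fps_altdef)
qed

lemma inv_fact_fps_factor:
  assumes "q \<ge> 1"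
  shows "inv_fact_fps q h s = fps_X ^ s * (\<Prod>k<s. inverse (fps_const (of_real q ^ k) + fps_const (of_real (h * qnum q k)) * fps_X))"
  unfolding inv_fact_fps_altdef[OF assms] prod.distrib by simp

text \<open>The passage from coefficients of factorials to coefficients of powers of
  \<open>z\<close> is triangular with these numbers on the diagonal; as they do not vanish, the
  factorial coefficients can be recovered.\<close>

lemma inv_fact_fps_nth_self:
  assumes "q \<ge> 1"
  shows "fps_nth (inv_fact_fps q h s) s \<noteq> 0"
proof -
  have "fps_nth (\<Prod>k\<in>S. f k) 0 = (\<Prod>k\<in>S. fps_nth (f k) 0)" for S :: "nat set" and f :: "nat \<Rightarrow> complex fps"
    by (induction S rule: infinite_finite_induct) auto
  then show ?thesis
    unfolding inv_fact_fps_factor[OF assms] fps_X_power_mult_nth using assms by simp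
qed

lemma inv_fact_fps_0 [simp]: "inv_fact_fps q h 0 = 1"
  by (simp add: inv_fact_fps_def)

definition zcoeff :: "real \<Rightarrow> real \<Rightarrow> (nat \<Rightarrow> complex^'n^'n) \<Rightarrow> nat \<Rightarrow> complex^'n^'n" where
  "zcoeff q h A N = (\<Sum>s\<le>N. mscale (fps_nth (inv_fact_fps q h s) N) (A s))"

lemma zcoeff_0 [simp]: "zcoeff q h A 0 = A 0"
  by (simp add: zcoeff_def)

lemma fseries_fps_nth: "fps_nth (fseries_fps q h A $ i $ j) N = zcoeff q h A N $ i $ j"
  by (simp add: fseries_fps_def zcoeff_def mscale_def mult.commute)

text \<open>The identity $A F - \delta F = F(px-ph) A_0$ at $z^N$, with the unknown coefficient of $F$ on the left.\<close>

lemma canonical_gauge_recursion: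
  assumes q: "q \<ge> 1" and g: "canonical_gauge q h A F"
  defines "a \<equiv> zcoeff q h A" and "f \<equiv> zcoeff q h F"
  shows "(A 0 + mscale (of_real (qnum q N)) (mat 1)) ** f N - f N ** mscale (of_real q ^ N) (A 0) =
    (\<Sum>n<N. mscale (fps_nth (fps_X ^ n * sub_ratio q h ^ n) N) (f n) ** A 0
        + mscale (fps_nth (delta_image q h n) N) (f n) - a (N - n) ** f n)"
    (is "?L = ?R")
proof -
  define MA where "MA = fseries_fps q h A"
  define MF where "MF = fseries_fps q h F"
  define S where "S = map_entries (shift_fps q h) MF"
  define Rm where "Rm = MA ** MF - map_entries (delta_fps q h) MF"
  have inv: "invertible S" and eq: "matrix_inv S ** Rm = map_entries fps_const (A 0)"
    using g by (auto simp: canonical_gauge_def gauge_fps_def S_def Rm_def MA_def MF_def)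
  \<comment> \<open>The gauge equation is multiplied by the shifted matrix, which frees the
    recursion from the inverse.\<close>
  have "S ** matrix_inv S = mat 1"
    using inv unfolding invertible_def matrix_inv_def by (rule someI2_ex) simp
  then have Rm: "Rm = S ** map_entries fps_const (A 0)"
    unfolding eq[symmetric] matrix_mul_assoc by simp
  let ?sh = "\<lambda>n. fps_nth (fps_X ^ n * sub_ratio q h ^ n) N" and ?dl = "\<lambda>n. fps_nth (delta_image q h n) N"
  have key: "(\<Sum>n\<le>N. a (N - n) ** f n) - (\<Sum>n\<le>N. mscale (?dl n) (f n)) = (\<Sum>n\<le>N. mscale (?sh n) (f n) ** A 0)"
  proof -
    have "((\<Sum>n\<le>N. a (N - n) ** f n) - (\<Sum>n\<le>N. mscale (?dl n) (f n))) $ i $ j = (\<Sum>n\<le>N. mscale (?sh n) (f n) ** A 0) $ i $ j" for i j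
    proof -
      have "fps_nth (Rm $ i $ j) N = (\<Sum>k\<in>UNIV. fps_nth (MA $ i $ k * MF $ k $ j) N) - fps_nth (delta_fps q h (MF $ i $ j)) N"
        by (simp add: Rm_def matrix_matrix_mult_def map_entries_def fps_sum_nth)
      also have "(\<Sum>k\<in>UNIV. fps_nth (MA $ i $ k * MF $ k $ j) N) = (\<Sum>k\<in>UNIV. \<Sum>n\<le>N. a (N - n) $ i $ k * f n $ k $ j)"
        unfolding mult.commute[of "MA $ _ $ _"] fps_mult_nth
        by (simp add: MA_def MF_def fseries_fps_nth a_def f_def atLeast0AtMost mult.commute)
      also have "\<dots> = (\<Sum>n\<le>N. a (N - n) ** f n) $ i $ j"
        by (subst sum.swap) (simp add: matrix_matrix_mult_def)
      also have "fps_nth (delta_fps q h (MF $ i $ j)) N = (\<Sum>n\<le>N. mscale (?dl n) (f n)) $ i $ j"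
        by (simp add: delta_fps_eq_fps_op[OF q] fps_op_nth MF_def fseries_fps_nth f_def mscale_def mult.commute)
      finally have l: "fps_nth (Rm $ i $ j) N = ((\<Sum>n\<le>N. a (N - n) ** f n) - (\<Sum>n\<le>N. mscale (?dl n) (f n))) $ i $ j"
        by simp
      have "fps_nth (Rm $ i $ j) N = (\<Sum>k\<in>UNIV. fps_nth (S $ i $ k) N * A 0 $ k $ j)"
        by (simp add: Rm matrix_matrix_mult_def map_entries_def fps_sum_nth)
      also have "\<dots> = (\<Sum>k\<in>UNIV. \<Sum>n\<le>N. mscale (?sh n) (f n) $ i $ k * A 0 $ k $ j)"
        by (simp add: S_def map_entries_def shift_fps_eq_fps_op fps_op_nth MF_def fseries_fps_nth f_def mscale_def
            sum_distrib_left sum_distrib_right mult_ac)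
      also have "\<dots> = (\<Sum>n\<le>N. mscale (?sh n) (f n) ** A 0) $ i $ j"
        by (subst sum.swap) (simp add: matrix_matrix_mult_def)
      finally show ?thesis using l by simp
    qed
    then show ?thesis by (simp add: vec_eq_iff)
  qed
  have v0: "fps_nth (sub_ratio q h ^ j) 0 = of_real q ^ j" for j
    by (simp add: sub_ratio_def fps_nth_power_0)
  \<comment> \<open>At \<open>n = N\<close> the shift contributes \<open>q^N\<close> and the
    operator contributes minus the bracket of \<open>N\<close>; these diagonal values form the
    Sylvester operator.\<close>
  have shN: "?sh N = of_real q ^ N" by (simp add: fps_X_power_mult_nth v0)
  have dlN: "?dl N = - of_real (qnum q N)"
    by (simp add: delta_image_def fps_X_power_mult_nth fps_sum_nth v0 qnum_def)
  have at: "{..N} = insert N {..<N}" by auto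
  have a0: "a 0 = A 0" by (simp add: a_def)
  have "?L = (a (N - N) ** f N - mscale (?dl N) (f N)) - mscale (?sh N) (f N) ** A 0"
    unfolding shN dlN by (simp add: a0 bounded_bilinear.add_left[OF bounded_bilinear_matrix_mul] mscale_mult_left mscale_mult_right)
      (simp add: mscale_def vec_eq_iff)
  also have "\<dots> = ?R"
    using key unfolding at by (simp add: sum_subtractf sum.distrib) (simp add: algebra_simps)
  finally show ?thesis .
qed

lemma tendsto_mscale:
  "(a \<longlongrightarrow> a0) \<Phi> \<Longrightarrow> (A \<longlongrightarrow> A0) \<Phi> \<Longrightarrow> ((\<lambda>i. mscale (a i) (A i)) \<longlongrightarrow> mscale a0 A0) \<Phi>"
  unfolding mscale_def by (intro tendsto_intros)

lemma zcoeff_tendsto: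
  assumes "(q \<longlongrightarrow> q0) \<Phi>" "(h \<longlongrightarrow> h0) \<Phi>" "\<forall>\<^sub>F i in \<Phi>. q i \<ge> 1" "q0 \<ge> 1"
    and "\<And>s. s \<le> N \<Longrightarrow> ((\<lambda>i. A i s) \<longlongrightarrow> A0 s) \<Phi>"
  shows "((\<lambda>i. zcoeff (q i) (h i) (A i) N) \<longlongrightarrow> zcoeff q0 h0 A0 N) \<Phi>"
  unfolding zcoeff_def using fps_tendsto_inv_fact[OF assms(1-4)] assms(5)
  by (intro tendsto_sum tendsto_mscale) (auto simp: fps_tendsto_def)

text \<open>Strong induction on the factorial coefficients: those below \<open>N\<close> determine
  the coefficients of \<open>z^n\<close> for \<open>n < N\<close>, the Sylvester equation yields the
  limit at \<open>z^N\<close>, and triangularity returns the factorial coefficient of index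
  \<open>N\<close>.\<close>

lemma canonical_gauge_tendsto:
  fixes A F :: "'i \<Rightarrow> nat \<Rightarrow> complex^'n^'n"
  assumes lim: "(q \<longlongrightarrow> q0) \<Phi>" "(h \<longlongrightarrow> h0) \<Phi>" "\<forall>\<^sub>F i in \<Phi>. q i \<ge> 1" "q0 \<ge> 1"
    and A: "\<And>s. ((\<lambda>i. A i s) \<longlongrightarrow> A0 s) \<Phi>"
    and g: "\<forall>\<^sub>F i in \<Phi>. canonical_gauge (q i) (h i) (A i) (F i)"
    and g0: "canonical_gauge q0 h0 A0 F0"
    and nr: "nonresonant {(q0, h0)} (\<lambda>_ _. A0)"
  shows "((\<lambda>i. F i s) \<longlongrightarrow> F0 s) \<Phi>"
proof (induction s rule: less_induct)
  case (less N)
  show ?case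
  proof (cases "N = 0")
    case True
    have "\<forall>\<^sub>F i in \<Phi>. F i 0 = F0 0"
      using g by eventually_elim (use g0 in \<open>simp add: canonical_gauge_def\<close>)
    then show ?thesis unfolding True by (rule tendsto_eventually)
  next
    case False
    have qn: "((\<lambda>i. qnum (q i) N) \<longlongrightarrow> qnum q0 N) \<Phi>"
      unfolding qnum_def by (intro tendsto_intros lim)
    note bb = bounded_bilinear.tendsto[OF bounded_bilinear_matrix_mul]
    let ?Ui = "\<lambda>i. A i 0 + mscale (of_real (qnum (q i) N)) (mat 1)" and ?Vi = "\<lambda>i. mscale (of_real (q i) ^ N) (A i 0)"
    let ?Ulim = "A0 0 + mscale (of_real (qnum q0 N)) (mat 1)" and ?Vlim = "mscale (of_real q0 ^ N) (A0 0)"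
    have sr: "fps_tendsto (\<lambda>i. sub_ratio (q i) (h i) ^ j) (sub_ratio q0 h0 ^ j) \<Phi>" for j
      by (intro fps_tendsto_power fps_tendsto_sub_ratio lim)
    have "fps_tendsto (\<lambda>i. fps_X ^ n * sub_ratio (q i) (h i) ^ n) (fps_X ^ n * sub_ratio q0 h0 ^ n) \<Phi>" for n
      by (intro fps_tendsto_mult fps_tendsto_const sr)
    then have sh: "((\<lambda>i. fps_nth (fps_X ^ n * sub_ratio (q i) (h i) ^ n) N) \<longlongrightarrow> fps_nth (fps_X ^ n * sub_ratio q0 h0 ^ n) N) \<Phi>" for n
      by (simp add: fps_tendsto_def)
    have "fps_tendsto (\<lambda>i. delta_image (q i) (h i) n) (delta_image q0 h0 n) \<Phi>" for n
      unfolding delta_image_def by (intro fps_tendsto_uminus fps_tendsto_mult fps_tendsto_sum fps_tendsto_const sr)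
    then have dl: "((\<lambda>i. fps_nth (delta_image (q i) (h i) n) N) \<longlongrightarrow> fps_nth (delta_image q0 h0 n) N) \<Phi>" for n
      by (simp add: fps_tendsto_def)
    have f: "((\<lambda>i. zcoeff (q i) (h i) (F i) n) \<longlongrightarrow> zcoeff q0 h0 F0 n) \<Phi>" if "n < N" for n
      using that by (intro zcoeff_tendsto lim less.IH) auto
    have R: "((\<lambda>i. \<Sum>n<N. mscale (fps_nth (fps_X ^ n * sub_ratio (q i) (h i) ^ n) N) (zcoeff (q i) (h i) (F i) n) ** A i 0
        + mscale (fps_nth (delta_image (q i) (h i) n) N) (zcoeff (q i) (h i) (F i) n)
        - zcoeff (q i) (h i) (A i) (N - n) ** zcoeff (q i) (h i) (F i) n) \<longlongrightarrow>
      (\<Sum>n<N. mscale (fps_nth (fps_X ^ n * sub_ratio q0 h0 ^ n) N) (zcoeff q0 h0 F0 n) ** A0 0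
        + mscale (fps_nth (delta_image q0 h0 n) N) (zcoeff q0 h0 F0 n)
        - zcoeff q0 h0 A0 (N - n) ** zcoeff q0 h0 F0 n)) \<Phi>"
      by (intro tendsto_sum tendsto_add tendsto_diff bb tendsto_mscale sh dl f A zcoeff_tendsto lim) auto
    have zN: "((\<lambda>i. zcoeff (q i) (h i) (F i) N) \<longlongrightarrow> zcoeff q0 h0 F0 N) \<Phi>"
    proof (rule sylvester_tendsto[where U = ?Ui and V = ?Vi])
      show "(?Ui \<longlongrightarrow> ?Ulim) \<Phi>" "(?Vi \<longlongrightarrow> ?Vlim) \<Phi>"
        by (intro tendsto_intros tendsto_mscale A qn lim)+
      show "((\<lambda>i. ?Ui i ** zcoeff (q i) (h i) (F i) N - zcoeff (q i) (h i) (F i) N ** ?Vi i) \<longlongrightarrow>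
         ?Ulim ** zcoeff q0 h0 F0 N - zcoeff q0 h0 F0 N ** ?Vlim) \<Phi>"
        unfolding canonical_gauge_recursion[OF lim(4) g0]
      proof (rule tendsto_cong[THEN iffD2, OF _ R])
        show "\<forall>\<^sub>F i in \<Phi>. ?Ui i ** zcoeff (q i) (h i) (F i) N - zcoeff (q i) (h i) (F i) N ** ?Vi i =
          (\<Sum>n<N. mscale (fps_nth (fps_X ^ n * sub_ratio (q i) (h i) ^ n) N) (zcoeff (q i) (h i) (F i) n) ** A i 0
        + mscale (fps_nth (delta_image (q i) (h i) n) N) (zcoeff (q i) (h i) (F i) n)
        - zcoeff (q i) (h i) (A i) (N - n) ** zcoeff (q i) (h i) (F i) n)"
          using g lim(3) by eventually_elim (rule canonical_gauge_recursion)
      qed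
      \<comment> \<open>A common eigenvalue \<open>c\<close> would make \<open>c' = c / q0^N\<close>
        and \<open>c - [N] = q0^N c' - [N]\<close> both eigenvalues of \<open>A0 0\<close>, a
        resonance with \<open>s = N\<close>.\<close>
      fix c assume c: "eigenval ?Ulim c" "eigenval ?Vlim c"
      have qN: "complex_of_real q0 ^ N \<noteq> 0" using lim(4) by simp
      obtain v where "v \<noteq> 0" "?Ulim *v v = c *s v" using c(1) unfolding eigenval_def by blast
      then have "eigenval (A0 0) (c - of_real (qnum q0 N))"
        unfolding eigenval_def
        by (intro exI[of _ v]) (simp add: matrix_vector_mult_add_rdistrib mscale_mult_vec vector_sub_rdistrib eq_diff_eq)
      moreover obtain w where w: "w \<noteq> 0" "?Vlim *v w = c *s w" using c(2) unfolding eigenval_def by blast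
      then have "(1 / of_real q0 ^ N) *s (of_real q0 ^ N *s (A0 0 *v w)) = (1 / of_real q0 ^ N) *s (c *s w)"
        by (simp add: mscale_mult_vec)
      then have "A0 0 *v w = (c / of_real q0 ^ N) *s w"
        using lim(4) by (auto simp: vector_smult_assoc split: if_splits)
      then have "eigenval (A0 0) (c / of_real q0 ^ N)"
        using w(1) unfolding eigenval_def by blast
      ultimately show False
        using nr qN False lim(4) unfolding nonresonant_def
        by (auto dest!: spec[of _ "c / of_real q0 ^ N"] spec[of _ "int N"] simp: qbracket_of_nat)
    qed
    have z: "zcoeff q h F N = (\<Sum>s<N. mscale (fps_nth (inv_fact_fps q h s) N) (F s)) + mscale (fps_nth (inv_fact_fps q h N) N) (F N)"
      for q h and F :: "nat \<Rightarrow> complex^'n^'n"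
      unfolding zcoeff_def lessThan_Suc_atMost[symmetric] by simp
    have FN: "mscale (1 / fps_nth (inv_fact_fps q h N) N) (zcoeff q h F N - (\<Sum>s<N. mscale (fps_nth (inv_fact_fps q h s) N) (F s))) = F N"
      if "q \<ge> 1" for q h and F :: "nat \<Rightarrow> complex^'n^'n"
      using inv_fact_fps_nth_self[OF that, of h N] by (simp add: z mscale_mscale)
    have c: "((\<lambda>i. fps_nth (inv_fact_fps (q i) (h i) s) N) \<longlongrightarrow> fps_nth (inv_fact_fps q0 h0 s) N) \<Phi>" for s
      using fps_tendsto_inv_fact[OF lim] by (simp add: fps_tendsto_def)
    have "((\<lambda>i. mscale (1 / fps_nth (inv_fact_fps (q i) (h i) N) N)
          (zcoeff (q i) (h i) (F i) N - (\<Sum>s<N. mscale (fps_nth (inv_fact_fps (q i) (h i) s) N) (F i s)))) \<longlongrightarrow>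
        mscale (1 / fps_nth (inv_fact_fps q0 h0 N) N)
          (zcoeff q0 h0 F0 N - (\<Sum>s<N. mscale (fps_nth (inv_fact_fps q0 h0 s) N) (F0 s)))) \<Phi>"
      by (intro tendsto_mscale tendsto_intros zN c less.IH inv_fact_fps_nth_self lim) auto
    then show ?thesis
      unfolding FN[OF lim(4)]
      by (rule tendsto_cong[THEN iffD1, rotated]) (use lim(3) in \<open>eventually_elim, simp add: FN\<close>)
  qed
qed


section \<open>Uniform convergence in the exponent and Cauchy estimates\<close>

text \<open>The poles in \<open>x\<close> move with the exponent, so a denominator without zeros on
  \<open>K\<close> at the exponent \<open>c\<close> may acquire some at exponents further away.
  Compactness yields a radius within which it stays uniformly away from 0.\<close>

lemma nonvanishing_near:
  fixes D :: "complex \<times> 'x::metric_space \<Rightarrow> complex"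
  assumes K: "compact K" and R: "R > 0" and cont: "continuous_on (cball c R \<times> K) D"
    and nz: "\<And>x. x \<in> K \<Longrightarrow> D (c, x) \<noteq> 0"
  obtains \<delta> \<epsilon> where "0 < \<delta>" "\<delta> \<le> R" "0 < \<epsilon>" "\<And>z. z \<in> ball c \<delta> \<times> K \<Longrightarrow> \<epsilon> \<le> cmod (D z)"
proof (cases "K = {}")
  case True
  then show ?thesis using that[of R 1] R by auto
next
  case False
  have "continuous_on K (\<lambda>x. cmod (D (c, x)))"
    by (intro continuous_intros continuous_on_compose2[OF cont]) (use R in auto)
  then obtain x0 where x0: "x0 \<in> K" "\<And>x. x \<in> K \<Longrightarrow> cmod (D (c, x0)) \<le> cmod (D (c, x))"
    using continuous_attains_inf[OF K False] by blast
  define \<epsilon> where "\<epsilon> = cmod (D (c, x0)) / 2"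
  have \<epsilon>: "\<epsilon> > 0" using nz[OF x0(1)] by (simp add: \<epsilon>_def)
  obtain X0 where X0: "c \<in> X0" "open X0" "\<And>y. y \<in> X0 \<inter> cball c R \<Longrightarrow> \<forall>t\<in>K. dist (D (y, t)) (D (c, t)) \<le> \<epsilon>"
    using continuous_on_prod_compactE[OF cont K _ \<epsilon>, of c] R by (metis centre_in_cball less_imp_le)
  obtain d where d: "d > 0" "ball c d \<subseteq> X0" using X0 by (meson open_contains_ball)
  show ?thesis
  proof (rule that[of "min d R" \<epsilon>])
    fix z assume z: "z \<in> ball c (min d R) \<times> K"
    then obtain y x where yx: "z = (y, x)" "x \<in> K" "y \<in> X0 \<inter> cball c R" using d by force
    have "dist (D z) (D (c, x)) \<le> \<epsilon>" using X0(3)[OF yx(3)] yx by blast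
    then show "\<epsilon> \<le> cmod (D z)"
      using x0(2)[OF yx(2)] norm_triangle_ineq2[of "D (c, x)" "D z"]
      by (simp add: \<epsilon>_def dist_norm norm_minus_commute)
  qed (use d R \<epsilon> in auto)
qed

text \<open>Function and argument vary together. The error splits into \<open>T i - T0\<close> at
  the moving point, small uniformly on \<open>A\<close>, and the variation of \<open>T0\<close>,
  small by uniform continuity on the compact set \<open>A\<close>.\<close>

lemma uniform_limit_compose_varying:
  fixes T :: "'i \<Rightarrow> 'z::metric_space \<Rightarrow> 'b::real_normed_vector"
  assumes T: "uniform_limit A T T0 \<Phi>" and cont: "continuous_on A T0" and A: "compact A"
    and z: "uniform_limit X z z0 \<Phi>" and ev: "\<forall>\<^sub>F i in \<Phi>. \<forall>x\<in>X. z i x \<in> A"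
  shows "uniform_limit X (\<lambda>i x. T i (z i x)) (\<lambda>x. T0 (z0 x)) \<Phi>"
proof -
  have u: "uniform_limit X (\<lambda>i x. T0 (z i x)) (\<lambda>x. T0 (z0 x)) \<Phi>"
    by (rule uniform_limit_compose_uniformly_continuous_on[OF z compact_uniformly_continuous[OF cont A] ev])
      (rule compact_imp_closed[OF A])
  have "uniform_limit X (\<lambda>i x. T i (z i x) - T0 (z i x)) (\<lambda>_. 0) \<Phi>"
  proof (rule uniform_limitI)
    fix e :: real assume "e > 0"
    with T have "\<forall>\<^sub>F i in \<Phi>. \<forall>y\<in>A. dist (T i y) (T0 y) < e" by (rule uniform_limitD)
    with ev show "\<forall>\<^sub>F i in \<Phi>. \<forall>x\<in>X. dist (T i (z i x) - T0 (z i x)) 0 < e"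
      by eventually_elim (simp add: dist_norm)
  qed
  from uniform_limit_add[OF this u] show ?thesis by simp
qed

text \<open>What Cauchy's inequality needs in order to transfer convergence to the derivatives in
  the exponent: one disc for all \<open>x\<close> and all late indices, and holomorphy in the
  exponent only. The radius is existential because it has to avoid exponents whose poles meet
  \<open>K\<close>.\<close>

definition e_fun_converges ::
    "('i \<Rightarrow> real) \<Rightarrow> ('i \<Rightarrow> real) \<Rightarrow> real \<Rightarrow> real \<Rightarrow> complex \<Rightarrow> complex set \<Rightarrow> 'i filter \<Rightarrow> bool" where
  "e_fun_converges q h q0 h0 c K \<Phi> \<longleftrightarrow> (\<exists>\<delta>>0.
    uniform_limit (ball c \<delta> \<times> K) (\<lambda>i z. e_fun (q i) (h i) (fst z) (snd z)) (\<lambda>z. e_fun q0 h0 (fst z) (snd z)) \<Phi> \<and>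
    bounded ((\<lambda>z. e_fun q0 h0 (fst z) (snd z)) ` (ball c \<delta> \<times> K)) \<and>
    (\<forall>\<^sub>F i in \<Phi>. \<forall>x\<in>K. (\<lambda>c'. e_fun (q i) (h i) c' x) holomorphic_on ball c \<delta>) \<and>
    (\<forall>x\<in>K. (\<lambda>c'. e_fun q0 h0 c' x) holomorphic_on ball c \<delta>))"

text \<open>Non-vanishing of the limit denominator is asked only at the central exponent; the radius
  is then reduced from \<open>R\<close> to \<open>\<delta>\<close>, where \<open>D0\<close> is at
  least \<open>\<epsilon>\<close> in modulus, and the quotients converge.\<close>

lemma e_fun_convergesI:
  assumes K: "compact K" and R: "R > 0"
    and lim: "uniform_limit (cball c R \<times> K) N N0 \<Phi>" "uniform_limit (cball c R \<times> K) D D0 \<Phi>"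
    and cont: "continuous_on (cball c R \<times> K) N0" "continuous_on (cball c R \<times> K) D0"
    and nz: "\<And>x. x \<in> K \<Longrightarrow> D0 (c, x) \<noteq> 0"
    and eq: "\<forall>\<^sub>F i in \<Phi>. \<forall>c'\<in>cball c R. \<forall>x\<in>K. e_fun (q i) (h i) c' x = N i (c', x) / D i (c', x)"
    and eq0: "\<And>c' x. c' \<in> cball c R \<Longrightarrow> x \<in> K \<Longrightarrow> e_fun q0 h0 c' x = N0 (c', x) / D0 (c', x)"
    and hol: "\<forall>\<^sub>F i in \<Phi>. \<forall>x\<in>K. (\<lambda>c'. N i (c', x)) holomorphic_on ball c R \<and> (\<lambda>c'. D i (c', x)) holomorphic_on ball c R"
    and hol0: "\<And>x. x \<in> K \<Longrightarrow> (\<lambda>c'. N0 (c', x)) holomorphic_on ball c R"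
      "\<And>x. x \<in> K \<Longrightarrow> (\<lambda>c'. D0 (c', x)) holomorphic_on ball c R"
  shows "e_fun_converges q h q0 h0 c K \<Phi>"
proof -
  obtain \<delta> \<epsilon> where \<delta>: "0 < \<delta>" "\<delta> \<le> R" and \<epsilon>: "0 < \<epsilon>" "\<And>z. z \<in> ball c \<delta> \<times> K \<Longrightarrow> \<epsilon> \<le> cmod (D0 z)"
    using nonvanishing_near[OF K R cont(2) nz] by metis
  have sub: "ball c \<delta> \<times> K \<subseteq> cball c R \<times> K" using \<delta> by auto
  have subb: "ball c \<delta> \<subseteq> ball c R" using \<delta> by auto
  have bN: "bounded (N0 ` (ball c \<delta> \<times> K))"
    by (rule bounded_subset[OF compact_imp_bounded[OF compact_continuous_image[OF cont(1)]]])
      (use sub K in \<open>auto intro!: compact_Times\<close>)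
  have u: "uniform_limit (ball c \<delta> \<times> K) (\<lambda>i z. N i z / D i z) (\<lambda>z. N0 z / D0 z) \<Phi>"
    by (rule uniform_lim_divide[OF uniform_limit_on_subset[OF lim(1) sub] uniform_limit_on_subset[OF lim(2) sub] bN \<epsilon>(2,1)])
  have nzev: "\<forall>\<^sub>F i in \<Phi>. \<forall>z\<in>ball c \<delta> \<times> K. D i z \<noteq> 0"
    using uniform_limitD[OF uniform_limit_on_subset[OF lim(2) sub] \<epsilon>(1)]
  proof eventually_elim
    case (elim i)
    show ?case
    proof
      fix z assume z: "z \<in> ball c \<delta> \<times> K"
      show "D i z \<noteq> 0" using elim[rule_format, OF z] \<epsilon>(2)[OF z] by (auto simp: dist_norm)
    qed
  qed
  show ?thesis
    unfolding e_fun_converges_def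
  proof (intro exI[of _ \<delta>] conjI \<delta>(1) ballI)
    show "uniform_limit (ball c \<delta> \<times> K) (\<lambda>i z. e_fun (q i) (h i) (fst z) (snd z)) (\<lambda>z. e_fun q0 h0 (fst z) (snd z)) \<Phi>"
    proof (subst uniform_limit_cong)
      show "\<forall>\<^sub>F i in \<Phi>. \<forall>z\<in>ball c \<delta> \<times> K. e_fun (q i) (h i) (fst z) (snd z) = N i z / D i z"
        using eq by eventually_elim (use sub in auto)
      show "e_fun q0 h0 (fst z) (snd z) = N0 z / D0 z" if "z \<in> ball c \<delta> \<times> K" for z
        using eq0[of "fst z" "snd z"] that sub by auto
    qed (rule u)
    show "bounded ((\<lambda>z. e_fun q0 h0 (fst z) (snd z)) ` (ball c \<delta> \<times> K))"
    proof -
      obtain B where B: "\<And>z. z \<in> ball c \<delta> \<times> K \<Longrightarrow> cmod (N0 z) \<le> B"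
        using bN unfolding bounded_iff by auto
      show ?thesis
      proof (rule boundedI, clarify)
        fix y x assume z: "y \<in> ball c \<delta>" "x \<in> K"
        then have "e_fun q0 h0 y x = N0 (y, x) / D0 (y, x)" using \<delta>(2) by (intro eq0) auto
        moreover have "cmod (N0 (y, x) / D0 (y, x)) \<le> B / \<epsilon>"
          unfolding norm_divide using z B[of "(y, x)"] \<epsilon>(2)[of "(y, x)"] \<epsilon>(1)
          by (intro frac_le order_trans[OF norm_ge_zero]) auto
        ultimately show "cmod (e_fun q0 h0 (fst (y, x)) (snd (y, x))) \<le> B / \<epsilon>" by simp
      qed
    qed
    show "\<forall>\<^sub>F i in \<Phi>. \<forall>x\<in>K. (\<lambda>c'. e_fun (q i) (h i) c' x) holomorphic_on ball c \<delta>"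
      using eq hol nzev
    proof eventually_elim
      case (elim i)
      show ?case
      proof
        fix x assume x: "x \<in> K"
        have "(\<lambda>c'. N i (c', x) / D i (c', x)) holomorphic_on ball c \<delta>"
          using elim x subb by (intro holomorphic_on_divide) (auto intro: holomorphic_on_subset)
        then show "(\<lambda>c'. e_fun (q i) (h i) c' x) holomorphic_on ball c \<delta>"
          by (rule holomorphic_transform) (use elim x subb in auto)
      qed
    qed
    fix x assume x: "x \<in> K"
    have "(\<lambda>c'. N0 (c', x) / D0 (c', x)) holomorphic_on ball c \<delta>"
      using hol0 x subb \<epsilon> by (intro holomorphic_on_divide) (force intro: holomorphic_on_subset)+
    then show "(\<lambda>c'. e_fun q0 h0 c' x) holomorphic_on ball c \<delta>"
      by (rule holomorphic_transform) (use eq0 x subb in auto)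
  qed
qed

text \<open>Cauchy's inequality is applied to the difference of the two functions of the exponent;
  the resulting bound does not depend on \<open>x\<close>.\<close>

lemma ell_fun_uniform_limit:
  assumes "e_fun_converges q h q0 h0 c K \<Phi>"
  shows "uniform_limit K (\<lambda>i. ell_fun (q i) (h i) c k) (ell_fun q0 h0 c k) \<Phi>"
    and "bounded (ell_fun q0 h0 c k ` K)"
proof -
  obtain \<delta> where \<delta>: "\<delta> > 0"
    and u: "uniform_limit (ball c \<delta> \<times> K) (\<lambda>i z. e_fun (q i) (h i) (fst z) (snd z)) (\<lambda>z. e_fun q0 h0 (fst z) (snd z)) \<Phi>"
    and b: "bounded ((\<lambda>z. e_fun q0 h0 (fst z) (snd z)) ` (ball c \<delta> \<times> K))"
    and hol: "\<forall>\<^sub>F i in \<Phi>. \<forall>x\<in>K. (\<lambda>c'. e_fun (q i) (h i) c' x) holomorphic_on ball c \<delta>"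
    and hol0: "\<And>x. x \<in> K \<Longrightarrow> (\<lambda>c'. e_fun q0 h0 c' x) holomorphic_on ball c \<delta>"
    using assms unfolding e_fun_converges_def by blast
  \<comment> \<open>A smaller radius, since the functions are controlled on an open disc and
    Cauchy's inequality is used on a closed one. The loss \<open>1 / r^k\<close> is compensated in
    \<open>e'\<close> below.\<close>
  define r where "r = \<delta> / 2"
  have r: "r > 0" "r < \<delta>" using \<delta> by (auto simp: r_def)
  have cauchy: "cmod ((deriv ^^ k) f c / fact k) \<le> B / r ^ k"
    if "f holomorphic_on ball c \<delta>" "\<And>y. y \<in> ball c \<delta> \<Longrightarrow> cmod (f y) \<le> B" for f B
  proof -
    have "cball c r \<subseteq> ball c \<delta>" using r by auto
    then have "cmod ((deriv ^^ k) f c) \<le> fact k * B / r ^ k"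
      using r that by (intro Cauchy_inequality)
        (auto intro!: holomorphic_on_imp_continuous_on dist_commute_lessI intro: holomorphic_on_subset simp: dist_norm)
    then show ?thesis by (simp add: norm_divide field_simps)
  qed
  show "uniform_limit K (\<lambda>i. ell_fun (q i) (h i) c k) (ell_fun q0 h0 c k) \<Phi>"
  proof (rule uniform_limitI)
    fix e :: real assume e: "e > 0"
    define e' where "e' = e / 2 * r ^ k"
    have "e' > 0" using e r by (simp add: e'_def)
    from uniform_limitD[OF u this] hol
    show "\<forall>\<^sub>F i in \<Phi>. \<forall>x\<in>K. dist (ell_fun (q i) (h i) c k x) (ell_fun q0 h0 c k x) < e"
    proof eventually_elim
      case (elim i)
      show ?case
      proof
        fix x assume x: "x \<in> K"
        let ?g = "\<lambda>c'. e_fun (q i) (h i) c' x - e_fun q0 h0 c' x"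
        have "?g holomorphic_on ball c \<delta>"
          using elim x hol0 by (intro holomorphic_on_diff) auto
        moreover have "cmod (?g y) \<le> e'" if "y \<in> ball c \<delta>" for y
          using elim(1)[rule_format, of "(y, x)"] that x by (simp add: dist_norm less_imp_le)
        ultimately have "cmod ((deriv ^^ k) ?g c / fact k) \<le> e' / r ^ k" by (rule cauchy)
        also have "\<dots> < e" using e r by (simp add: e'_def)
        also have "(deriv ^^ k) ?g c = (deriv ^^ k) (\<lambda>c'. e_fun (q i) (h i) c' x) c - (deriv ^^ k) (\<lambda>c'. e_fun q0 h0 c' x) c"
          using elim x hol0 \<delta> by (intro higher_deriv_diff[of _ "ball c \<delta>"]) auto
        finally show "dist (ell_fun (q i) (h i) c k x) (ell_fun q0 h0 c k x) < e"
          by (simp add: ell_fun_def dist_norm diff_divide_distrib)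
      qed
    qed
  qed
  obtain B where B: "\<And>z. z \<in> ball c \<delta> \<times> K \<Longrightarrow> cmod (e_fun q0 h0 (fst z) (snd z)) \<le> B"
  proof -
    from b obtain B where "\<forall>v\<in>(\<lambda>z. e_fun q0 h0 (fst z) (snd z)) ` (ball c \<delta> \<times> K). cmod v \<le> B"
      unfolding bounded_iff by blast
    then show ?thesis using that by blast
  qed
  show "bounded (ell_fun q0 h0 c k ` K)"
  proof (rule boundedI, clarify)
    fix x assume x: "x \<in> K"
    show "cmod (ell_fun q0 h0 c k x) \<le> B / r ^ k"
      unfolding ell_fun_def using B[of "(_, x)"] x by (intro cauchy hol0) auto
  qed
qed

section \<open>The infinite product (x;p)_infinity as an entire function of x\<close>

lemma summable_geometric_mult: "0 < (p::real) \<Longrightarrow> p < 1 \<Longrightarrow> summable (\<lambda>k. p ^ k * R)"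
  by (intro summable_mult2 summable_geometric) auto

lemma qpoch_factor_bound:
  assumes "0 < p" "cmod x \<le> R"
  shows "cmod (1 - of_real p ^ k * x - 1) \<le> p ^ k * R"
  using assms by (simp add: norm_mult norm_power mult_left_mono)

lemma qpoch_inf_convergent: "0 < p \<Longrightarrow> p < 1 \<Longrightarrow> convergent_prod (\<lambda>k. 1 - of_real p ^ k * (x::complex))"
  by (rule prod_dominated(1)[OF summable_geometric_mult[of p "cmod x"]]) (use qpoch_factor_bound in auto)

lemma qpoch_inf_tendsto:
  assumes "0 < p" "p < 1"
  shows "(\<lambda>n. \<Prod>k<n. 1 - of_real p ^ k * x) \<longlonglongrightarrow> qpoch_inf p x"
  using convergent_prod_LIMSEQ[OF qpoch_inf_convergent[OF assms, of x]]
  unfolding qpoch_inf_def by (subst (asm) lessThan_Suc_atMost[symmetric]) (rule LIMSEQ_imp_Suc)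

lemma qpoch_partial_uniform_limit:
  assumes p: "0 < p" "p < 1"
  shows "uniform_limit (cball 0 R) (\<lambda>n x. \<Prod>k<n. 1 - of_real p ^ k * x) (qpoch_inf p) sequentially"
proof (rule uniform_limitI)
  fix e :: real assume "e > 0"
  let ?m = "\<lambda>k. p ^ k * R"
  note sm = summable_geometric_mult[OF p, of R]
  have "\<forall>\<^sub>F n in sequentially. exp (suminf ?m) * (suminf ?m - (\<Sum>k<n. ?m k)) < e"
    using dominated_tail_tendsto_0[OF sm] \<open>e > 0\<close> by (intro order_tendstoD)
  then show "\<forall>\<^sub>F n in sequentially. \<forall>x\<in>cball 0 R. dist (\<Prod>k<n. 1 - of_real p ^ k * x) (qpoch_inf p x) < e"
  proof eventually_elim
    case (elim n)
    show ?case
    proof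
      fix x :: complex assume "x \<in> cball 0 R"
      then have "cmod (qpoch_inf p x - (\<Prod>k<n. 1 - of_real p ^ k * x)) \<le> exp (suminf ?m) * (suminf ?m - (\<Sum>k<n. ?m k))"
        unfolding qpoch_inf_def using qpoch_factor_bound[OF p(1)]
        by (intro prod_dominated(5)[OF sm]) auto
      then show "dist (\<Prod>k<n. 1 - of_real p ^ k * x) (qpoch_inf p x) < e"
        using elim by (simp add: dist_norm norm_minus_commute)
    qed
  qed
qed

lemma holomorphic_qpoch_inf: "0 < p \<Longrightarrow> p < 1 \<Longrightarrow> qpoch_inf p holomorphic_on A"
proof -
  assume p: "0 < p" "p < 1"
  have "qpoch_inf p holomorphic_on UNIV"
  proof (rule holomorphic_uniform_sequence)
    fix x :: complex
    have "cball x 1 \<subseteq> cball 0 (cmod x + 1)" by (rule cball_subset_cball_0)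
    then show "\<exists>d>0. cball x d \<subseteq> UNIV \<and> uniform_limit (cball x d) (\<lambda>n x. \<Prod>k<n. 1 - of_real p ^ k * x) (qpoch_inf p) sequentially"
      using uniform_limit_on_subset[OF qpoch_partial_uniform_limit[OF p]] by (intro exI[of _ 1]) auto
  qed (auto intro!: holomorphic_intros)
  then show ?thesis by (rule holomorphic_on_subset) auto
qed

lemma qpoch_inf_eq_0D: "0 < p \<Longrightarrow> p < 1 \<Longrightarrow> qpoch_inf p x = 0 \<Longrightarrow> \<exists>k. of_real p ^ k * x = 1"
  using prodinf_nonzero[OF qpoch_inf_convergent[of p x]] unfolding qpoch_inf_def by auto

lemma qpoch_inf_split:
  assumes "0 < p" "p < 1"
  shows "qpoch_inf p x = (\<Prod>k<n. 1 - of_real p ^ k * x) * qpoch_inf p (of_real p ^ n * x)"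
proof -
  have "(\<lambda>k. 1 - of_real p ^ k * x) has_prod ((\<Prod>k<n. 1 - of_real p ^ k * x) * (\<Prod>k. 1 - of_real p ^ (k + n) * x))"
    by (rule has_prod_ignore_initial_segment'[OF qpoch_inf_convergent[OF assms]])
  then show ?thesis
    unfolding qpoch_inf_def by (simp add: has_prod_iff power_add mult.assoc)
qed


section \<open>Confluence to $(1,0)$\<close>

lemma qbracket_complex: "qbracket p c = (if p = 1 then c else (1 - of_real p powr c) / of_real (1 - p) :: complex)"
  using minus_divide_divide[of "of_real p powr c - 1" "complex_of_real p - 1"] by (simp add: qbracket_def)

text \<open>With \<open>t = - ln p\<close> one has \<open>p^c = exp (- c t)\<close> and
  \<open>0 \<le> t - (1 - p) \<le> 2 (1 - p)^2\<close>. The part \<open>2 R\<close> of the constant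
  comes from replacing \<open>t\<close> by \<open>1 - p\<close>, the part \<open>4 R^2 exp R\<close>
  from the quadratic remainder of \<open>exp\<close>, where \<open>c t\<close> is at most
  \<open>2 R (1 - p) \<le> R\<close> in modulus. Both steps rest on
  \<open>p \<ge> 1/2\<close>.\<close>

lemma qbracket_minus_bound:
  assumes p: "1 / 2 \<le> p" "p \<le> 1" and c: "cmod c \<le> R"
  shows "cmod (qbracket p c - c) \<le> (2 * R + 4 * R\<^sup>2 * exp R) * (1 - p)"
proof (cases "p = 1")
  case False
  then have p1: "p < 1" "p > 0" using p by auto
  have R: "R \<ge> 0" using c norm_ge_zero order_trans by blast
  define t where "t = - ln p"
  define z where "z = - (c * of_real t)"
  have t1: "1 - p \<le> t" using ln_le_minus_one[of p] p1 by (simp add: t_def)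
  have "t \<le> 1 / p - 1" using ln_le_minus_one[of "1 / p"] p1 by (simp add: t_def ln_div)
  also have "1 / p - 1 = (1 - p) / p" using p1 by (simp add: field_simps)
  finally have t2: "t \<le> (1 - p) / p" .
  have ip: "1 / p \<le> 2" using p p1 by (simp add: field_simps)
  have "(1 - p) / p \<le> 2 * (1 - p)" using mult_left_mono[OF ip, of "1 - p"] p1 by simp
  then have t3: "t \<le> 2 * (1 - p)" using t2 by simp
  have "(1 - p) / p - (1 - p) = (1 - p) * (1 - p) / p" using p1 by (simp add: field_simps)
  also have "\<dots> \<le> 2 * (1 - p)\<^sup>2"
    using mult_left_mono[OF ip, of "(1 - p)\<^sup>2"] by (simp add: power2_eq_square)
  finally have t4: "t - (1 - p) \<le> 2 * (1 - p)\<^sup>2" using t2 by simp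
  have t0: "t \<ge> 0" using t1 p1 by simp
  have nz: "cmod z \<le> R * (2 * (1 - p))"
    unfolding z_def norm_minus_cancel norm_mult using c t0 t3 R by (intro mult_mono) auto
  have "R * (2 * (1 - p)) \<le> R * 1" using R p by (intro mult_left_mono) auto
  then have nz1: "cmod z \<le> R" using nz by linarith
  have ez: "of_real p powr c = exp z"
    using p1 by (simp add: powr_def Ln_of_real z_def t_def mult.commute)
  have "cmod (exp z - (1 + z)) \<le> exp \<bar>Re z\<bar> * cmod z ^ 2"
    using Taylor_exp[of z 1] by (simp add: numeral_2_eq_2)
  also have "\<dots> \<le> exp R * (R * (2 * (1 - p)))\<^sup>2"
    using nz nz1 abs_Re_le_cmod[of z] by (intro mult_mono power_mono) auto
  also have "exp R * (R * (2 * (1 - p)))\<^sup>2 = 4 * R\<^sup>2 * exp R * (1 - p)\<^sup>2"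
    by algebra
  finally have e: "cmod (exp z - (1 + z)) \<le> 4 * R\<^sup>2 * exp R * (1 - p)\<^sup>2" .
  have "qbracket p c - c = (c * of_real (t - (1 - p)) - (exp z - (1 + z))) / of_real (1 - p)"
    using p1 by (simp add: qbracket_complex ez z_def field_simps)
  then have "cmod (qbracket p c - c) = cmod (c * of_real (t - (1 - p)) - (exp z - (1 + z))) / (1 - p)"
    using p1 by (simp add: norm_divide del: of_real_diff)
  also have "\<dots> \<le> (2 * R * (1 - p)\<^sup>2 + 4 * R\<^sup>2 * exp R * (1 - p)\<^sup>2) / (1 - p)"
  proof (rule divide_right_mono)
    have "cmod (c * of_real (t - (1 - p))) = cmod c * (t - (1 - p))"
      using t1 by (simp only: norm_mult norm_of_real abs_of_nonneg diff_ge_0_iff_ge)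
    also have "\<dots> \<le> R * (2 * (1 - p)\<^sup>2)" using c t4 t1 R by (intro mult_mono) auto
    finally show "cmod (c * of_real (t - (1 - p)) - (exp z - (1 + z))) \<le> 2 * R * (1 - p)\<^sup>2 + 4 * R\<^sup>2 * exp R * (1 - p)\<^sup>2"
      using e norm_triangle_ineq4[of "c * of_real (t - (1 - p))" "exp z - (1 + z)"] by linarith
  qed (use p1 in auto)
  also have "\<dots> = (2 * R + 4 * R\<^sup>2 * exp R) * (1 - p)"
    using p1 by (simp add: power2_eq_square field_simps)
  finally show ?thesis .
qed (simp add: qbracket_complex)

lemma qbracket_uniform_limit:
  assumes p: "(p \<longlongrightarrow> 1) \<Phi>" "\<forall>\<^sub>F i in \<Phi>. p i \<le> 1"
  shows "uniform_limit (cball (0::complex) R) (\<lambda>i. qbracket (p i)) (\<lambda>c. c) \<Phi>"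
proof (rule uniform_limitI)
  fix e :: real assume e: "e > 0"
  have "((\<lambda>i. (2 * R + 4 * R\<^sup>2 * exp R) * (1 - p i)) \<longlongrightarrow> (2 * R + 4 * R\<^sup>2 * exp R) * (1 - 1)) \<Phi>"
    by (intro tendsto_intros p)
  then have "\<forall>\<^sub>F i in \<Phi>. (2 * R + 4 * R\<^sup>2 * exp R) * (1 - p i) < e"
    using e by (intro order_tendstoD) auto
  moreover have "\<forall>\<^sub>F i in \<Phi>. 1 / 2 < p i" using p(1) by (intro order_tendstoD) auto
  ultimately show "\<forall>\<^sub>F i in \<Phi>. \<forall>c\<in>cball (0::complex) R. dist (qbracket (p i) c) c < e"
    using p(2)
  proof eventually_elim
    case (elim i)
    show ?case
    proof
      fix c :: complex assume "c \<in> cball 0 R"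
      then have "cmod (qbracket (p i) c - c) \<le> (2 * R + 4 * R\<^sup>2 * exp R) * (1 - p i)"
        using elim by (intro qbracket_minus_bound) auto
      then show "dist (qbracket (p i) c) c < e" using elim by (simp add: dist_norm)
    qed
  qed
qed

text \<open>For \<open>d > 0\<close>, a quantitative way of saying that \<open>a\<close> is not in
  \<open>[1, \<infinity>)\<close>: the segment from 1 to \<open>1 - a\<close> stays at distance at
  least \<open>d\<close> from 0. All the points \<open>p^j a\<close> inherit it with the same
  \<open>d\<close>.\<close>

definition slit_ge :: "real \<Rightarrow> complex set" where
  "slit_ge d = {a. \<forall>u\<in>{0..1}. d \<le> cmod (1 - of_real u * a)}"

lemma slit_ge_mult: "a \<in> slit_ge d \<Longrightarrow> 0 \<le> u \<Longrightarrow> u \<le> 1 \<Longrightarrow> of_real u * a \<in> slit_ge d"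
  unfolding slit_ge_def
proof safe
  fix v :: real assume a: "\<forall>u\<in>{0..1}. d \<le> cmod (1 - of_real u * a)" and uv: "0 \<le> u" "u \<le> 1" "v \<in> {0..1}"
  have "v * u \<in> {0..1}" using uv by (auto intro: mult_le_one)
  then have "d \<le> cmod (1 - of_real (v * u) * a)" using a by blast
  then show "d \<le> cmod (1 - of_real v * (of_real u * a))" by (simp add: mult.assoc)
qed

lemma slit_ge_ge: "a \<in> slit_ge d \<Longrightarrow> d \<le> cmod (1 - a)"
  unfolding slit_ge_def by (auto dest: bspec[of _ _ 1])

lemma slit_ge_not_nonpos:
  assumes "a \<in> slit_ge d" "d > 0"
  shows "1 - a \<notin> \<real>\<^sub>\<le>\<^sub>0"
proof
  assume "1 - a \<in> \<real>\<^sub>\<le>\<^sub>0"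
  then obtain r where r: "1 - a = of_real r" "r \<le> 0" by (auto elim: nonpos_Reals_cases)
  then have a: "a = of_real (1 - r)" by (simp add: algebra_simps)
  have "of_real (1 / (1 - r)) * a = 1" unfolding a of_real_mult[symmetric] using r by simp
  moreover have "1 / (1 - r) \<in> {0..1}" using r by auto
  then have "d \<le> cmod (1 - of_real (1 / (1 - r)) * a)" using assms(1) unfolding slit_ge_def by blast
  ultimately show False using assms(2) by simp
qed

lemma slit_ge_near:
  assumes "a \<in> slit_ge (e + d)" "cmod (y - a) \<le> d"
  shows "y \<in> slit_ge e"
  unfolding slit_ge_def
proof safe
  fix u :: real assume u: "u \<in> {0..1}"
  have "cmod (of_real u * (y - a)) \<le> d"
    using u assms(2) mult_mono[of u 1 "cmod (y - a)" d] by (simp add: norm_mult)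
  moreover have "e + d \<le> cmod (1 - of_real u * a)" using assms u by (auto simp: slit_ge_def)
  moreover have "1 - of_real u * a = (1 - of_real u * y) + of_real u * (y - a)" by (simp add: algebra_simps)
  then have "cmod (1 - of_real u * a) \<le> cmod (1 - of_real u * y) + cmod (of_real u * (y - a))"
    using norm_triangle_ineq by metis
  ultimately show "e \<le> cmod (1 - of_real u * y)" by simp
qed

text \<open>On the segment the second derivative of \<open>Ln (1 - y)\<close> is at most
  \<open>1 / d^2\<close>. The error is quadratic in \<open>t - s\<close>, which is what leaves a
  factor \<open>1 - p\<close> after summation over the points \<open>p^j a\<close>.\<close>

lemma Ln_one_minus_taylor:
  assumes seg: "closed_segment s t \<subseteq> slit_ge d" and d: "d > 0"
  shows "cmod (Ln (1 - t) - Ln (1 - s) + (t - s) / (1 - s)) \<le> (cmod (t - s))\<^sup>2 / d\<^sup>2"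
proof -
  define f :: "nat \<Rightarrow> complex \<Rightarrow> complex"
    where "f i y = (if i = 0 then Ln (1 - y) else if i = 1 then - inverse (1 - y) else - (inverse (1 - y))\<^sup>2)" for i y
  have "cmod (f 0 t - (\<Sum>i\<le>1. f i s * (t - s) ^ i / fact i)) \<le> 1 / d\<^sup>2 * cmod (t - s) ^ Suc 1 / fact 1"
  proof (rule complex_Taylor[of "closed_segment s t"])
    fix i y assume y: "y \<in> closed_segment s t" and i: "i \<le> (1::nat)"
    have nn: "1 - y \<notin> \<real>\<^sub>\<le>\<^sub>0" using seg y slit_ge_not_nonpos[OF _ d] by auto
    then have "1 - y \<noteq> 0" by auto
    then show "(f i has_field_derivative f (Suc i) y) (at y within closed_segment s t)"
      using i nn unfolding f_def
      by (cases "i = 0") (auto intro!: derivative_eq_intros simp: field_simps power2_eq_square)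
  next
    fix y assume y: "y \<in> closed_segment s t"
    then have "d \<le> cmod (1 - y)" using seg slit_ge_ge by blast
    then have "inverse (cmod (1 - y)) \<le> inverse d" using d by (intro le_imp_inverse_le) auto
    then have "(inverse (cmod (1 - y)))\<^sup>2 \<le> (inverse d)\<^sup>2" by (intro power_mono) auto
    then show "cmod (f (Suc 1) y) \<le> 1 / d\<^sup>2"
      by (simp add: f_def norm_power norm_inverse power_divide inverse_eq_divide norm_divide)
  qed auto
  then show ?thesis by (simp add: f_def field_simps power2_eq_square)
qed

text \<open>By this bound, errors of the form \<open>(1 - p)^2 p^(2j)\<close> add up to at most
  \<open>1 - p\<close>.\<close>

lemma suminf_pow_sq_le:
  assumes "0 < p" "p < (1::real)"
  shows "summable (\<lambda>j. (p ^ j)\<^sup>2)" "(\<Sum>j. (p ^ j)\<^sup>2) \<le> 1 / (1 - p)"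
proof -
  have eq: "(p ^ j)\<^sup>2 = (p\<^sup>2) ^ j" for j by (simp add: power_mult[symmetric] mult.commute)
  have p2: "p\<^sup>2 < 1" using assms by (simp add: power_less_one_iff)
  then show "summable (\<lambda>j. (p ^ j)\<^sup>2)" unfolding eq by (intro summable_geometric) simp
  have "(\<Sum>j. (p ^ j)\<^sup>2) = 1 / (1 - p\<^sup>2)" unfolding eq using p2 by (subst suminf_geometric) auto
  also have "\<dots> \<le> 1 / (1 - p)"
    using assms p2 by (intro divide_left_mono) (auto simp: power2_eq_square mult_le_cancel_left1)
  finally show "(\<Sum>j. (p ^ j)\<^sup>2) \<le> 1 / (1 - p)" .
qed

lemma segment_in_slit_ge:
  assumes "a \<in> slit_ge d" "0 \<le> u" "u \<le> 1" "0 \<le> v" "v \<le> 1"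
  shows "closed_segment (of_real u * a) (of_real v * a) \<subseteq> slit_ge d"
proof
  fix y assume "y \<in> closed_segment (of_real u * a) (of_real v * a)"
  then obtain r where r: "0 \<le> r" "r \<le> 1" "y = (1 - r) *\<^sub>R (of_real u * a) + r *\<^sub>R (of_real v * a)"
    by (auto simp: in_segment)
  have "y = of_real ((1 - r) * u + r * v) * a"
    unfolding r by (simp add: scaleR_conv_of_real algebra_simps)
  moreover have "0 \<le> (1 - r) * u + r * v" using r assms by auto
  moreover have "(1 - r) * u + r * v \<le> 1" using r assms by (intro convex_bound_le) auto
  ultimately show "y \<in> slit_ge d" by (metis slit_ge_mult[OF assms(1)])
qed

text \<open>\<open>(1 - p) * suminf g\<close> is the Riemann sum of \<open>a / (1 - u a)\<close>
  with nodes \<open>u = p^j\<close> and steps \<open>(1 - p) p^j\<close>. Each term is compared with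
  the increment of \<open>Ln (1 - u a)\<close> between consecutive nodes, and these increments
  telescope from \<open>u = 1\<close> down to \<open>u = 0\<close>.\<close>

lemma quot_sum_tendsto:
  assumes p: "0 < p" "p < 1" and a: "a \<in> slit_ge d" "cmod a \<le> M" and d: "d > 0"
  defines "g \<equiv> \<lambda>j. of_real (p ^ j) * a / (1 - of_real (p ^ j) * a)"
  shows "summable g" "cmod (of_real (1 - p) * suminf g + Ln (1 - a)) \<le> M\<^sup>2 / d\<^sup>2 * (1 - p)"
proof -
  have M: "M \<ge> 0" using a(2) norm_ge_zero order_trans by blast
  have pj: "0 \<le> p ^ j" "p ^ j \<le> 1" for j using p by (auto intro: power_le_one)
  have ge: "d \<le> cmod (1 - of_real (p ^ j) * a)" for j
    using slit_ge_ge[OF slit_ge_mult[OF a(1) pj]] .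
  show sg: "summable g"
  proof (rule summable_comparison_test'[OF summable_geometric_mult[OF p, of "M / d"], of 0])
    fix j
    have "cmod (g j) = p ^ j * cmod a / cmod (1 - of_real (p ^ j) * a)"
      using p by (simp add: g_def norm_mult norm_divide norm_power)
    also have "\<dots> \<le> p ^ j * M / d" using ge[of j] d a(2) M pj by (intro frac_le mult_left_mono mult_nonneg_nonneg) auto
    finally show "norm (g j) \<le> p ^ j * (M / d)" by simp
  qed
  define T where "T j = Ln (1 - of_real (p ^ j) * a)" for j
  have diff: "cmod (T (Suc j) - T j - of_real (1 - p) * g j) \<le> M\<^sup>2 / d\<^sup>2 * (1 - p)\<^sup>2 * (p ^ j)\<^sup>2" for j
  proof -
    let ?s = "of_real (p ^ j) * a" and ?t = "of_real (p ^ Suc j) * a"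
    have st: "?t - ?s = - (of_real ((1 - p) * p ^ j) * a)" by (simp add: algebra_simps)
    have "cmod (Ln (1 - ?t) - Ln (1 - ?s) + (?t - ?s) / (1 - ?s)) \<le> (cmod (?t - ?s))\<^sup>2 / d\<^sup>2"
      using pj[of j] pj[of "Suc j"] by (intro Ln_one_minus_taylor[OF segment_in_slit_ge[OF a(1)] d])
    also have "(?t - ?s) / (1 - ?s) = - (of_real (1 - p) * g j)"
      unfolding st by (simp add: g_def)
    also have "cmod (?t - ?s) = (1 - p) * p ^ j * cmod a"
      unfolding st norm_minus_cancel norm_mult norm_of_real using p pj[of j] by (simp add: abs_mult)
    also have "((1 - p) * p ^ j * cmod a)\<^sup>2 / d\<^sup>2 \<le> ((1 - p) * p ^ j * M)\<^sup>2 / d\<^sup>2"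
      using p a(2) pj[of j] by (intro divide_right_mono power_mono mult_left_mono mult_nonneg_nonneg) auto
    finally show ?thesis by (simp add: T_def power_mult_distrib mult_ac)
  qed
  have "T \<longlonglongrightarrow> Ln (1 - of_real 0 * a)"
    unfolding T_def using p by (intro tendsto_intros LIMSEQ_realpow_zero) auto
  then have tel: "(\<lambda>j. T (Suc j) - T j) sums (0 - T 0)"
    by (intro telescope_sums) simp
  have sums: "(\<lambda>j. T (Suc j) - T j - of_real (1 - p) * g j) sums (0 - T 0 - of_real (1 - p) * suminf g)"
    by (intro sums_diff tel sums_mult summable_sums sg)
  note sq = suminf_pow_sq_le[OF p]
  have ssq: "summable (\<lambda>j. M\<^sup>2 / d\<^sup>2 * (1 - p)\<^sup>2 * (p ^ j)\<^sup>2)" by (intro summable_mult sq)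
  have "cmod (0 - T 0 - of_real (1 - p) * suminf g) \<le> (\<Sum>j. M\<^sup>2 / d\<^sup>2 * (1 - p)\<^sup>2 * (p ^ j)\<^sup>2)"
    unfolding sums_unique[OF sums] by (rule norm_suminf_le[OF diff ssq])
  also have "\<dots> = M\<^sup>2 / d\<^sup>2 * (1 - p)\<^sup>2 * (\<Sum>j. (p ^ j)\<^sup>2)" by (intro suminf_mult sq)
  also have "\<dots> \<le> M\<^sup>2 / d\<^sup>2 * (1 - p)\<^sup>2 * (1 / (1 - p))" by (intro mult_left_mono sq) auto
  also have "\<dots> = M\<^sup>2 / d\<^sup>2 * (1 - p)" using p by (simp add: power2_eq_square)
  finally have "cmod (- (of_real (1 - p) * suminf g + Ln (1 - a))) \<le> M\<^sup>2 / d\<^sup>2 * (1 - p)"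
    by (simp add: T_def algebra_simps)
  then show "cmod (of_real (1 - p) * suminf g + Ln (1 - a)) \<le> M\<^sup>2 / d\<^sup>2 * (1 - p)"
    by (simp only: norm_minus_cancel)
qed

text \<open>A sum of principal logarithms is harmless, because only its exponential is compared with
  the product.\<close>

lemma qpoch_inf_eq_exp:
  assumes p: "0 < p" "p < 1" and a: "a \<in> slit_ge d" and d: "d > 0"
  shows "summable (\<lambda>j. Ln (1 - of_real (p ^ j) * a))"
    and "qpoch_inf p a = exp (\<Sum>j. Ln (1 - of_real (p ^ j) * a))"
proof -
  have pj: "0 \<le> p ^ j" "p ^ j \<le> 1" for j using p by (auto intro: power_le_one)
  show s: "summable (\<lambda>j. Ln (1 - of_real (p ^ j) * a))"
  proof (rule summable_comparison_test'[OF summable_geometric_mult[OF p, of "cmod a + (cmod a)\<^sup>2 / d\<^sup>2"], of 0])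
    fix j
    let ?t = "of_real (p ^ j) * a"
    have A: "cmod (Ln (1 - ?t) + ?t) \<le> (cmod ?t)\<^sup>2 / d\<^sup>2"
      using Ln_one_minus_taylor[OF segment_in_slit_ge[OF a, of 0 "p ^ j"] d] pj[of j] by simp
    have nt: "cmod ?t = p ^ j * cmod a" using p by (simp add: norm_mult norm_power)
    have "(p ^ j)\<^sup>2 \<le> p ^ j" using pj[of j] by (simp add: power2_eq_square mult_left_le)
    then have "(p ^ j * cmod a)\<^sup>2 \<le> p ^ j * (cmod a)\<^sup>2"
      unfolding power_mult_distrib by (intro mult_right_mono) auto
    then have le: "(p ^ j * cmod a)\<^sup>2 / d\<^sup>2 \<le> p ^ j * (cmod a)\<^sup>2 / d\<^sup>2" by (intro divide_right_mono) auto
    have B: "cmod (Ln (1 - ?t)) \<le> cmod (Ln (1 - ?t) + ?t) + cmod ?t"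
      using norm_triangle_ineq4[of "Ln (1 - ?t) + ?t" ?t] by simp
    have "cmod (Ln (1 - ?t)) \<le> p ^ j * (cmod a)\<^sup>2 / d\<^sup>2 + p ^ j * cmod a"
      using A B le unfolding nt by linarith
    then show "norm (Ln (1 - ?t)) \<le> p ^ j * (cmod a + (cmod a)\<^sup>2 / d\<^sup>2)"
      by (simp add: distrib_left)
  qed
  have nz: "1 - of_real (p ^ j) * a \<noteq> 0" for j
    using slit_ge_ge[OF slit_ge_mult[OF a pj]] d by (metis norm_zero not_less)
  have "(\<lambda>n. exp (\<Sum>j<n. Ln (1 - of_real (p ^ j) * a))) \<longlonglongrightarrow> exp (\<Sum>j. Ln (1 - of_real (p ^ j) * a))"
    by (intro tendsto_exp summable_LIMSEQ s)
  moreover have "exp (\<Sum>j<n. Ln (1 - of_real (p ^ j) * a)) = (\<Prod>j<n. 1 - of_real p ^ j * a)" for n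
    using nz by (simp add: exp_sum)
  ultimately show "qpoch_inf p a = exp (\<Sum>j. Ln (1 - of_real (p ^ j) * a))"
    using qpoch_inf_tendsto[OF p, of a] LIMSEQ_unique by simp
qed

text \<open>Here \<open>w\<close> stands for \<open>p^c\<close> and \<open>\<kappa>\<close> for the
  bracket of \<open>c\<close> in base \<open>p\<close>. Summing the expansions from
  \<open>p^j a\<close> to \<open>p^j w a\<close>, a logarithm of the quotient is close to
  \<open>(w - 1) * suminf g = - \<kappa> (1 - p) * suminf g\<close>, hence to
  \<open>\<kappa> * Ln (1 - a)\<close>; the two errors account for the square and the first power of
  \<open>cmod \<kappa>\<close>. The margin \<open>d + d\<close> leaves room for the displacement
  from \<open>a\<close> to \<open>w a\<close>.\<close>

lemma qpoch_inf_quotient: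
  assumes p: "0 < p" "p < 1" and a: "a \<in> slit_ge (d + d)" "cmod a \<le> M" and d: "d > 0"
    and w: "cmod (w - 1) * M \<le> d"
  defines "\<kappa> \<equiv> (1 - w) / of_real (1 - p)"
  shows "\<exists>X. qpoch_inf p a / qpoch_inf p (w * a) = exp X \<and>
      cmod (X - \<kappa> * Ln (1 - a)) \<le> (cmod \<kappa> + (cmod \<kappa>)\<^sup>2) * (M\<^sup>2 / d\<^sup>2) * (1 - p)"
    and "qpoch_inf p (w * a) \<noteq> 0"
proof -
  have M: "M \<ge> 0" using a(2) norm_ge_zero order_trans by blast
  have pj: "0 \<le> p ^ j" "p ^ j \<le> 1" for j using p by (auto intro: power_le_one)
  define b where "b = w * a"
  have ba: "b - a = (w - 1) * a" by (simp add: b_def algebra_simps)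
  have nba: "cmod (b - a) \<le> cmod (w - 1) * M"
    unfolding ba norm_mult using a(2) by (intro mult_left_mono) auto
  have seg0: "closed_segment a b \<subseteq> slit_ge d"
  proof
    fix y assume "y \<in> closed_segment a b"
    then have "cmod (y - a) \<le> cmod (b - a)"
      using segment_bound1 by blast
    then show "y \<in> slit_ge d" using nba w by (intro slit_ge_near[OF a(1)]) simp
  qed
  then have ab: "a \<in> slit_ge d" "b \<in> slit_ge d" by auto
  note La = qpoch_inf_eq_exp[OF p ab(1) d] and Lb = qpoch_inf_eq_exp[OF p ab(2) d]
  show "qpoch_inf p (w * a) \<noteq> 0" using Lb(2) unfolding b_def[symmetric] by simp
  define g where "g j = of_real (p ^ j) * a / (1 - of_real (p ^ j) * a)" for j
  note W = quot_sum_tendsto[OF p ab(1) a(2) d, folded g_def]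
  let ?la = "\<lambda>j. Ln (1 - of_real (p ^ j) * a)" and ?lb = "\<lambda>j. Ln (1 - of_real (p ^ j) * b)"
  define X where "X = suminf ?la - suminf ?lb"
  have diff: "cmod (?lb j - ?la j + (w - 1) * g j) \<le> (cmod (w - 1) * M)\<^sup>2 / d\<^sup>2 * (p ^ j)\<^sup>2" for j
  proof -
    let ?s = "of_real (p ^ j) * a" and ?t = "of_real (p ^ j) * b"
    have "closed_segment ?s ?t \<subseteq> slit_ge d"
    proof
      fix y assume "y \<in> closed_segment ?s ?t"
      then obtain u where u: "0 \<le> u" "u \<le> 1" "y = (1 - u) *\<^sub>R ?s + u *\<^sub>R ?t"
        by (auto simp: in_segment)
      define z where "z = (1 - u) *\<^sub>R a + u *\<^sub>R b"
      have "z \<in> closed_segment a b" using u by (auto simp: z_def in_segment)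
      moreover have "y = of_real (p ^ j) * z"
        unfolding u z_def by (simp add: scaleR_conv_of_real algebra_simps)
      ultimately show "y \<in> slit_ge d" using seg0 slit_ge_mult[OF _ pj] by blast
    qed
    then have "cmod (?lb j - ?la j + (?t - ?s) / (1 - ?s)) \<le> (cmod (?t - ?s))\<^sup>2 / d\<^sup>2"
      by (rule Ln_one_minus_taylor[OF _ d])
    also have "(?t - ?s) / (1 - ?s) = (w - 1) * g j" by (simp add: b_def g_def algebra_simps diff_divide_distrib)
    also have "cmod (?t - ?s) = p ^ j * cmod (b - a)"
      unfolding right_diff_distrib[symmetric] norm_mult norm_of_real using pj[of j] by simp
    also have "(p ^ j * cmod (b - a))\<^sup>2 / d\<^sup>2 \<le> (p ^ j * (cmod (w - 1) * M))\<^sup>2 / d\<^sup>2"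
      using pj[of j] nba by (intro divide_right_mono power_mono mult_left_mono mult_nonneg_nonneg) auto
    finally show ?thesis by (simp add: power_mult_distrib mult_ac)
  qed
  have sums: "(\<lambda>j. ?lb j - ?la j + (w - 1) * g j) sums (suminf ?lb - suminf ?la + (w - 1) * suminf g)"
    by (intro sums_add sums_diff sums_mult summable_sums La Lb W)
  note sq = suminf_pow_sq_le[OF p]
  have ssq: "summable (\<lambda>j. (cmod (w - 1) * M)\<^sup>2 / d\<^sup>2 * (p ^ j)\<^sup>2)" by (intro summable_mult sq)
  have w1: "w - 1 = - (\<kappa> * of_real (1 - p))" using p by (simp add: \<kappa>_def del: of_real_diff)
  have nw1: "cmod (w - 1) = cmod \<kappa> * (1 - p)" unfolding w1 norm_minus_cancel norm_mult norm_of_real using p by simp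
  have "cmod (suminf ?lb - suminf ?la + (w - 1) * suminf g) \<le> (\<Sum>j. (cmod (w - 1) * M)\<^sup>2 / d\<^sup>2 * (p ^ j)\<^sup>2)"
    unfolding sums_unique[OF sums] by (rule norm_suminf_le[OF diff ssq])
  also have "\<dots> = (cmod (w - 1) * M)\<^sup>2 / d\<^sup>2 * (\<Sum>j. (p ^ j)\<^sup>2)" by (intro suminf_mult sq)
  also have "\<dots> \<le> (cmod (w - 1) * M)\<^sup>2 / d\<^sup>2 * (1 / (1 - p))" by (intro mult_left_mono sq) auto
  also have "\<dots> = (cmod \<kappa>)\<^sup>2 * (M\<^sup>2 / d\<^sup>2) * (1 - p)"
    unfolding nw1 using p by (simp add: power2_eq_square)
  finally have e1: "cmod (suminf ?lb - suminf ?la + (w - 1) * suminf g) \<le> (cmod \<kappa>)\<^sup>2 * (M\<^sup>2 / d\<^sup>2) * (1 - p)" .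
  have tri: "cmod (- U - \<kappa> * V) \<le> cmod U + cmod \<kappa> * cmod V" for U V
    using norm_triangle_ineq4[of "- U" "\<kappa> * V"] by (simp add: norm_mult)
  have Xeq: "X - \<kappa> * Ln (1 - a) = - (suminf ?lb - suminf ?la + (w - 1) * suminf g)
      - \<kappa> * (of_real (1 - p) * suminf g + Ln (1 - a))"
    unfolding X_def w1 by (simp add: algebra_simps)
  have "cmod (X - \<kappa> * Ln (1 - a)) \<le> cmod (suminf ?lb - suminf ?la + (w - 1) * suminf g)
      + cmod \<kappa> * cmod (of_real (1 - p) * suminf g + Ln (1 - a))"
    unfolding Xeq by (rule tri)
  also have "\<dots> \<le> (cmod \<kappa>)\<^sup>2 * (M\<^sup>2 / d\<^sup>2) * (1 - p) + cmod \<kappa> * (M\<^sup>2 / d\<^sup>2 * (1 - p))"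
    by (intro add_mono e1 mult_left_mono W) auto
  finally have "cmod (X - \<kappa> * Ln (1 - a)) \<le> (cmod \<kappa> + (cmod \<kappa>)\<^sup>2) * (M\<^sup>2 / d\<^sup>2) * (1 - p)"
    by (simp only: distrib_right mult.assoc add.commute)
  moreover have "qpoch_inf p a / qpoch_inf p (w * a) = exp X"
    using La(2) Lb(2) by (simp add: X_def exp_diff b_def)
  ultimately show "\<exists>X. qpoch_inf p a / qpoch_inf p (w * a) = exp X \<and>
      cmod (X - \<kappa> * Ln (1 - a)) \<le> (cmod \<kappa> + (cmod \<kappa>)\<^sup>2) * (M\<^sup>2 / d\<^sup>2) * (1 - p)" by blast
qed


lemma uniform_limit_exp:
  fixes Y :: "'i \<Rightarrow> 'x \<Rightarrow> complex"
  assumes Y: "uniform_limit X Y Y0 \<Phi>" and b: "\<And>x. x \<in> X \<Longrightarrow> cmod (Y0 x) \<le> B"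
  shows "uniform_limit X (\<lambda>i x. exp (Y i x)) (\<lambda>x. exp (Y0 x)) \<Phi>"
proof (rule uniform_limit_compose_uniformly_continuous_on[OF Y])
  show "uniformly_continuous_on (cball 0 (B + 1)) (exp :: complex \<Rightarrow> complex)"
    by (intro compact_uniformly_continuous continuous_intros) auto
  show "\<forall>\<^sub>F i in \<Phi>. \<forall>x\<in>X. Y i x \<in> cball 0 (B + 1)"
    using uniform_limit_bound_eventually[OF Y b] by simp
qed auto

lemma uniform_limit_of_tendsto: "(g \<longlongrightarrow> g0) \<Phi> \<Longrightarrow> uniform_limit X (\<lambda>i x. g i) (\<lambda>x. g0) \<Phi>"
  unfolding uniform_limit_iff tendsto_iff by (auto elim: eventually_mono)

lemma powr_of_real_inverse: "q > 0 \<Longrightarrow> of_real (1 / q) powr c = of_real q powr (- c :: complex)"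
  by (simp add: powr_def Ln_of_real ln_div flip: of_real_divide)

text \<open>\<open>u (1 + x/l) = 1\<close> with \<open>0 < u \<le> 1\<close> means
  \<open>x = l (1/u - 1) \<ge> 0\<close>; this is where the half-line is excluded. The constant is a
  minimum over the compact set \<open>[0, 1] \<times> K\<close>.\<close>

lemma slit_ge_exists:
  assumes K: "compact K" and out: "K \<inter> complex_of_real ` {0..} = {}" and l: "l > 0"
  obtains d where "d > 0" "\<And>x. x \<in> K \<Longrightarrow> 1 + x / of_real l \<in> slit_ge d"
proof (cases "K = {}")
  case False
  let ?f = "\<lambda>z :: real \<times> complex. cmod (1 - of_real (fst z) * (1 + snd z / of_real l))"
  have "continuous_on ({0..1} \<times> K) ?f" using l by (intro continuous_intros) auto
  moreover have "compact ({0..1::real} \<times> K)" "{0..1::real} \<times> K \<noteq> {}"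
    using K False by (auto intro: compact_Times)
  ultimately obtain z0 where z0: "z0 \<in> {0..1} \<times> K" "\<And>z. z \<in> {0..1} \<times> K \<Longrightarrow> ?f z0 \<le> ?f z"
    using continuous_attains_inf[of "{0..1} \<times> K" ?f] by blast
  have "?f z0 \<noteq> 0"
  proof
    obtain u x where ux: "z0 = (u, x)" "0 \<le> u" "u \<le> 1" "x \<in> K" using z0(1) by auto
    assume "?f z0 = 0"
    then have eq: "of_real u * (1 + x / of_real l) = 1" using ux by simp
    then have u0: "u \<noteq> 0" by auto
    have "1 + x / of_real l = of_real (1 / u)" using eq u0 by (simp add: field_simps)
    then have "x = of_real l * (of_real (1 / u) - 1)" using l by (simp add: field_simps)
    then have "x = of_real (l * (1 / u - 1))" by simp
    moreover have "l * (1 / u - 1) \<ge> 0" using ux u0 l by simp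
    ultimately show False using out ux(4) by blast
  qed
  then show ?thesis using z0(2) by (intro that[of "?f z0"]) (auto simp: slit_ge_def)
qed (rule that[of 1], auto)

text \<open>The argument \<open>a i x\<close> tends to \<open>a0 x = 1 + x/l\<close> because
  \<open>(1 - p)/h\<close> tends to \<open>1/l\<close>, and the prefactor tends to
  \<open>l^c\<close>. The limit \<open>l^c (1 - a0 x)^c = l^c (- x/l)^c\<close> is
  \<open>(- x)^c\<close>, since \<open>l > 0\<close>.\<close>

lemma e_fun_converges_to_1_0:
  fixes q h :: "'i \<Rightarrow> real"
  assumes K: "compact K" and out: "K \<inter> complex_of_real ` {0..} = {}" and l: "l > 0"
    and q: "(q \<longlongrightarrow> 1) \<Phi>" and lim: "((\<lambda>i. h i / (q i - 1)) \<longlongrightarrow> l) \<Phi>"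
    and ev: "\<forall>\<^sub>F i in \<Phi>. q i > 1 \<and> h i > 0"
  shows "e_fun_converges q h 1 0 c K \<Phi>"
proof -
  define p where "p i = 1 / q i" for i
  define u where "u i = (1 - p i) / h i" for i
  have p: "(p \<longlongrightarrow> 1) \<Phi>"
    using tendsto_divide[OF tendsto_const[of 1] q] by (simp add: p_def[abs_def])
  have evp: "\<forall>\<^sub>F i in \<Phi>. 0 < p i \<and> p i < 1 \<and> u i > 0"
    using ev by eventually_elim (auto simp: p_def u_def)
  have "((\<lambda>i. p i / (h i / (q i - 1))) \<longlongrightarrow> 1 / l) \<Phi>"
    using l by (intro tendsto_divide p lim) auto
  moreover have "\<forall>\<^sub>F i in \<Phi>. p i / (h i / (q i - 1)) = u i"
    using ev by eventually_elim (auto simp: p_def u_def field_simps)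
  ultimately have u: "(u \<longlongrightarrow> 1 / l) \<Phi>" using tendsto_cong by force
  obtain d3 where d3: "d3 > 0" "\<And>x. x \<in> K \<Longrightarrow> 1 + x / of_real l \<in> slit_ge d3"
    using slit_ge_exists[OF K out l] by metis
  \<comment> \<open>One third of the margin allows for the move from \<open>a0\<close> to
    \<open>a i\<close>; the other two are required by \<open>qpoch_inf_quotient\<close>.\<close>
  define d where "d = d3 / 3"
  have d: "d > 0" using d3 by (simp add: d_def)
  define a where "a i x = of_real (u i) * x + of_real (p i)" for i and x :: complex
  define a0 where "a0 x = 1 + x / of_real l" for x :: complex
  have alim: "uniform_limit K a a0 \<Phi>"
  proof -
    have "uniform_limit K (\<lambda>i x. (\<lambda>(z :: (real \<times> real) \<times> complex). of_real (fst (fst z)) * snd z + of_real (snd (fst z))) ((u i, p i), x))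
       (\<lambda>x. (\<lambda>(z :: (real \<times> real) \<times> complex). of_real (fst (fst z)) * snd z + of_real (snd (fst z))) ((1 / l, 1), x)) \<Phi>"
      by (rule uniform_limit_joint_continuous[where S = UNIV]) (auto intro!: continuous_intros tendsto_intros K u p)
    then show ?thesis by (simp add: a_def[abs_def] a0_def[abs_def] add.commute)
  qed
  have "continuous_on K a0" unfolding a0_def[abs_def] using l by (intro continuous_intros) auto
  then obtain M0 where M0: "\<And>x. x \<in> K \<Longrightarrow> cmod (a0 x) \<le> M0" using compact_continuous_bound[OF K] by blast
  define M where "M = max 0 M0 + d"
  have M: "M > 0" using d by (simp add: M_def)
  have eva: "\<forall>\<^sub>F i in \<Phi>. \<forall>x\<in>K. a i x \<in> slit_ge (d + d) \<and> cmod (a i x) \<le> M"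
    using uniform_limitD[OF alim d]
  proof eventually_elim
    case (elim i)
    show ?case
    proof
      fix x assume x: "x \<in> K"
      then have le: "cmod (a i x - a0 x) \<le> d" using elim by (simp add: dist_norm less_imp_le)
      have "d3 = (d + d) + d" by (simp add: d_def)
      then have "a0 x \<in> slit_ge ((d + d) + d)" using d3(2)[OF x] by (simp add: a0_def)
      moreover have "cmod (a i x) \<le> M"
        using le M0[OF x] norm_triangle_ineq2[of "a i x" "a0 x"] by (simp add: M_def)
      ultimately show "a i x \<in> slit_ge (d + d) \<and> cmod (a i x) \<le> M"
        using slit_ge_near le by blast
    qed
  qed
  define R where "R = cmod c + 1"
  have R: "R > 0" "cball c 1 \<subseteq> cball 0 R"
    using cball_subset_cball_0[of c 1] by (simp_all add: R_def add_nonneg_pos)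
  define w where "w i c' = of_real (p i) powr c'" for i and c' :: complex
  have kap: "uniform_limit (cball c 1) (\<lambda>i. qbracket (p i)) (\<lambda>c'. c') \<Phi>"
    by (rule uniform_limit_on_subset[OF qbracket_uniform_limit[OF p] R(2)]) (use evp in \<open>auto elim: eventually_mono\<close>)
  have evk: "\<forall>\<^sub>F i in \<Phi>. \<forall>c'\<in>cball c 1. cmod (qbracket (p i) c') \<le> R + 1"
    using R(2) by (intro uniform_limit_bound_eventually[OF kap]) auto
  have kw: "qbracket (p i) c' = (1 - w i c') / of_real (1 - p i)" if "p i < 1" for i c'
    using that by (simp add: qbracket_complex w_def)
  have "((\<lambda>i. (R + 1) * (1 - p i) * M) \<longlongrightarrow> (R + 1) * (1 - 1) * M) \<Phi>" by (intro tendsto_intros p)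
  then have evw0: "\<forall>\<^sub>F i in \<Phi>. (R + 1) * (1 - p i) * M < d" using d by (intro order_tendstoD) auto
  define Bd where "Bd i = ((R + 1) + (R + 1)\<^sup>2) * (M\<^sup>2 / d\<^sup>2) * (1 - p i)" for i
  have "((\<lambda>i. ((R + 1) + (R + 1)\<^sup>2) * (M\<^sup>2 / d\<^sup>2) * (1 - p i)) \<longlongrightarrow> ((R + 1) + (R + 1)\<^sup>2) * (M\<^sup>2 / d\<^sup>2) * (1 - 1)) \<Phi>"
    by (intro tendsto_intros p)
  then have Bd: "(Bd \<longlongrightarrow> 0) \<Phi>" by (simp add: Bd_def[abs_def])
  \<comment> \<open>A logarithm of the quotient, chosen pointwise. The choice says nothing about
    regularity in the exponent; holomorphy is obtained below from the quotient itself.\<close>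
  define X where "X i z = (SOME X. qpoch_inf (p i) (a i (snd z)) / qpoch_inf (p i) (w i (fst z) * a i (snd z)) = exp X \<and>
      cmod (X - qbracket (p i) (fst z) * Ln (1 - a i (snd z))) \<le> Bd i)" for i z
  have evX: "\<forall>\<^sub>F i in \<Phi>. \<forall>z\<in>cball c 1 \<times> K. qpoch_inf (p i) (w i (fst z) * a i (snd z)) \<noteq> 0 \<and>
      qpoch_inf (p i) (a i (snd z)) / qpoch_inf (p i) (w i (fst z) * a i (snd z)) = exp (X i z) \<and>
      cmod (X i z - qbracket (p i) (fst z) * Ln (1 - a i (snd z))) \<le> Bd i"
    using eva evk evw0 evp
  proof eventually_elim
    case (elim i)
    show ?case
    proof
      fix z assume z: "z \<in> cball c 1 \<times> K"
      obtain c' x where cx: "z = (c', x)" "c' \<in> cball c 1" "x \<in> K" using z by auto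
      have p01: "0 < p i" "p i < 1" using elim by auto
      have ax: "a i x \<in> slit_ge (d + d)" "cmod (a i x) \<le> M" using elim cx by auto
      have k: "cmod (qbracket (p i) c') \<le> R + 1" using elim cx by auto
      have "w i c' - 1 = - (qbracket (p i) c' * of_real (1 - p i))" using p01 by (simp add: kw del: of_real_diff)
      then have "cmod (w i c' - 1) = cmod (qbracket (p i) c') * (1 - p i)"
        using p01 by (simp only: norm_minus_cancel norm_mult norm_of_real)
      also have "\<dots> \<le> (R + 1) * (1 - p i)" using k p01 by (intro mult_right_mono) auto
      finally have "cmod (w i c' - 1) * M \<le> (R + 1) * (1 - p i) * M" using M by (intro mult_right_mono) auto
      then have wM: "cmod (w i c' - 1) * M \<le> d" using elim by linarith
      have "(cmod (qbracket (p i) c') + (cmod (qbracket (p i) c'))\<^sup>2) * (M\<^sup>2 / d\<^sup>2) * (1 - p i) \<le> Bd i"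
        unfolding Bd_def using k p01 by (intro mult_right_mono add_mono power_mono) auto
      then have ex: "\<exists>X. qpoch_inf (p i) (a i x) / qpoch_inf (p i) (w i c' * a i x) = exp X \<and>
          cmod (X - qbracket (p i) c' * Ln (1 - a i x)) \<le> Bd i"
        using qpoch_inf_quotient(1)[OF p01 ax d wM] unfolding kw[OF p01(2), symmetric] by (meson order_trans)
      have "qpoch_inf (p i) (w i c' * a i x) \<noteq> 0" by (rule qpoch_inf_quotient(2)[OF p01 ax d wM])
      with someI_ex[OF ex] show "qpoch_inf (p i) (w i (fst z) * a i (snd z)) \<noteq> 0 \<and>
        qpoch_inf (p i) (a i (snd z)) / qpoch_inf (p i) (w i (fst z) * a i (snd z)) = exp (X i z) \<and>
        cmod (X i z - qbracket (p i) (fst z) * Ln (1 - a i (snd z))) \<le> Bd i"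
        unfolding X_def cx by simp
    qed
  qed
  have kapz: "uniform_limit (cball c 1 \<times> K) (\<lambda>i z. qbracket (p i) (fst z)) (\<lambda>z. fst z) \<Phi>"
    using kap by (rule uniform_limit_compose') auto
  \<comment> \<open>Keeps the logarithm off its cut both along the family, where
    \<open>t = p i\<close>, and in the limit, where \<open>t = 1\<close>.\<close>
  have not_nonpos: "1 - (of_real v * x + of_real t) \<notin> \<real>\<^sub>\<le>\<^sub>0" if "v > 0" "t \<le> 1" "x \<in> K" for v t x
  proof
    assume "1 - (of_real v * x + of_real t) \<in> \<real>\<^sub>\<le>\<^sub>0"
    then obtain r where r: "1 - (of_real v * x + of_real t) = of_real r" "r \<le> 0" by (auto elim: nonpos_Reals_cases)
    then have "of_real v * x = of_real (1 - t - r)" by (simp add: algebra_simps)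
    then have "x = of_real ((1 - t - r) / v)" using that by (simp add: field_simps)
    moreover have "(1 - t - r) / v \<ge> 0" using that r by auto
    ultimately show False using out that by blast
  qed
  have LnK: "uniform_limit K (\<lambda>i x. Ln (1 - a i x)) (\<lambda>x. Ln (1 - a0 x)) \<Phi>"
  proof -
    have "uniform_limit K (\<lambda>i x. (\<lambda>(z :: (real \<times> real) \<times> complex). Ln (1 - (of_real (fst (fst z)) * snd z + of_real (snd (fst z))))) ((u i, p i), x))
       (\<lambda>x. (\<lambda>(z :: (real \<times> real) \<times> complex). Ln (1 - (of_real (fst (fst z)) * snd z + of_real (snd (fst z))))) ((1 / l, 1), x)) \<Phi>"
    proof (rule uniform_limit_joint_continuous[where S = "{0<..} \<times> {..1}"])
      show "continuous_on (({0<..} \<times> {..1}) \<times> K) (\<lambda>(z :: (real \<times> real) \<times> complex). Ln (1 - (of_real (fst (fst z)) * snd z + of_real (snd (fst z)))))"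
        using not_nonpos by (intro continuous_intros) auto
      show "((\<lambda>i. (u i, p i)) \<longlongrightarrow> (1 / l, 1)) \<Phi>" by (intro tendsto_intros u p)
      show "\<forall>\<^sub>F i in \<Phi>. (u i, p i) \<in> {0<..} \<times> {..1}" using evp by eventually_elim auto
      show "(1 / l, 1 :: real) \<in> {0<..} \<times> {..1}" using l by auto
    qed (rule K)
    then show ?thesis by (simp add: a_def[abs_def] a0_def[abs_def] add.commute)
  qed
  then have Lnz: "uniform_limit (cball c 1 \<times> K) (\<lambda>i z. Ln (1 - a i (snd z))) (\<lambda>z. Ln (1 - a0 (snd z))) \<Phi>"
    by (rule uniform_limit_compose') auto
  have cLn: "continuous_on K (\<lambda>x. Ln (1 - a0 x))"
    unfolding a0_def using not_nonpos[of "1 / l" 1] l by (intro continuous_intros) (auto simp: add.commute)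
  then obtain BL where BL: "\<And>x. x \<in> K \<Longrightarrow> cmod (Ln (1 - a0 x)) \<le> BL" using compact_continuous_bound[OF K] by blast
  have kL: "uniform_limit (cball c 1 \<times> K) (\<lambda>i z. qbracket (p i) (fst z) * Ln (1 - a i (snd z))) (\<lambda>z. fst z * Ln (1 - a0 (snd z))) \<Phi>"
  proof (rule uniform_lim_mult[OF kapz Lnz])
    show "bounded (fst ` (cball c 1 \<times> K))" by (rule bounded_subset[of "cball c 1"]) auto
    show "bounded ((\<lambda>z. Ln (1 - a0 (snd z))) ` (cball c 1 \<times> K))" by (rule boundedI[of _ BL]) (use BL in auto)
  qed
  have Xerr: "uniform_limit (cball c 1 \<times> K) (\<lambda>i z. X i z - qbracket (p i) (fst z) * Ln (1 - a i (snd z))) (\<lambda>_. 0) \<Phi>"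
  proof (rule uniform_limitI)
    fix e :: real assume "e > 0"
    then have "\<forall>\<^sub>F i in \<Phi>. Bd i < e" using Bd by (intro order_tendstoD)
    with evX show "\<forall>\<^sub>F i in \<Phi>. \<forall>z\<in>cball c 1 \<times> K. dist (X i z - qbracket (p i) (fst z) * Ln (1 - a i (snd z))) 0 < e"
      by eventually_elim (force simp: dist_norm)
  qed
  have Xlim: "uniform_limit (cball c 1 \<times> K) X (\<lambda>z. fst z * Ln (1 - a0 (snd z))) \<Phi>"
    using uniform_limit_add[OF Xerr kL] by simp
  define g where "g i = ln (h i / (1 - p i))" for i
  have "((\<lambda>i. inverse (u i)) \<longlongrightarrow> inverse (1 / l)) \<Phi>" using l by (intro tendsto_inverse u) auto
  then have "((\<lambda>i. h i / (1 - p i)) \<longlongrightarrow> l) \<Phi>" by (simp add: u_def[abs_def] inverse_eq_divide)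
  then have g: "(g \<longlongrightarrow> ln l) \<Phi>" unfolding g_def[abs_def] using l by (intro tendsto_ln) auto
  have glim: "uniform_limit (cball c 1 \<times> K) (\<lambda>i z. fst z * complex_of_real (g i)) (\<lambda>z. fst z * complex_of_real (ln l)) \<Phi>"
  proof (rule uniform_lim_mult)
    show "uniform_limit (cball c 1 \<times> K) (\<lambda>i z. complex_of_real (g i)) (\<lambda>z. complex_of_real (ln l)) \<Phi>"
      by (intro uniform_limit_of_tendsto tendsto_of_real g)
    show "bounded (fst ` (cball c 1 \<times> K))" by (rule bounded_subset[of "cball c 1"]) auto
    show "bounded ((\<lambda>_. complex_of_real (ln l)) ` (cball c 1 \<times> K))"
      by (rule bounded_subset[of "{complex_of_real (ln l)}"]) auto
  qed (rule uniform_limit_const)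
  define Y0 where "Y0 z = fst z * complex_of_real (ln l) + fst z * Ln (1 - a0 (snd z))" for z
  have Ylim: "uniform_limit (cball c 1 \<times> K) (\<lambda>i z. exp (fst z * complex_of_real (g i) + X i z)) (\<lambda>z. exp (Y0 z)) \<Phi>"
    unfolding Y0_def
  proof (rule uniform_limit_exp[OF uniform_limit_add[OF glim Xlim]])
    fix z assume z: "z \<in> cball c 1 \<times> K"
    have "cmod (fst z) \<le> R" using z R(2) by auto
    moreover have "cmod (Ln (1 - a0 (snd z))) \<le> BL" using z BL by auto
    ultimately show "cmod (fst z * complex_of_real (ln l) + fst z * Ln (1 - a0 (snd z))) \<le> R * \<bar>ln l\<bar> + R * BL"
      using R(1) by (intro order_trans[OF norm_triangle_ineq] add_mono) (auto simp: norm_mult intro!: mult_mono)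
  qed
  have Y0: "exp (Y0 (c', x)) = (- x) powr c'" if "x \<in> K" for c' x
  proof -
    have x0: "x \<noteq> 0" using out that by (metis IntI atLeast_iff empty_iff imageI of_real_0 order_refl)
    have "Ln (1 - a0 x) = Ln (- x / of_real l)" by (simp add: a0_def)
    also have "\<dots> = Ln (- x) - of_real (ln l)" using Ln_divide_of_real[OF l, of "- x"] x0 by simp
    finally have eq: "Ln (1 - a0 x) = Ln (- x) - of_real (ln l)" .
    show ?thesis using x0 by (simp add: Y0_def powr_def eq right_diff_distrib)
  qed
  define E where "E i c' x = of_real (h i / (1 - p i)) powr c' * qpoch_inf (p i) (a i x) / qpoch_inf (p i) (w i c' * a i x)" for i c' x
  have eE: "e_fun (q i) (h i) c' x = E i c' x" if "q i > 1" "h i > 0" for i c' x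
    using that by (simp add: e_fun_def E_def a_def w_def u_def p_def Let_def)
  show ?thesis
  proof (rule e_fun_convergesI[OF K, where R = 1 and N = "\<lambda>i z. exp (fst z * complex_of_real (g i) + X i z)" and ?N0.0 = "\<lambda>z. exp (Y0 z)"
        and D = "\<lambda>_ _. 1" and ?D0.0 = "\<lambda>_. 1"])
    show "uniform_limit (cball c 1 \<times> K) (\<lambda>i z. exp (fst z * complex_of_real (g i) + X i z)) (\<lambda>z. exp (Y0 z)) \<Phi>" by (rule Ylim)
    show "continuous_on (cball c 1 \<times> K) (\<lambda>z. exp (Y0 z))"
      unfolding Y0_def by (intro continuous_intros continuous_on_compose2[OF cLn]) auto
    have ee: "\<forall>\<^sub>F i in \<Phi>. \<forall>c'\<in>cball c 1. \<forall>x\<in>K. E i c' x = exp (fst (c', x) * complex_of_real (g i) + X i (c', x))"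
      using evX evp ev
    proof eventually_elim
      case (elim i)
      show ?case
      proof (intro ballI)
        fix c' x assume "c' \<in> cball c 1" "x \<in> K"
        then have "qpoch_inf (p i) (a i x) / qpoch_inf (p i) (w i c' * a i x) = exp (X i (c', x))"
          using elim by auto
        moreover have "of_real (h i / (1 - p i)) powr c' = exp (c' * complex_of_real (g i))"
          using elim by (simp add: powr_def g_def Ln_of_real del: of_real_divide of_real_diff)
        ultimately show "E i c' x = exp (fst (c', x) * complex_of_real (g i) + X i (c', x))"
          by (simp add: E_def exp_add flip: times_divide_eq_right)
      qed
    qed
    with ev show "\<forall>\<^sub>F i in \<Phi>. \<forall>c'\<in>cball c 1. \<forall>x\<in>K. e_fun (q i) (h i) c' x = exp (fst (c', x) * complex_of_real (g i) + X i (c', x)) / 1"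
      by eventually_elim (auto simp: eE)
    show "e_fun 1 0 c' x = exp (Y0 (c', x)) / 1" if "c' \<in> cball c 1" "x \<in> K" for c' x
      using Y0[OF that(2)] by (simp add: e_fun_def)
    show "\<forall>\<^sub>F i in \<Phi>. \<forall>x\<in>K. (\<lambda>c'. exp (fst (c', x) * complex_of_real (g i) + X i (c', x))) holomorphic_on ball c 1 \<and> (\<lambda>c'. 1 :: complex) holomorphic_on ball c 1"
      using ee evX evp ev
    proof eventually_elim
      case (elim i)
      have p01: "0 < p i" "p i < 1" using elim by auto
      show ?case
      proof (intro ballI conjI)
        fix x assume x: "x \<in> K"
        have nz: "of_real (p i) \<noteq> (0 :: complex)" "complex_of_real (h i / (1 - p i)) \<noteq> 0" using elim by auto
        \<comment> \<open>Holomorphy passes from the explicit quotient \<open>E\<close> to the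
          exponential of the chosen \<open>X\<close>, the two being equal on the disc.\<close>
        have "(\<lambda>c'. qpoch_inf (p i) (w i c' * a i x)) holomorphic_on ball c 1"
          unfolding w_def using nz
          by (intro holomorphic_on_compose_gen[OF _ holomorphic_qpoch_inf[OF p01, of UNIV], unfolded o_def] holomorphic_intros) auto
        then have "E i c' x = exp (fst (c', x) * complex_of_real (g i) + X i (c', x))" if "c' \<in> ball c 1" for c'
          using elim x that by auto
        moreover have "(\<lambda>c'. E i c' x) holomorphic_on ball c 1"
          unfolding E_def using nz elim x
          by (intro holomorphic_intros \<open>(\<lambda>c'. qpoch_inf (p i) (w i c' * a i x)) holomorphic_on ball c 1\<close>) auto
        ultimately show "(\<lambda>c'. exp (fst (c', x) * complex_of_real (g i) + X i (c', x))) holomorphic_on ball c 1"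
          by (rule holomorphic_transform[rotated])
      qed (rule holomorphic_on_const)
    qed
    show "(\<lambda>c'. exp (Y0 (c', x))) holomorphic_on ball c 1" for x
      unfolding Y0_def fst_conv snd_conv by (intro holomorphic_intros)
  qed (auto intro: uniform_limit_const)
qed


section \<open>Confluence to $q = 1$\<close>

text \<open>The coefficient \<open>\<epsilon>\<close> in \<open>1 - p^(k+1) (1 - (1 - p) w) = (1 -
  p^(k+1)) (1 + \<epsilon> w)\<close>. At \<open>p = 1\<close> it is \<open>1/(k + 1)\<close>, the
  coefficient in Euler's product for 1/Gamma.\<close>

definition eps_quot :: "real \<Rightarrow> nat \<Rightarrow> real" where
  "eps_quot p k = p ^ Suc k / qnum p (Suc k)"

lemma qnum_pos:
  assumes "0 < p"
  shows "0 < qnum p (Suc k)"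
  unfolding qnum_def using assms by (intro sum_pos) auto

lemma eps_quot_pos: "0 < p \<Longrightarrow> 0 < eps_quot p k"
  using qnum_pos[of p k] by (simp add: eps_quot_def)

text \<open>Each of the \<open>k + 1\<close> powers in the bracket is at least
  \<open>p^(k+1)\<close>. The bound is independent of \<open>p\<close>, as domination of the
  products requires.\<close>

lemma eps_quot_le:
  assumes "0 < p" "p \<le> 1"
  shows "eps_quot p k \<le> 1 / real (Suc k)"
proof -
  have "(\<Sum>j<Suc k. p ^ Suc k) \<le> qnum p (Suc k)"
    unfolding qnum_def using assms by (intro sum_mono power_decreasing) auto
  then have "real (Suc k) * p ^ Suc k \<le> qnum p (Suc k)" by simp
  then show ?thesis
    using qnum_pos[OF assms(1), of k] by (simp add: eps_quot_def field_simps)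
qed

text \<open>\<open>1 + eps_quot p k\<close> is the quotient of the consecutive brackets of
  \<open>k + 2\<close> and \<open>k + 1\<close>, so the logarithms telescope.\<close>

lemma sum_ln_one_plus_eps_quot:
  assumes "0 < p"
  shows "(\<Sum>k<n. ln (1 + eps_quot p k)) = ln (qnum p (Suc n))"
proof (induction n)
  case 0 then show ?case by (simp add: qnum_def)
next
  case (Suc n)
  note pos = qnum_pos[OF assms]
  have "1 + eps_quot p n = qnum p (Suc (Suc n)) / qnum p (Suc n)"
    using pos[of n] unfolding eps_quot_def by (simp add: field_simps) (simp add: qnum_def)
  then show ?case using Suc pos[of n] pos[of "Suc n"] by (simp add: ln_div)
qed

text \<open>Euler's convergence factor \<open>(1 + e)^(-w)\<close> cancels the term of first order,
  as \<open>exp (- e w)\<close> would in Weierstrass' product; but its exponents telescope over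
  \<open>k\<close>, and no Euler constant appears.\<close>

definition phi_factor :: "real \<Rightarrow> complex \<Rightarrow> complex" where
  "phi_factor e w = (1 + of_real e * w) * exp (- (w * of_real (ln (1 + e))))"

text \<open>With \<open>L = ln (1 + e)\<close> and \<open>r\<close> the quadratic remainder of
  \<open>exp (- w L)\<close>, the difference is
  \<open>- (e w)^2 + (1 + e w) (w (e - L) + r)\<close>. Since \<open>e - L \<le> e^2\<close>, every
  term is of second order in \<open>e\<close>.\<close>

lemma phi_factor_bound:
  assumes e: "0 \<le> e" "e \<le> 1" and w: "cmod w \<le> R"
  shows "cmod (phi_factor e w - 1) \<le> (R\<^sup>2 + (1 + R) * (R + exp R * R\<^sup>2)) * e\<^sup>2"
proof -
  have R: "R \<ge> 0" using w norm_ge_zero order_trans by blast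
  define L where "L = ln (1 + e)"
  have L: "0 \<le> L" "L \<le> e" "e - L \<le> e\<^sup>2"
    using e ln_one_plus_pos_lower_bound[of e] by (auto simp: L_def ln_add_one_self_le_self)
  define z where "z = - (w * of_real L)"
  define r where "r = exp z - (1 + z)"
  have nz: "cmod z \<le> R * e"
    unfolding z_def norm_minus_cancel norm_mult using w L R by (intro mult_mono) auto
  also have "R * e \<le> R * 1" using R e by (intro mult_left_mono)
  finally have nz1: "cmod z \<le> R" by simp
  have "cmod r \<le> exp \<bar>Re z\<bar> * cmod z ^ 2"
    using Taylor_exp[of z 1] by (simp add: numeral_2_eq_2 r_def)
  also have "\<dots> \<le> exp R * (R * e)\<^sup>2"
    using nz nz1 abs_Re_le_cmod[of z] by (intro mult_mono power_mono) auto
  finally have r: "cmod r \<le> exp R * R\<^sup>2 * e\<^sup>2" by (simp add: power_mult_distrib)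
  have "cmod (w * of_real (e - L)) = cmod w * (e - L)"
    using L by (simp only: norm_mult norm_of_real abs_of_nonneg diff_ge_0_iff_ge)
  also have "\<dots> \<le> R * e\<^sup>2" using w L R by (intro mult_mono) auto
  finally have A: "cmod (w * of_real (e - L) + r) \<le> (R + exp R * R\<^sup>2) * e\<^sup>2"
    using r norm_triangle_ineq[of "w * of_real (e - L)" r] by (simp add: algebra_simps)
  have "cmod (1 + of_real e * w) \<le> 1 + e * R"
    using norm_triangle_ineq[of 1 "of_real e * w"] e w mult_left_mono[of "cmod w" R e] by (simp add: norm_mult)
  also have "\<dots> \<le> 1 + R" using mult_right_mono[of e 1 R] e R by simp
  finally have B: "cmod (1 + of_real e * w) \<le> 1 + R" .
  have "phi_factor e w - 1 = - ((of_real e * w)\<^sup>2) + (1 + of_real e * w) * (w * of_real (e - L) + r)"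
    unfolding phi_factor_def r_def L_def[symmetric] z_def[symmetric]
    by (simp add: z_def power2_eq_square algebra_simps)
  then have "cmod (phi_factor e w - 1) \<le> cmod ((of_real e * w)\<^sup>2) + cmod (1 + of_real e * w) * cmod (w * of_real (e - L) + r)"
    by (metis norm_minus_cancel norm_mult norm_triangle_ineq)
  also have "\<dots> \<le> R\<^sup>2 * e\<^sup>2 + (1 + R) * ((R + exp R * R\<^sup>2) * e\<^sup>2)"
  proof (intro add_mono mult_mono A B)
    show "cmod ((of_real e * w)\<^sup>2) \<le> R\<^sup>2 * e\<^sup>2"
    proof -
      have "cmod ((of_real e * w)\<^sup>2) = (cmod w)\<^sup>2 * e\<^sup>2"
        by (simp add: norm_power norm_mult power_mult_distrib)
      also have "\<dots> \<le> R\<^sup>2 * e\<^sup>2" using w by (intro mult_right_mono power_mono) auto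
      finally show ?thesis .
    qed
  qed (use R in auto)
  finally show ?thesis by (simp add: algebra_simps)
qed

text \<open>The reciprocal of the $p$-Gamma function, in the variable $w = (1-p^y)/(1-p)$.\<close>

definition rGamma_p :: "real \<Rightarrow> complex \<Rightarrow> complex" where
  "rGamma_p p w = w * prodinf (\<lambda>k. phi_factor (eps_quot p k) w)"

lemma phi_factor_eps_bound:
  assumes "0 < p" "p \<le> 1" "cmod w \<le> R"
  shows "cmod (phi_factor (eps_quot p k) w - 1) \<le> (R\<^sup>2 + (1 + R) * (R + exp R * R\<^sup>2)) * (1 / real (Suc k))\<^sup>2"
proof -
  have R: "R \<ge> 0" using assms norm_ge_zero order_trans by blast
  have e: "0 \<le> eps_quot p k" "eps_quot p k \<le> 1 / real (Suc k)"
    using eps_quot_le[OF assms(1,2)] eps_quot_pos[OF assms(1)] less_imp_le by auto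
  have "1 / real (Suc k) \<le> 1" by simp
  then have "eps_quot p k \<le> 1" using e order_trans by blast
  from phi_factor_bound[OF e(1) this assms(3)] show ?thesis
    using e R by (elim order_trans) (intro mult_left_mono power_mono add_nonneg_nonneg mult_nonneg_nonneg; simp)
qed

lemma summable_phi_bound: "summable (\<lambda>k. B * (1 / real (Suc k))\<^sup>2)"
  using inverse_squares_sums by (intro summable_mult) (auto simp: sums_iff power_divide add.commute)

lemma rGamma_p_tendsto:
  assumes "0 < p" "p \<le> 1"
  shows "(\<lambda>n. w * (\<Prod>k<n. phi_factor (eps_quot p k) w)) \<longlonglongrightarrow> rGamma_p p w"
proof -
  have "convergent_prod (\<lambda>k. phi_factor (eps_quot p k) w)"
    by (rule prod_dominated(1)[OF summable_phi_bound phi_factor_eps_bound[OF assms order_refl]])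
  from convergent_prod_LIMSEQ[OF this] have "(\<lambda>n. \<Prod>k<n. phi_factor (eps_quot p k) w) \<longlonglongrightarrow> prodinf (\<lambda>k. phi_factor (eps_quot p k) w)"
    by (subst (asm) lessThan_Suc_atMost[symmetric]) (rule LIMSEQ_imp_Suc)
  then show ?thesis unfolding rGamma_p_def by (rule tendsto_mult_left)
qed

lemma prod_phi_factor:
  assumes "0 < p"
  shows "(\<Prod>k<n. phi_factor (eps_quot p k) w) =
    (\<Prod>k<n. 1 + of_real (eps_quot p k) * w) * exp (- (w * of_real (ln (qnum p (Suc n)))))"
  unfolding phi_factor_def prod.distrib sum_ln_one_plus_eps_quot[OF assms, symmetric]
  by (simp add: exp_sum[symmetric] sum_negf sum_distrib_left)

text \<open>The partial products are those of \<open>rGamma_series\<close> with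
  \<open>ln (n + 1)\<close> in place of \<open>ln n\<close>; the correcting factor tends to
  1.\<close>

lemma rGamma_p_1: "rGamma_p 1 w = rGamma w"
proof -
  have poch: "pochhammer w (Suc n) = w * fact n * (\<Prod>k<n. 1 + of_real (eps_quot 1 k) * w)" for n
  proof (induction n)
    case (Suc n)
    have "w + of_nat (Suc n) = of_nat (Suc n) * (1 + of_real (eps_quot 1 n) * w)"
      by (simp add: eps_quot_def field_simps del: of_nat_Suc)
    then show ?case
      using Suc by (subst pochhammer_Suc) (simp add: mult_ac)
  qed simp
  have part: "w * (\<Prod>k<n. phi_factor (eps_quot 1 k) w) = rGamma_series w n * exp (- (w * of_real (ln (1 + 1 / real n))))"
    if "n > 0" for n
  proof -
    have "ln (1 + 1 / real n) = ln (real (Suc n) / real n)" using that by (simp add: field_simps)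
    also have "\<dots> = ln (real (Suc n)) - ln (real n)" using that by (subst ln_div) auto
    finally have l: "ln (real (Suc n)) = ln (real n) + ln (1 + 1 / real n)" by simp
    have e: "exp (- (w * of_real (ln (real (Suc n))))) =
        exp (- (w * of_real (ln (real n)))) * exp (- (w * of_real (ln (1 + 1 / real n))))"
      unfolding l by (simp only: of_real_add distrib_left minus_add_distrib exp_add)
    show ?thesis
      unfolding prod_phi_factor[OF zero_less_one] rGamma_series_def qnum_one e Suc_eq_plus1[symmetric] poch
      by (simp add: exp_minus field_simps)
  qed
  have "(\<lambda>n. rGamma_series w n * exp (- (w * of_real (ln (1 + 1 / real n))))) \<longlonglongrightarrow> rGamma w * exp (- (w * of_real (ln (1 + 0))))"
    by (intro tendsto_intros lim_1_over_n) auto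
  then have "(\<lambda>n. rGamma_series w n * exp (- (w * of_real (ln (1 + 1 / real n))))) \<longlonglongrightarrow> rGamma w" by simp
  then have "(\<lambda>n. w * (\<Prod>k<n. phi_factor (eps_quot 1 k) w)) \<longlonglongrightarrow> rGamma w"
    by (rule Lim_transform_eventually) (use part in \<open>auto simp: eventually_sequentially intro!: exI[of _ 1]\<close>)
  then show ?thesis using rGamma_p_tendsto[of 1 w] LIMSEQ_unique by auto
qed

text \<open>The majorant, a multiple of \<open>1/(k + 1)^2\<close>, does not depend on
  \<open>p\<close>, so dominated convergence of products applies on every disc.\<close>

lemma rGamma_p_uniform_limit:
  assumes p: "(p \<longlongrightarrow> 1) \<Phi>" and ev: "\<forall>\<^sub>F i in \<Phi>. 0 < p i \<and> p i \<le> 1"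
  shows "uniform_limit (cball 0 R) (\<lambda>i. rGamma_p (p i)) rGamma \<Phi>"
proof -
  have U: "uniform_limit (cball 0 R) (\<lambda>i w. phi_factor (eps_quot (p i) k) w) (\<lambda>w. phi_factor (eps_quot 1 k) w) \<Phi>" for k
  proof -
    have "uniform_limit (cball 0 R) (\<lambda>i w. (\<lambda>z. phi_factor (eps_quot (fst z) k) (snd z)) (p i, w))
      (\<lambda>w. (\<lambda>z. phi_factor (eps_quot (fst z) k) (snd z)) (1, w)) \<Phi>"
    proof (rule uniform_limit_joint_continuous[where S = "{0<..1}"])
      have "1 + eps_quot x k \<noteq> 0" if "0 < x" for x using eps_quot_pos[OF that, of k] by linarith
      moreover have "qnum x (Suc k) \<noteq> 0" if "0 < x" for x using qnum_pos[OF that, of k] by linarith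
      ultimately show "continuous_on ({0<..1} \<times> cball 0 R) (\<lambda>z. phi_factor (eps_quot (fst z) k) (snd z))"
        unfolding phi_factor_def eps_quot_def by (intro continuous_intros) auto
    qed (use p ev in auto)
    then show ?thesis by simp
  qed
  have b0: "cmod (phi_factor (eps_quot 1 k) w - 1) \<le> (R\<^sup>2 + (1 + R) * (R + exp R * R\<^sup>2)) * (1 / real (Suc k))\<^sup>2"
    if "w \<in> cball 0 R" for w k using that by (intro phi_factor_eps_bound) auto
  have ul: "uniform_limit (cball 0 R) (\<lambda>i w. prodinf (\<lambda>k. phi_factor (eps_quot (p i) k) w)) (\<lambda>w. prodinf (\<lambda>k. phi_factor (eps_quot 1 k) w)) \<Phi>"
  proof (rule uniform_limit_prodinf_dominated[OF summable_phi_bound U _ b0])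
    show "\<forall>\<^sub>F i in \<Phi>. \<forall>w\<in>cball 0 R. \<forall>k. cmod (phi_factor (eps_quot (p i) k) w - 1) \<le> (R\<^sup>2 + (1 + R) * (R + exp R * R\<^sup>2)) * (1 / real (Suc k))\<^sup>2"
      using ev by eventually_elim (intro ballI allI phi_factor_eps_bound, auto)
  qed
  have "bounded ((\<lambda>w. prodinf (\<lambda>k. phi_factor (eps_quot 1 k) w)) ` cball 0 R)"
  proof (rule boundedI, clarify)
    fix w :: complex assume w: "w \<in> cball 0 R"
    let ?m = "\<lambda>k. (R\<^sup>2 + (1 + R) * (R + exp R * R\<^sup>2)) * (1 / real (Suc k))\<^sup>2"
    have "cmod (prodinf (\<lambda>k. phi_factor (eps_quot 1 k) w) - 1) \<le> exp (suminf ?m) * suminf ?m"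
      using prod_dominated(5)[OF summable_phi_bound b0[OF w], of 0] by simp
    then show "cmod (prodinf (\<lambda>k. phi_factor (eps_quot 1 k) w)) \<le> exp (suminf ?m) * suminf ?m + 1"
      using norm_triangle_ineq2[of "prodinf (\<lambda>k. phi_factor (eps_quot 1 k) w)" 1] by simp
  qed
  then have "uniform_limit (cball 0 R) (\<lambda>i w. w * prodinf (\<lambda>k. phi_factor (eps_quot (p i) k) w)) (\<lambda>w. w * prodinf (\<lambda>k. phi_factor (eps_quot 1 k) w)) \<Phi>"
    by (intro uniform_lim_mult uniform_limit_const ul) auto
  then show ?thesis
    using rGamma_p_1 by (simp add: rGamma_p_def[abs_def])
qed

lemma qpoch_inf_self_nonzero: "0 < p \<Longrightarrow> p < 1 \<Longrightarrow> qpoch_inf p (of_real p) \<noteq> 0"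
proof
  assume p: "0 < p" "p < 1" "qpoch_inf p (of_real p) = 0"
  then obtain k where "complex_of_real p ^ k * of_real p = 1" using qpoch_inf_eq_0D by blast
  then have "complex_of_real (p ^ Suc k) = of_real 1" by (simp add: mult.commute)
  then have "p ^ Suc k = 1" unfolding of_real_eq_iff .
  then show False using p power_Suc_less_one[of p k] by simp
qed

text \<open>The factor of index 0 is \<open>(1 - p) w\<close>, the later ones split into a factor of
  \<open>(p;p)\<close> and \<open>1 + \<epsilon> w\<close>. The brackets tend to
  \<open>1/(1 - p)\<close>, which produces the power of \<open>1 - p\<close>; its exponent is
  \<open>w\<close>, not the \<open>y\<close> of which \<open>w\<close> is the bracket, so that the
  formula involves \<open>w\<close> alone.\<close>

lemma qpoch_inf_eq_rGamma_p:
  assumes p: "0 < p" "p < 1"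
  shows "qpoch_inf p (1 - of_real (1 - p) * w) =
    of_real (1 - p) * qpoch_inf p (of_real p) * exp (- (w * of_real (ln (1 - p)))) * rGamma_p p w"
proof -
  define a where "a = 1 - of_real (1 - p) * w"
  have fac: "1 - of_real p ^ Suc k * a = (1 - of_real p ^ k * of_real p) * (1 + of_real (eps_quot p k) * w)" for k
  proof -
    have p1: "p ^ Suc k < 1" by (rule power_Suc_less_one[OF p])
    have "eps_quot p k = p ^ Suc k * (1 - p) / (1 - p ^ Suc k)"
      unfolding eps_quot_def using p p1 by (subst qnum_closed) (auto simp: field_simps)
    then have "(1 - p ^ Suc k) * eps_quot p k = p ^ Suc k * (1 - p)" using p1 by simp
    then have "complex_of_real ((1 - p ^ Suc k) * eps_quot p k) = of_real (p ^ Suc k * (1 - p))" by simp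
    then have "(1 - of_real p ^ Suc k) * of_real (eps_quot p k) = of_real p ^ Suc k * (1 - of_real p :: complex)"
      by simp
    then have *: "(1 - of_real p ^ Suc k) * (of_real (eps_quot p k) * w) = of_real p ^ Suc k * (1 - of_real p) * w"
      by (metis mult.assoc)
    have "(1 - of_real p ^ Suc k) * (1 + of_real (eps_quot p k) * w) = (1 - of_real p ^ Suc k) + of_real p ^ Suc k * (1 - of_real p) * w"
      unfolding distrib_left * by simp
    also have "\<dots> = 1 - of_real p ^ Suc k * a" by (simp add: a_def algebra_simps)
    finally show ?thesis by (simp add: mult.commute)
  qed
  have part: "(\<Prod>k<Suc n. 1 - of_real p ^ k * a) = of_real (1 - p) * (\<Prod>k<n. 1 - of_real p ^ k * of_real p)
     * exp (w * of_real (ln (qnum p (Suc n)))) * (w * (\<Prod>k<n. phi_factor (eps_quot p k) w))" for n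
  proof -
    have "(\<Prod>k<Suc n. 1 - of_real p ^ k * a) = (1 - a) * (\<Prod>k<n. 1 - of_real p ^ Suc k * a)"
      by (subst prod.lessThan_Suc_shift) simp
    also have "\<dots> = of_real (1 - p) * w * ((\<Prod>k<n. 1 - of_real p ^ k * of_real p) * (\<Prod>k<n. 1 + of_real (eps_quot p k) * w))"
      unfolding fac prod.distrib by (simp add: a_def)
    also have "(\<Prod>k<n. 1 + of_real (eps_quot p k) * w) = exp (w * of_real (ln (qnum p (Suc n)))) * (\<Prod>k<n. phi_factor (eps_quot p k) w)"
      unfolding prod_phi_factor[OF p(1)] by (simp add: exp_minus)
    finally show ?thesis by (simp add: mult_ac)
  qed
  have qn: "(\<lambda>n. qnum p (Suc n)) \<longlonglongrightarrow> (0 - 1) / (p - 1)"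
    using p by (subst qnum_closed, simp) (intro tendsto_intros LIMSEQ_Suc[OF LIMSEQ_realpow_zero]; simp)
  have "(0 - 1) / (p - 1) = 1 / (1 - p)" using p by (simp add: field_simps)
  then have "(\<lambda>n. ln (qnum p (Suc n))) \<longlonglongrightarrow> ln (1 / (1 - p))"
    using tendsto_ln[OF qn] p by simp
  then have lnq: "(\<lambda>n. ln (qnum p (Suc n))) \<longlonglongrightarrow> - ln (1 - p)" using p by (simp add: ln_div)
  have "(\<lambda>n. \<Prod>k<Suc n. 1 - of_real p ^ k * a) \<longlonglongrightarrow> of_real (1 - p) * qpoch_inf p (of_real p)
     * exp (w * of_real (- ln (1 - p))) * rGamma_p p w"
    unfolding part using p by (intro tendsto_mult tendsto_const qpoch_inf_tendsto tendsto_exp tendsto_of_real lnq rGamma_p_tendsto) auto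
  moreover have "(\<lambda>n. \<Prod>k<Suc n. 1 - of_real p ^ k * a) \<longlonglongrightarrow> qpoch_inf p a"
    by (rule LIMSEQ_Suc[OF qpoch_inf_tendsto[OF p]])
  ultimately have "qpoch_inf p a = of_real (1 - p) * qpoch_inf p (of_real p)
     * exp (w * of_real (- ln (1 - p))) * rGamma_p p w" using LIMSEQ_unique by blast
  then show ?thesis by (simp add: a_def)
qed

lemma holomorphic_rGamma_p:
  assumes p: "0 < p" "p \<le> 1"
  shows "rGamma_p p holomorphic_on A"
proof (cases "p = 1")
  case True
  then show ?thesis using rGamma_p_1 by (metis (no_types, lifting) ext holomorphic_rGamma)
next
  case False
  then have p1: "p < 1" using p by simp
  have nz: "of_real (1 - p) * qpoch_inf p (of_real p) \<noteq> (0::complex)" using qpoch_inf_self_nonzero[OF p(1) p1] p1 by simp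
  have "rGamma_p p w = qpoch_inf p (1 - of_real (1 - p) * w) * exp (w * of_real (ln (1 - p))) / (of_real (1 - p) * qpoch_inf p (of_real p))" for w
    unfolding qpoch_inf_eq_rGamma_p[OF p(1) p1] using nz by (simp add: exp_minus field_simps)
  then have eq: "rGamma_p p = (\<lambda>w. qpoch_inf p (1 - of_real (1 - p) * w) * exp (w * of_real (ln (1 - p))) / (of_real (1 - p) * qpoch_inf p (of_real p)))"
    by blast
  have "(\<lambda>w. qpoch_inf p (1 - of_real (1 - p) * w)) holomorphic_on A"
    by (intro holomorphic_on_compose_gen[OF _ holomorphic_qpoch_inf[OF p(1) p1, of UNIV], unfolded o_def] holomorphic_intros) auto
  then show ?thesis unfolding eq using nz by (intro holomorphic_intros) auto
qed

text \<open>Applied to \<open>x = 1 - p\<close>, it shows that a factor \<open>1 - p\<close> beats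
  the divergence of \<open>ln (1 - p)\<close>.\<close>

lemma one_minus_mult_ln_bound:
  fixes x :: real
  assumes "0 < x" "x \<le> 1"
  shows "x * \<bar>ln x\<bar> \<le> 2 * sqrt x"
proof -
  define s where "s = sqrt x"
  have s: "s > 0" "x = s * s" using assms by (auto simp: s_def)
  have "- ln s \<le> 1 / s - 1" using ln_le_minus_one[of "1 / s"] s by (simp add: ln_div)
  then have "- ln x \<le> 2 / s" unfolding s(2) using s(1) by (simp add: ln_mult)
  moreover have "\<bar>ln x\<bar> = - ln x" using assms by simp
  ultimately have "x * \<bar>ln x\<bar> \<le> x * (2 / s)" using assms by (intro mult_left_mono) auto
  also have "\<dots> = 2 * s" using s by simp
  finally show ?thesis by (simp add: s_def)
qed


text \<open>If \<open>w\<close> is the bracket of \<open>y\<close> in base \<open>p\<close>, then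
  \<open>w'\<close> is that of \<open>y + c\<close>; correspondingly
  \<open>1 - (1 - p) w' = p^c (1 - (1 - p) w)\<close>. The constants \<open>(p;p)\<close> cancel,
  and the powers of \<open>1 - p\<close> leave the exponent \<open>w' - w - c\<close>. At
  \<open>p = 1\<close>, where the logarithm would be that of 0, this factor is 1.\<close>

lemma e_fun_eq_rGamma_p:
  fixes q h :: real and c x :: complex
  assumes q: "q \<ge> 1" and h: "h > 0"
  defines "p \<equiv> 1 / q" and "w \<equiv> 1 - x / of_real h"
  defines "w' \<equiv> qbracket p c + of_real p powr c * w"
  shows "e_fun q h c x = exp (c * of_real (ln h)) * (if p = 1 then 1 else exp ((w' - w - c) * of_real (ln (1 - p))))
     * rGamma_p p w / rGamma_p p w'"
proof (cases "q = 1")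
  case True
  \<comment> \<open>At \<open>q = 1\<close> the identity includes the poles, because
    \<open>Gamma\<close> is the inverse of \<open>rGamma\<close> and
    \<open>inverse 0 = 0\<close>.\<close>
  have "w' = 1 + c - x / of_real h" using True by (simp add: w'_def w_def p_def qbracket_complex)
  then show ?thesis
    using True h by (simp add: e_fun_def p_def w_def rGamma_p_1 Gamma_def powr_def Ln_of_real divide_inverse mult_ac)
next
  case False
  then have q1: "q > 1" using q by simp
  have p: "0 < p" "p < 1" using q1 by (auto simp: p_def)
  define a where "a = of_real (1 - p) * x / of_real h + of_real p"
  have a: "a = 1 - of_real (1 - p) * w" using h by (simp add: a_def w_def algebra_simps)
  have "of_real (1 - p) * qbracket p c = 1 - of_real p powr c"
    using p by (simp add: qbracket_complex del: of_real_diff)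
  then have pa: "of_real p powr c * a = 1 - of_real (1 - p) * w'"
    unfolding a w'_def by (simp add: algebra_simps)
  have nz: "of_real (1 - p) * qpoch_inf p (of_real p) \<noteq> (0::complex)" using qpoch_inf_self_nonzero[OF p] p by simp
  have cancel: "A * B * (of_real (1 - p) * qpoch_inf p (of_real p) * C * G) / (of_real (1 - p) * qpoch_inf p (of_real p) * C' * G') = A * (B * C / C') * G / G'"
    for A B C C' G G' :: complex
    using nz by simp
  have "e_fun q h c x = of_real (h / (1 - p)) powr c * qpoch_inf p a / qpoch_inf p (of_real p powr c * a)"
    using q1 h by (simp add: e_fun_def Let_def p_def a_def)
  also have "of_real (h / (1 - p)) powr c = exp (c * of_real (ln h)) * exp (- (c * of_real (ln (1 - p))))"
    using h p by (simp add: powr_def Ln_of_real ln_div exp_add[symmetric] del: of_real_divide of_real_diff)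
      (simp add: algebra_simps)
  finally have "e_fun q h c x = exp (c * of_real (ln h)) * (exp (- (c * of_real (ln (1 - p)))) * exp (- (w * of_real (ln (1 - p)))) / exp (- (w' * of_real (ln (1 - p)))))
    * rGamma_p p w / rGamma_p p w'"
    unfolding pa unfolding a qpoch_inf_eq_rGamma_p[OF p] by (simp only: cancel)
  also have "exp (- (c * of_real (ln (1 - p)))) * exp (- (w * of_real (ln (1 - p)))) / exp (- (w' * of_real (ln (1 - p))))
    = exp ((w' - w - c) * of_real (ln (1 - p)))"
    by (simp add: exp_add[symmetric] exp_diff[symmetric] algebra_simps)
  finally show ?thesis using p by simp
qed

text \<open>The family may contain points with \<open>q = 1\<close> besides those with
  \<open>q > 1\<close>; hence the case distinctions on \<open>p i = 1\<close>, and a single formula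
  in terms of \<open>rGamma_p\<close> for both.\<close>

lemma e_fun_converges_to_q_1:
  fixes q h :: "'i \<Rightarrow> real"
  assumes K: "compact K" and out: "K \<inter> gamma_poles h0 c = {}" and h0: "h0 > 0"
    and q: "(q \<longlongrightarrow> 1) \<Phi>" and h: "(h \<longlongrightarrow> h0) \<Phi>" and ev: "\<forall>\<^sub>F i in \<Phi>. q i \<ge> 1"
  shows "e_fun_converges q h 1 h0 c K \<Phi>"
proof -
  define p where "p i = 1 / q i" for i
  have p: "(p \<longlongrightarrow> 1) \<Phi>"
    using tendsto_divide[OF tendsto_const[of 1] q] by (simp add: p_def[abs_def])
  have evp: "\<forall>\<^sub>F i in \<Phi>. 0 < p i \<and> p i \<le> 1"
    using ev by eventually_elim (auto simp: p_def)
  have evh: "\<forall>\<^sub>F i in \<Phi>. h i > 0" using h h0 by (intro order_tendstoD) auto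
  define w where "w i x = 1 - x / of_real (h i)" for i and x :: complex
  define w0 where "w0 x = 1 - x / of_real h0" for x :: complex
  define pc where "pc i c' = of_real (p i) powr c'" for i and c' :: complex
  define w' where "w' i z = qbracket (p i) (fst z) + pc i (fst z) * w i (snd z)" for i z
  define R where "R = cmod c + 1"
  have R: "R > 0" "cball c 1 \<subseteq> cball 0 R"
    using cball_subset_cball_0[of c 1] by (simp_all add: R_def add_nonneg_pos)
  have wlim: "uniform_limit K w w0 \<Phi>"
  proof -
    have "uniform_limit K (\<lambda>i x. (\<lambda>(z :: real \<times> complex). 1 - snd z / of_real (fst z)) (h i, x))
       (\<lambda>x. (\<lambda>(z :: real \<times> complex). 1 - snd z / of_real (fst z)) (h0, x)) \<Phi>"
      by (rule uniform_limit_joint_continuous[where S = "{0<..}"])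
        (use K h evh h0 in \<open>auto intro!: continuous_intros\<close>)
    then show ?thesis by (simp add: w_def[abs_def] w0_def[abs_def])
  qed
  have cw0: "continuous_on K w0" unfolding w0_def[abs_def] using h0 by (intro continuous_intros) auto
  then obtain W0 where W0: "\<And>x. x \<in> K \<Longrightarrow> cmod (w0 x) \<le> W0" using compact_continuous_bound[OF K] by blast
  define W where "W = max 0 W0 + 1"
  have W: "W > 0" by (simp add: W_def)
  have evw: "\<forall>\<^sub>F i in \<Phi>. \<forall>x\<in>K. cmod (w i x) \<le> W"
    using W0 by (intro uniform_limit_bound_eventually[OF wlim, of "max 0 W0", folded W_def]) (auto intro: max.coboundedI2)
  have kap: "uniform_limit (cball c 1) (\<lambda>i. qbracket (p i)) (\<lambda>c'. c') \<Phi>"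
    by (rule uniform_limit_on_subset[OF qbracket_uniform_limit[OF p] R(2)]) (use evp in \<open>auto elim: eventually_mono\<close>)
  have pcl: "uniform_limit (cball c 1) pc (\<lambda>_. 1) \<Phi>"
  proof -
    have "uniform_limit (cball c 1) (\<lambda>i x. (\<lambda>(z :: real \<times> complex). exp (snd z * of_real (ln (fst z)))) (p i, x))
       (\<lambda>x. (\<lambda>(z :: real \<times> complex). exp (snd z * of_real (ln (fst z)))) (1, x)) \<Phi>"
      by (rule uniform_limit_joint_continuous[where S = "{0<..}"])
        (use p evp in \<open>auto intro!: continuous_intros elim: eventually_mono\<close>)
    then have "uniform_limit (cball c 1) (\<lambda>i c'. exp (c' * of_real (ln (p i)))) (\<lambda>_. 1) \<Phi>" by simp
    moreover have "\<forall>\<^sub>F i in \<Phi>. \<forall>c'\<in>cball c 1. exp (c' * of_real (ln (p i))) = pc i c'"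
      using evp by eventually_elim (simp add: pc_def powr_def Ln_of_real)
    ultimately show ?thesis by (elim uniform_limit_cong[THEN iffD1, rotated 2]) auto
  qed
  have bK: "bounded ((\<lambda>z. w0 (snd z)) ` (cball c 1 \<times> K))"
    by (rule boundedI[of _ W0]) (use W0 in auto)
  have w'lim: "uniform_limit (cball c 1 \<times> K) w' (\<lambda>z. fst z + w0 (snd z)) \<Phi>"
  proof -
    have "uniform_limit (cball c 1 \<times> K) (\<lambda>i z. qbracket (p i) (fst z) + pc i (fst z) * w i (snd z)) (\<lambda>z. fst z + 1 * w0 (snd z)) \<Phi>"
      by (intro uniform_limit_add uniform_lim_mult uniform_limit_compose'[OF kap] uniform_limit_compose'[OF pcl] uniform_limit_compose'[OF wlim] bK)
        (auto intro: bounded_subset[of "{1}"])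
    then show ?thesis by (simp add: w'_def[abs_def])
  qed
  have evw': "\<forall>\<^sub>F i in \<Phi>. \<forall>z\<in>cball c 1 \<times> K. w' i z \<in> cball 0 (R + W)"
  proof -
    have "cmod (fst z + w0 (snd z)) \<le> R + max 0 W0" if "z \<in> cball c 1 \<times> K" for z
      using that R(2) W0 by (intro norm_triangle_mono) (auto intro: max.coboundedI2)
    from uniform_limit_bound_eventually[OF w'lim this] show ?thesis by (simp add: W_def add.assoc)
  qed
  define eta where "eta i z = (if p i = 1 then 0 else (w' i z - w i (snd z) - fst z) * of_real (ln (1 - p i)))" for i z
  \<comment> \<open>From \<open>p^c = 1 - (1 - p) [c]\<close> one gets
    \<open>w' - w - c = ([c] - c) - (1 - p) [c] w\<close>, the bracket being in base
    \<open>p\<close>; the two summands of \<open>Ck\<close> bound these two terms, divided by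
    \<open>1 - p\<close>.\<close>
  define Ck where "Ck = (2 * R + 4 * R\<^sup>2 * exp R) + (R + (2 * R + 4 * R\<^sup>2 * exp R)) * W"
  have Ck: "Ck \<ge> 0" using R W by (simp add: Ck_def)
  have "\<forall>\<^sub>F i in \<Phi>. 1 / 2 < p i" using p by (intro order_tendstoD) auto
  then have eta_le: "\<forall>\<^sub>F i in \<Phi>. \<forall>z\<in>cball c 1 \<times> K. cmod (eta i z) \<le> Ck * (2 * sqrt (1 - p i))"
    using evp evw
  proof eventually_elim
    case (elim i)
    show ?case
    proof
      fix z assume z: "z \<in> cball c 1 \<times> K"
      obtain c' x where cx: "z = (c', x)" "c' \<in> cball c 1" "x \<in> K" using z by auto
      show "cmod (eta i z) \<le> Ck * (2 * sqrt (1 - p i))"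
      proof (cases "p i = 1")
        case True then show ?thesis by (simp add: eta_def)
      next
        case False
        then have p1: "p i < 1" using elim by simp
        have c'R: "cmod c' \<le> R" using cx R(2) by auto
        define B where "B = 2 * R + 4 * R\<^sup>2 * exp R"
        have B: "B \<ge> 0" using R by (simp add: B_def)
        have k1: "cmod (qbracket (p i) c' - c') \<le> B * (1 - p i)"
          unfolding B_def using elim c'R by (intro qbracket_minus_bound) auto
        also have "B * (1 - p i) \<le> B * 1" using B elim by (intro mult_left_mono) auto
        finally have k2: "cmod (qbracket (p i) c') \<le> R + B"
          using c'R norm_triangle_ineq2[of "qbracket (p i) c'" c'] by simp
        have pck: "pc i c' = 1 - of_real (1 - p i) * qbracket (p i) c'"
          using p1 by (simp add: pc_def qbracket_complex del: of_real_diff)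
        have "w' i z - w i x - c' = (qbracket (p i) c' - c') - of_real (1 - p i) * (qbracket (p i) c' * w i x)"
          by (simp add: w'_def cx pck algebra_simps)
        then have "cmod (w' i z - w i x - c') \<le> cmod (qbracket (p i) c' - c') + cmod (of_real (1 - p i) * (qbracket (p i) c' * w i x))"
          using norm_triangle_ineq4 by metis
        also have "cmod (of_real (1 - p i) * (qbracket (p i) c' * w i x)) = (1 - p i) * (cmod (qbracket (p i) c') * cmod (w i x))"
          using p1 by (simp only: norm_mult norm_of_real)
        also have "\<dots> \<le> (1 - p i) * ((R + B) * W)"
          using p1 k2 elim cx R B by (intro mult_left_mono mult_mono) auto
        finally have "cmod (w' i z - w i x - c') \<le> Ck * (1 - p i)"
          using k1 by (simp add: Ck_def B_def algebra_simps)
        then have "cmod (eta i z) \<le> Ck * (1 - p i) * \<bar>ln (1 - p i)\<bar>"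
          using False by (simp add: eta_def cx norm_mult mult_right_mono)
        also have "\<dots> \<le> Ck * (2 * sqrt (1 - p i))"
          unfolding mult.assoc using Ck p1 elim by (intro mult_left_mono one_minus_mult_ln_bound) auto
        finally show ?thesis .
      qed
    qed
  qed
  have "((\<lambda>i. Ck * (2 * sqrt (1 - p i))) \<longlongrightarrow> Ck * (2 * sqrt (1 - 1))) \<Phi>"
    by (intro tendsto_intros p)
  then have eta0: "((\<lambda>i. Ck * (2 * sqrt (1 - p i))) \<longlongrightarrow> 0) \<Phi>" by simp
  have etalim: "uniform_limit (cball c 1 \<times> K) eta (\<lambda>_. 0) \<Phi>"
  proof (rule uniform_limitI)
    fix e :: real assume "e > 0"
    then have "\<forall>\<^sub>F i in \<Phi>. Ck * (2 * sqrt (1 - p i)) < e" using eta0 by (intro order_tendstoD)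
    with eta_le show "\<forall>\<^sub>F i in \<Phi>. \<forall>z\<in>cball c 1 \<times> K. dist (eta i z) 0 < e"
      by eventually_elim (force simp: dist_norm)
  qed
  have faclim: "uniform_limit (cball c 1 \<times> K) (\<lambda>i z. exp (eta i z)) (\<lambda>_. 1) \<Phi>"
    using uniform_limit_exp[OF etalim, of 0] by simp
  have hlim: "uniform_limit (cball c 1 \<times> K) (\<lambda>i z. exp (fst z * of_real (ln (h i)))) (\<lambda>z. exp (fst z * of_real (ln h0))) \<Phi>"
  proof -
    have "uniform_limit (cball c 1) (\<lambda>i x. (\<lambda>(z :: real \<times> complex). exp (snd z * of_real (ln (fst z)))) (h i, x))
       (\<lambda>x. (\<lambda>(z :: real \<times> complex). exp (snd z * of_real (ln (fst z)))) (h0, x)) \<Phi>"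
      by (rule uniform_limit_joint_continuous[where S = "{0<..}"])
        (use h evh h0 in \<open>auto intro!: continuous_intros\<close>)
    then show ?thesis unfolding fst_conv snd_conv by (rule uniform_limit_compose') auto
  qed
  have bh: "bounded ((\<lambda>z. exp (fst z * complex_of_real (ln h0))) ` (cball c 1 \<times> K))"
    by (intro compact_imp_bounded compact_continuous_image continuous_intros compact_Times K) auto
  have Gw: "uniform_limit (cball c 1 \<times> K) (\<lambda>i z. rGamma_p (p i) (w i (snd z))) (\<lambda>z. rGamma (w0 (snd z))) \<Phi>"
    by (rule uniform_limit_compose_varying[OF rGamma_p_uniform_limit[OF p evp, of W] continuous_on_rGamma _ uniform_limit_compose'[OF wlim]])
      (use evw in \<open>auto elim!: eventually_mono\<close>)
  have Gw': "uniform_limit (cball c 1 \<times> K) (\<lambda>i z. rGamma_p (p i) (w' i z)) (\<lambda>z. rGamma (fst z + w0 (snd z))) \<Phi>"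
    by (rule uniform_limit_compose_varying[OF rGamma_p_uniform_limit[OF p evp, of "R + W"] continuous_on_rGamma _ w'lim])
      (use evw' in auto)
  have cw0': "continuous_on (cball c 1 \<times> K) (\<lambda>z. w0 (snd z))"
    by (rule continuous_on_compose2[OF cw0]) (auto intro!: continuous_intros)
  have bG: "bounded ((\<lambda>z. rGamma (w0 (snd z))) ` (cball c 1 \<times> K))"
    by (intro compact_imp_bounded compact_continuous_image compact_Times K
        continuous_on_compose2[OF continuous_on_rGamma cw0']) auto
  define N where "N i z = exp (fst z * of_real (ln (h i))) * exp (eta i z) * rGamma_p (p i) (w i (snd z))" for i z
  show ?thesis
  proof (rule e_fun_convergesI[OF K zero_less_one, where N = N and ?N0.0 = "\<lambda>z. exp (fst z * of_real (ln h0)) * 1 * rGamma (w0 (snd z))"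
        and D = "\<lambda>i z. rGamma_p (p i) (w' i z)" and ?D0.0 = "\<lambda>z. rGamma (fst z + w0 (snd z))"])
    have b1: "bounded ((\<lambda>z. exp (fst z * complex_of_real (ln h0)) * 1) ` (cball c 1 \<times> K))" using bh by simp
    show "uniform_limit (cball c 1 \<times> K) N (\<lambda>z. exp (fst z * of_real (ln h0)) * 1 * rGamma (w0 (snd z))) \<Phi>"
      unfolding N_def[abs_def] by (intro uniform_lim_mult hlim faclim Gw bh bG b1) (auto intro: bounded_subset[of "{1}"])
    show "continuous_on (cball c 1 \<times> K) (\<lambda>z. exp (fst z * of_real (ln h0)) * 1 * rGamma (w0 (snd z)))"
      by (intro continuous_intros continuous_on_compose2[OF continuous_on_rGamma cw0']) auto
    show "continuous_on (cball c 1 \<times> K) (\<lambda>z. rGamma (fst z + w0 (snd z)))"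
      by (intro continuous_on_compose2[OF continuous_on_rGamma] continuous_intros cw0') auto
    show "rGamma (fst (c, x) + w0 (snd (c, x))) \<noteq> 0" if "x \<in> K" for x
    proof
      assume "rGamma (fst (c, x) + w0 (snd (c, x))) = 0"
      then have "c + w0 x \<in> \<int>\<^sub>\<le>\<^sub>0" by (simp add: rGamma_eq_zero_iff)
      \<comment> \<open>The zeros of 1/Gamma at \<open>- k\<close>, \<open>k \<ge> 0\<close>,
        correspond to \<open>x = h0 (c + k + 1)\<close>; the shift by one comes from
        \<open>w0 x = 1 - x/h0\<close>.\<close>
      then obtain k where "c + w0 x = - of_nat k" by (elim nonpos_Ints_cases')
      then have "x = of_real h0 * (c + of_nat (Suc k))" using h0 by (simp add: w0_def field_simps)
      then have "x \<in> gamma_poles h0 c" unfolding gamma_poles_def by (intro image_eqI[of _ _ "Suc k"]) auto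
      then show False using out that by auto
    qed
    show "\<forall>\<^sub>F i in \<Phi>. \<forall>c'\<in>cball c 1. \<forall>x\<in>K. e_fun (q i) (h i) c' x = N i (c', x) / rGamma_p (p i) (w' i (c', x))"
      using ev evh
    proof eventually_elim
      case (elim i)
      show ?case
      proof (intro ballI)
        fix c' x
        show "e_fun (q i) (h i) c' x = N i (c', x) / rGamma_p (p i) (w' i (c', x))"
          unfolding e_fun_eq_rGamma_p[OF elim] by (simp add: N_def eta_def w'_def w_def pc_def p_def)
      qed
    qed
    show "e_fun 1 h0 c' x = exp (fst (c', x) * of_real (ln h0)) * 1 * rGamma (w0 (snd (c', x))) / rGamma (fst (c', x) + w0 (snd (c', x)))" for c' x
      using e_fun_eq_rGamma_p[of 1 h0 c' x] h0 by (simp add: qbracket_complex w0_def rGamma_p_1)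
    show "\<forall>\<^sub>F i in \<Phi>. \<forall>x\<in>K. (\<lambda>c'. N i (c', x)) holomorphic_on ball c 1 \<and> (\<lambda>c'. rGamma_p (p i) (w' i (c', x))) holomorphic_on ball c 1"
      using evp evh
    proof eventually_elim
      case (elim i)
      then have p0: "complex_of_real (p i) \<noteq> 0" by simp
      have hk: "qbracket (p i) holomorphic_on ball c 1"
        unfolding qbracket_complex using p0 by (cases "p i = 1") (auto intro!: holomorphic_intros)
      have hw: "(\<lambda>c'. w' i (c', x)) holomorphic_on ball c 1" for x
        unfolding w'_def fst_conv snd_conv pc_def using p0 by (intro holomorphic_intros hk)
      have "(\<lambda>c'. eta i (c', x)) holomorphic_on ball c 1" for x
        unfolding eta_def fst_conv snd_conv by (cases "p i = 1") (auto intro!: holomorphic_intros hw)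
      then have "(\<lambda>c'. N i (c', x)) holomorphic_on ball c 1" for x
        unfolding N_def fst_conv snd_conv by (intro holomorphic_intros)
      moreover have "(\<lambda>c'. rGamma_p (p i) (w' i (c', x))) holomorphic_on ball c 1" for x
        using elim by (intro holomorphic_on_compose_gen[OF hw holomorphic_rGamma_p[of _ UNIV], unfolded o_def]) auto
      ultimately show ?case by blast
    qed
    show "(\<lambda>c'. exp (fst (c', x) * of_real (ln h0)) * 1 * rGamma (w0 (snd (c', x)))) holomorphic_on ball c 1" for x
      unfolding fst_conv snd_conv by (intro holomorphic_intros)
    show "(\<lambda>c'. rGamma (fst (c', x) + w0 (snd (c', x)))) holomorphic_on ball c 1" for x
      unfolding fst_conv snd_conv by (intro holomorphic_intros holomorphic_rGamma')
  qed (rule Gw')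
qed


section \<open>Confluence to $h = 0$ and the triple product identity\<close>

definition pochp :: "real \<Rightarrow> nat \<Rightarrow> complex" where
  "pochp p n = (\<Prod>j<n. 1 - of_real p ^ j * of_real p)"

text \<open>With the convention $1/(p;p)_m = 0$ for $m < 0$ the recurrence holds for all integers.\<close>

definition pochp_inv :: "real \<Rightarrow> int \<Rightarrow> complex" where
  "pochp_inv p m = (if m < 0 then 0 else inverse (pochp p (nat m)))"

definition theta_term :: "real \<Rightarrow> complex \<Rightarrow> int \<Rightarrow> complex" where
  "theta_term p z k = (-1) powi k * of_real p powi (k * (k - 1) div 2) * z powi k"

text \<open>The Gaussian binomial coefficient of \<open>2n\<close> over \<open>n + k\<close> in base
  \<open>p\<close>, equal to 0 when \<open>k\<close> exceeds \<open>n\<close> in absolute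
  value.\<close>

definition theta_coeff :: "real \<Rightarrow> nat \<Rightarrow> int \<Rightarrow> complex" where
  "theta_coeff p n k = pochp p (2 * n) * pochp_inv p (int n + k) * pochp_inv p (int n - k)"

definition theta_prod :: "real \<Rightarrow> complex \<Rightarrow> complex" where
  "theta_prod p z = qpoch_inf p z * qpoch_inf p (of_real p / z)"

text \<open>Only the second product is truncated: this is what remains of the infinite product at
  \<open>z / p^n\<close> once a monomial is taken out of each of its first \<open>n\<close>
  factors.\<close>

definition theta_partial :: "real \<Rightarrow> nat \<Rightarrow> complex \<Rightarrow> complex" where
  "theta_partial p n z = qpoch_inf p z * (\<Prod>j<n. 1 - of_real p ^ j * (of_real p / z))"

lemma pochp_factor_nonzero: "0 < p \<Longrightarrow> p < 1 \<Longrightarrow> (1 - of_real p ^ j * of_real p :: complex) \<noteq> 0"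
proof
  assume p: "0 < p" "p < 1" "1 - of_real p ^ j * of_real p = (0::complex)"
  then have "complex_of_real (p ^ Suc j) = of_real 1" by (simp add: mult.commute)
  then have "p ^ Suc j = 1" unfolding of_real_eq_iff .
  then show False using p power_Suc_less_one[of p j] by simp
qed

text \<open>For \<open>m \<le> 0\<close> both sides are 0: at \<open>m = 0\<close> the last factor
  vanishes, which is what makes the convention consistent.\<close>

lemma pochp_inv_rec:
  assumes "0 < p" "p < 1"
  shows "pochp_inv p (m - 1) = pochp_inv p m * (1 - of_real p powi m)"
proof (cases "m \<le> 0")
  case False
  define k where "k = nat (m - 1)"
  have m: "m = int (Suc k)" using False by (simp add: k_def)
  have "pochp p (Suc k) = pochp p k * (1 - of_real p powi m)"
    unfolding m power_int_of_nat by (simp add: pochp_def mult.commute)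
  moreover have "1 - of_real p powi m \<noteq> (0::complex)"
    unfolding m power_int_of_nat using pochp_factor_nonzero[OF assms, of k] by (simp add: mult.commute)
  moreover have "nat m = Suc k" "nat (m - 1) = k" using m by auto
  ultimately show ?thesis using False by (simp add: pochp_inv_def)
next
  case True
  then show ?thesis by (cases "m = 0") (auto simp: pochp_inv_def)
qed

lemma theta_term_Suc:
  assumes "p \<noteq> 0" "z \<noteq> 0"
  shows "theta_term p z (k + 1) = - (of_real p powi k * z * theta_term p z k)"
proof -
  have "(k + 1) * (k + 1 - 1) = k * (k - 1) + k * 2" by (simp add: algebra_simps)
  then have "(k + 1) * (k + 1 - 1) div 2 = k * (k - 1) div 2 + k" by simp
  then show ?thesis using assms by (simp add: theta_term_def power_int_add)
qed

text \<open>The recurrence mirrors multiplication by \<open>(1 - p^n z)(1 - p^(n+1)/z)\<close>. With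
  \<open>X = p^(n+1+k)\<close>, \<open>Y = p^(n+1-k)\<close> and \<open>s = 1/p\<close>, all four
  coefficients are polynomials in \<open>X\<close>, \<open>Y\<close>, \<open>s\<close> times a
  common factor, and the claim is a polynomial identity.\<close>

lemma theta_coeff_Suc:
  assumes p: "0 < p" "p < 1"
  shows "theta_coeff p (Suc n) k = (1 + of_real p powi (2 * int n + 1)) * theta_coeff p n k
    + of_real p powi (int n + 1 - k) * theta_coeff p n (k - 1) + of_real p powi (int n + 1 + k) * theta_coeff p n (k + 1)"
proof -
  define P where "P = complex_of_real p"
  have P0: "P \<noteq> 0" using p by (simp add: P_def)
  define X where "X = P powi (int n + 1 + k)"
  define Y where "Y = P powi (int n + 1 - k)"
  define \<alpha> where "\<alpha> = pochp_inv p (int n + 1 + k)"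
  define \<beta> where "\<beta> = pochp_inv p (int n + 1 - k)"
  define s where "s = inverse P"
  have XY: "P powi (2 * int n + 1) = X * Y * s" "P powi (2 * int n + 2) = X * Y"
    "P powi (int n + k) = X * s" "P powi (int n - k) = Y * s"
    using P0 by (simp_all add: X_def Y_def s_def power_int_add power_int_diff power_int_mult field_simps power2_eq_square)
  have a1: "pochp_inv p (int n + k) = \<alpha> * (1 - X)"
    using pochp_inv_rec[OF p, of "int n + 1 + k"] by (simp add: \<alpha>_def X_def P_def algebra_simps)
  have a2: "pochp_inv p (int n + k - 1) = \<alpha> * (1 - X) * (1 - X * s)"
    unfolding a1[symmetric] XY(3)[symmetric] P_def by (rule pochp_inv_rec[OF p])
  have b1: "pochp_inv p (int n - k) = \<beta> * (1 - Y)"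
    using pochp_inv_rec[OF p, of "int n + 1 - k"] by (simp add: \<beta>_def Y_def P_def algebra_simps)
  have b2: "pochp_inv p (int n - k - 1) = \<beta> * (1 - Y) * (1 - Y * s)"
    unfolding b1[symmetric] XY(4)[symmetric] P_def by (rule pochp_inv_rec[OF p])
  have "pochp p (2 * Suc n) = pochp p (2 * n) * (1 - P ^ (2 * n + 1)) * (1 - P ^ (2 * n + 2))"
    by (simp add: pochp_def P_def mult_ac)
  moreover have "P ^ (2 * n + 1) = X * Y * s" "P ^ (2 * n + 2) = X * Y"
    using XY(1,2) unfolding power_int_of_nat[symmetric] by (simp_all add: ac_simps)
  ultimately have Pn: "pochp p (2 * Suc n) = pochp p (2 * n) * (1 - X * Y * s) * (1 - X * Y)" by simp
  have c0: "theta_coeff p (Suc n) k = pochp p (2 * n) * (1 - X * Y * s) * (1 - X * Y) * \<alpha> * \<beta>"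
    unfolding theta_coeff_def Pn by (simp add: \<alpha>_def \<beta>_def algebra_simps)
  have c1: "theta_coeff p n k = pochp p (2 * n) * (\<alpha> * (1 - X)) * (\<beta> * (1 - Y))"
    unfolding theta_coeff_def a1 b1 ..
  have i: "int n + (k - 1) = int n + k - 1" "int n - (k - 1) = int n + 1 - k"
    "int n + (k + 1) = int n + 1 + k" "int n - (k + 1) = int n - k - 1" by simp_all
  have c2: "theta_coeff p n (k - 1) = pochp p (2 * n) * (\<alpha> * (1 - X) * (1 - X * s)) * \<beta>"
    unfolding theta_coeff_def i a2 \<beta>_def ..
  have c3: "theta_coeff p n (k + 1) = pochp p (2 * n) * \<alpha> * (\<beta> * (1 - Y) * (1 - Y * s))"
    unfolding theta_coeff_def i b2 \<alpha>_def ..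
  show ?thesis
    unfolding P_def[symmetric] XY(1) X_def[symmetric] Y_def[symmetric] c0 c1 c2 c3 by algebra
qed

text \<open>The finite form of Jacobi's identity. Since the sum runs over all integers there are no
  boundary terms, and multiplication by \<open>z\<close> or \<open>1/z\<close> is a mere shift of
  the index.\<close>

lemma finite_triple_product:
  assumes p: "0 < p" "p < 1" and z: "z \<noteq> 0"
  shows "((\<lambda>k. theta_coeff p n k * theta_term p z k) has_sum
    (\<Prod>j<n. (1 - of_real p ^ j * z) * (1 - of_real p ^ j * (of_real p / z)))) UNIV"
proof (induction n)
  case 0
  have "theta_coeff p 0 k = 0" if "k \<noteq> 0" for k using that by (auto simp: theta_coeff_def pochp_inv_def)
  moreover have "theta_coeff p 0 0 * theta_term p z 0 = 1" by (simp add: theta_coeff_def pochp_inv_def pochp_def theta_term_def)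
  ultimately show ?case by (intro has_sum_finite_neutralI[of "{0}"]) auto
next
  case (Suc n)
  define P where "P = complex_of_real p"
  have P0: "P \<noteq> 0" "p \<noteq> 0" using p by (auto simp: P_def)
  define f where "f k = theta_coeff p n k * theta_term p z k" for k
  define S where "S = (\<Prod>j<n. (1 - of_real p ^ j * z) * (1 - of_real p ^ j * (of_real p / z)))"
  have f: "(f has_sum S) UNIV" using Suc by (simp add: f_def[abs_def] S_def)
  have fm: "((\<lambda>k. f (k - 1)) has_sum S) UNIV"
    using f by (rule has_sum_reindex_bij_witness[of UNIV "\<lambda>k. k + 1" "\<lambda>k. k - 1", THEN iffD2, rotated -1]) auto
  have fp: "((\<lambda>k. f (k + 1)) has_sum S) UNIV"
    using f by (rule has_sum_reindex_bij_witness[of UNIV "\<lambda>k. k - 1" "\<lambda>k. k + 1", THEN iffD2, rotated -1]) auto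
  have sum: "((\<lambda>k. (1 + P ^ (2 * n + 1)) * f k + (- (P ^ n * z)) * f (k - 1) + (- (P ^ n * (P / z))) * f (k + 1)) has_sum
      ((1 + P ^ (2 * n + 1)) * S + (- (P ^ n * z)) * S + (- (P ^ n * (P / z))) * S)) UNIV"
    by (intro has_sum_add has_sum_cmult_right f fm fp)
  have "(1 + P ^ (2 * n + 1)) * S + (- (P ^ n * z)) * S + (- (P ^ n * (P / z))) * S = S * ((1 - P ^ n * z) * (1 - P ^ n * (P / z)))"
  proof -
    have e: "P ^ (2 * n + 1) = P ^ n * P ^ n * P" by (simp add: mult_2 power_add)
    show ?thesis unfolding e using z by (simp add: field_simps)
  qed
  also have "\<dots> = (\<Prod>j<Suc n. (1 - of_real p ^ j * z) * (1 - of_real p ^ j * (of_real p / z)))"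
    by (simp add: S_def P_def)
  finally have S: "(1 + P ^ (2 * n + 1)) * S + (- (P ^ n * z)) * S + (- (P ^ n * (P / z))) * S = \<dots>" .
  have "(1 + P ^ (2 * n + 1)) * f k + (- (P ^ n * z)) * f (k - 1) + (- (P ^ n * (P / z))) * f (k + 1)
      = theta_coeff p (Suc n) k * theta_term p z k" for k
  proof -
    have "theta_term p z k = - (P powi (k - 1) * z * theta_term p z (k - 1))"
      using theta_term_Suc[OF P0(2) z, of "k - 1"] by (simp add: P_def)
    then have "P powi (int n + 1 - k) * theta_term p z k = - (P powi (int n + 1 - k) * P powi (k - 1) * z * theta_term p z (k - 1))"
      by simp
    also have "P powi (int n + 1 - k) * P powi (k - 1) = P ^ n"
      using P0 by (simp add: power_int_add[symmetric])
    finally have t1: "- (P ^ n * z) * theta_term p z (k - 1) = P powi (int n + 1 - k) * theta_term p z k" by simp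
    have "P ^ n * (P / z) * theta_term p z (k + 1) = - (P powi (int n + 1) * P powi k * theta_term p z k)"
      using theta_term_Suc[OF P0(2) z, of k] z P0 by (simp add: P_def[symmetric] power_int_add)
    also have "P powi (int n + 1) * P powi k = P powi (int n + 1 + k)" using P0 by (simp add: power_int_add)
    finally have t2: "- (P ^ n * (P / z)) * theta_term p z (k + 1) = P powi (int n + 1 + k) * theta_term p z k" by simp
    have e: "P ^ (2 * n + 1) = P powi (2 * int n + 1)"
      unfolding power_int_of_nat[symmetric] by (simp add: ac_simps)
    have "(- (P ^ n * z)) * f (k - 1) = theta_coeff p n (k - 1) * (P powi (int n + 1 - k) * theta_term p z k)"
      unfolding t1[symmetric] f_def by (simp add: mult_ac)
    moreover have "(- (P ^ n * (P / z))) * f (k + 1) = theta_coeff p n (k + 1) * (P powi (int n + 1 + k) * theta_term p z k)"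
      unfolding t2[symmetric] f_def by (simp add: mult_ac)
    ultimately show ?thesis
      unfolding theta_coeff_Suc[OF p] e f_def P_def[symmetric] by (simp add: algebra_simps)
  qed
  with sum show ?case unfolding S by simp
qed

lemma summable_gauss_power:
  assumes p: "0 < p" "p < (1::real)" and r: "r \<ge> 0"
  shows "summable (\<lambda>n::nat. p powi (int n * (int n - 1) div 2) * r ^ n)"
proof -
  have "(\<lambda>n. p ^ n * r) \<longlonglongrightarrow> 0 * r" using p by (intro tendsto_intros LIMSEQ_realpow_zero) auto
  then have "\<forall>\<^sub>F n in sequentially. p ^ n * r < 1 / 2" by (intro order_tendstoD) auto
  then obtain N where N: "\<And>n. n \<ge> N \<Longrightarrow> p ^ n * r < 1 / 2" by (auto simp: eventually_sequentially)
  show ?thesis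
  proof (rule summable_ratio_test[of "1/2" N])
    define a where "a n = p powi (int n * (int n - 1) div 2) * r ^ n" for n
    have a0: "a n \<ge> 0" for n using p r by (simp add: a_def zero_le_power_int)
    fix n assume n: "n \<ge> N"
    have "int (Suc n) * (int (Suc n) - 1) = int n * (int n - 1) + int n * 2" by (simp add: algebra_simps)
    then have e: "int (Suc n) * (int (Suc n) - 1) div 2 = int n * (int n - 1) div 2 + int n" by simp
    have "a (Suc n) = (p ^ n * r) * a n"
      unfolding a_def e using p by (simp add: power_int_add)
    moreover have "(p ^ n * r) * a n \<le> 1 / 2 * a n"
      using N[OF n] a0 by (intro mult_right_mono) auto
    ultimately have "norm (a (Suc n)) \<le> 1 / 2 * norm (a n)" using a0[of n] a0[of "Suc n"] by simp
    then show "norm (p powi (int (Suc n) * (int (Suc n) - 1) div 2) * r ^ Suc n) \<le> 1 / 2 * norm (p powi (int n * (int n - 1) div 2) * r ^ n)"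
      unfolding a_def .
  qed auto
qed

text \<open>The reflection of \<open>k\<close> to \<open>1 - k\<close> preserves
  \<open>k (k - 1)\<close>, so the negative indices reduce to non-negative ones with
  \<open>1/z\<close> in place of \<open>z\<close>.\<close>

lemma summable_on_theta_term:
  assumes p: "0 < p" "p < 1" and z: "z \<noteq> 0"
  shows "(\<lambda>k. cmod (theta_term p z k)) summable_on UNIV"
proof -
  have nt: "cmod (theta_term p z k) = p powi (k * (k - 1) div 2) * cmod z powi k" for k
    using p by (simp add: theta_term_def norm_mult norm_power_int)
  have "(\<lambda>n::nat. p powi (int n * (int n - 1) div 2) * cmod z ^ n) summable_on UNIV"
    by (subst summable_on_UNIV_nonneg_real_iff) (use p summable_gauss_power[OF p] in \<open>auto simp: zero_le_power_int\<close>)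
  then have "((\<lambda>k. cmod (theta_term p z k)) \<circ> int) summable_on UNIV" by (simp add: nt o_def)
  then have A: "(\<lambda>k. cmod (theta_term p z k)) summable_on range int"
    by (subst summable_on_reindex) auto
  have "(\<lambda>n::nat. p powi (int n * (int n - 1) div 2) * (1 / cmod z) ^ n) summable_on UNIV"
    by (subst summable_on_UNIV_nonneg_real_iff) (use p summable_gauss_power[OF p, of "1 / cmod z"] in \<open>auto simp: zero_le_power_int\<close>)
  then have "(\<lambda>n::nat. cmod z * (p powi (int n * (int n - 1) div 2) * (1 / cmod z) ^ n)) summable_on UNIV"
    by (rule summable_on_cmult_right)
  moreover have "cmod z * (p powi (int n * (int n - 1) div 2) * (1 / cmod z) ^ n) = cmod (theta_term p z (1 - int n))" for n
  proof -
    have "(1 - int n) * (1 - int n - 1) = int n * (int n - 1)" by (simp add: algebra_simps)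
    moreover have "cmod z powi (1 - int n) = cmod z * (1 / cmod z) ^ n"
      using z by (simp add: power_int_diff power_one_over divide_inverse power_inverse)
    ultimately show ?thesis unfolding nt by simp
  qed
  ultimately have "((\<lambda>k. cmod (theta_term p z k)) \<circ> (\<lambda>n. 1 - int n)) summable_on UNIV" by (simp add: o_def)
  then have B: "(\<lambda>k. cmod (theta_term p z k)) summable_on range (\<lambda>n. 1 - int n)"
    by (subst summable_on_reindex) (auto simp: inj_on_def)
  have "UNIV = range int \<union> range (\<lambda>n. 1 - int n)"
  proof (intro equalityI subsetI)
    fix k :: int
    show "k \<in> range int \<union> range (\<lambda>n. 1 - int n)"
      by (cases "k \<ge> 0") (auto simp: image_iff intro: exI[of _ "nat k"] exI[of _ "nat (1 - k)"])
  qed auto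
  then show ?thesis using summable_on_union[OF A B] by simp
qed

text \<open>Jacobi's triple product identity as the limit of its finite form. The coefficients tend
  to the inverse of \<open>(p;p)\<close> and are bounded by \<open>B1 * B2 * B2\<close> for all
  \<open>n\<close> and \<open>k\<close>, so the series converge uniformly in \<open>n\<close>, and
  limit and sum may be exchanged.\<close>

lemma theta_prod_has_sum:
  assumes p: "0 < p" "p < 1" and z: "z \<noteq> 0"
  shows "((\<lambda>k. theta_term p z k) has_sum (qpoch_inf p (of_real p) * theta_prod p z)) UNIV"
proof -
  define L where "L = qpoch_inf p (of_real p)"
  have L0: "L \<noteq> 0" unfolding L_def by (rule qpoch_inf_self_nonzero[OF p])
  have plim: "pochp p \<longlonglongrightarrow> L"
    unfolding pochp_def[abs_def] L_def by (rule qpoch_inf_tendsto[OF p])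
  have "Bseq (pochp p)" by (rule convergent_imp_Bseq[OF convergentI[OF plim]])
  then obtain B1 where B1: "\<And>n. cmod (pochp p n) \<le> B1" unfolding Bseq_def by auto
  have ilim: "(\<lambda>n. inverse (pochp p n)) \<longlonglongrightarrow> inverse L" by (rule tendsto_inverse[OF plim L0])
  have "Bseq (\<lambda>n. inverse (pochp p n))" by (rule convergent_imp_Bseq[OF convergentI[OF ilim]])
  then obtain B2 where B2: "B2 > 0" "\<And>n. cmod (inverse (pochp p n)) \<le> B2" unfolding Bseq_def by auto
  have B2': "cmod (pochp_inv p m) \<le> B2" for m
    using B2 by (auto simp: pochp_inv_def)
  have B1p: "B1 \<ge> 0" using B1[of 0] norm_ge_zero order_trans by blast
  have tsum: "(\<lambda>k. theta_term p z k) summable_on UNIV"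
    using summable_on_theta_term[OF p z] by (rule abs_summable_summable)
  then have tl: "((\<lambda>k. theta_term p z k) has_sum (\<Sum>\<^sub>\<infinity>k. theta_term p z k)) UNIV" by (rule has_sum_infsum)
  define T where "T = (\<Sum>\<^sub>\<infinity>k. theta_term p z k)"
  have "((\<lambda>k. inverse L * theta_term p z k) has_sum inverse L * T) UNIV"
    unfolding T_def by (rule has_sum_cmult_right[OF tl])
  then have g: "((\<lambda>X. \<Sum>k\<in>X. inverse L * theta_term p z k) \<longlongrightarrow> inverse L * T) (finite_subsets_at_top UNIV)"
    unfolding has_sum_def .
  define h where "h n = (\<Prod>j<n. (1 - of_real p ^ j * z) * (1 - of_real p ^ j * (of_real p / z)))" for n
  have uc: "uniform_limit UNIV (\<lambda>X n. \<Sum>k\<in>X. theta_coeff p n k * theta_term p z k) h (finite_subsets_at_top UNIV)"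
  proof (rule Weierstrass_m_test_general')
    show "((\<lambda>k. theta_coeff p n k * theta_term p z k) has_sum h n) UNIV" for n
      unfolding h_def by (rule finite_triple_product[OF p z])
    show "(\<lambda>k. B1 * B2 * B2 * cmod (theta_term p z k)) summable_on UNIV"
      by (intro summable_on_cmult_right summable_on_theta_term[OF p z])
    show "cmod (theta_coeff p n k * theta_term p z k) \<le> B1 * B2 * B2 * cmod (theta_term p z k)" for n k
      unfolding theta_coeff_def norm_mult using B1 B2' B1p B2(1)
      by (intro mult_mono mult_right_mono mult_nonneg_nonneg norm_ge_zero) auto
  qed
  have clim: "(\<lambda>n. theta_coeff p n k) \<longlonglongrightarrow> inverse L" for k
  proof -
    have sh: "(\<lambda>n. pochp_inv p (int n + j)) \<longlonglongrightarrow> inverse L" for j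
    proof -
      have "filterlim (\<lambda>n. nat (int n + j)) at_top sequentially"
        unfolding filterlim_at_top
      proof
        fix Z :: nat
        show "\<forall>\<^sub>F n in sequentially. Z \<le> nat (int n + j)"
          unfolding eventually_sequentially by (rule exI[of _ "Z + nat \<bar>j\<bar>"]) linarith
      qed
      then have "(\<lambda>n. inverse (pochp p (nat (int n + j)))) \<longlonglongrightarrow> inverse L"
        using filterlim_compose[OF ilim] by blast
      moreover have "\<forall>\<^sub>F n in sequentially. inverse (pochp p (nat (int n + j))) = pochp_inv p (int n + j)"
        unfolding eventually_sequentially by (rule exI[of _ "nat \<bar>j\<bar>"]) (auto simp: pochp_inv_def)
      ultimately show ?thesis by (rule Lim_transform_eventually)
    qed
    have "(\<lambda>n. pochp p (2 * n)) \<longlonglongrightarrow> L"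
      using LIMSEQ_subseq_LIMSEQ[OF plim, of "\<lambda>n. 2 * n"] by (simp add: strict_mono_def o_def)
    then have "(\<lambda>n. pochp p (2 * n) * pochp_inv p (int n + k) * pochp_inv p (int n + (- k))) \<longlonglongrightarrow> L * inverse L * inverse L"
      by (intro tendsto_mult sh)
    then show ?thesis using L0 by (simp add: theta_coeff_def)
  qed
  have "h \<longlonglongrightarrow> inverse L * T"
  proof (rule swap_uniform_limit'[OF _ g uc])
    show "\<forall>\<^sub>F X in finite_subsets_at_top UNIV. (\<lambda>n. \<Sum>k\<in>X. theta_coeff p n k * theta_term p z k) \<longlonglongrightarrow> (\<Sum>k\<in>X. inverse L * theta_term p z k)"
      by (intro always_eventually allI tendsto_sum tendsto_mult clim tendsto_const)
  qed auto
  moreover have "h \<longlonglongrightarrow> theta_prod p z"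
    unfolding h_def theta_prod_def prod.distrib by (intro tendsto_mult qpoch_inf_tendsto[OF p])
  ultimately have "inverse L * T = theta_prod p z" by (rule LIMSEQ_unique)
  then have "T = L * theta_prod p z" using L0 by (simp add: field_simps)
  then show ?thesis using tl by (simp add: T_def L_def)
qed

section \<open>From the theta series to truncated products along the sequence h_n\<close>

lemma Theta_eq_theta_prod:
  assumes q: "q > 1" and z: "z \<noteq> 0"
  shows "Theta q z = qpoch_inf (1 / q) (of_real (1 / q)) * theta_prod (1 / q) z"
proof -
  have "(-1) powi n * of_real q powi (- (n * (n - 1) div 2)) * z powi n = theta_term (1 / q) z n" for n
    by (simp add: theta_term_def power_int_minus power_int_inverse divide_inverse)
  then show ?thesis
    unfolding Theta_def using infsumI[OF theta_prod_has_sum[of "1 / q" z]] q z by simp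
qed

text \<open>Each of the first \<open>n\<close> factors is turned over:
  \<open>1 - y/p^(j+1) = - (y/p^(j+1)) (1 - p^j (p/y))\<close>. In a quotient of two such products
  the monomials cancel up to a power of the ratio of the arguments.\<close>

lemma qpoch_inf_shift:
  assumes p: "0 < p" "p < 1" and y: "y \<noteq> 0"
  shows "qpoch_inf p (y / of_real p ^ n) = (\<Prod>j<n. - (y / of_real p ^ Suc j)) * theta_partial p n y"
proof (induction n)
  case 0 then show ?case by (simp add: theta_partial_def)
next
  case (Suc n)
  have p0: "complex_of_real p \<noteq> 0" using p by simp
  have "qpoch_inf p (y / of_real p ^ Suc n) = (1 - y / of_real p ^ Suc n) * qpoch_inf p (y / of_real p ^ n)"
    using qpoch_inf_split[OF p, of "y / of_real p ^ Suc n" 1] p0 by simp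
  also have "1 - y / of_real p ^ Suc n = - (y / of_real p ^ Suc n) * (1 - of_real p ^ n * (of_real p / y))"
    using p0 y by (simp add: field_simps)
  finally show ?case unfolding Suc by (simp add: theta_partial_def mult_ac)
qed

text \<open>The choice of \<open>h_n\<close> enters here: \<open>h/(1 - p) = p^n\<close>, so the
  argument of the products is \<open>y/p^n\<close> with an integral shift, and the prefactor
  \<open>(p^n)^c = w^n\<close> cancels the \<open>w^n\<close> that the shift produces in the
  denominator.\<close>

lemma e_fun_eq_theta_partial:
  fixes q :: real and n :: nat and c x :: complex
  assumes q: "q > 1"
  defines "p \<equiv> 1 / q"
  defines "y \<equiv> x + of_real (p ^ Suc n)"
  assumes y: "y \<noteq> 0"
  shows "e_fun q ((1 - 1 / q) * (1 / q) ^ n) c x = theta_partial p n y / theta_partial p n (of_real p powr c * y)"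
proof -
  have p: "0 < p" "p < 1" using q by (auto simp: p_def)
  define h where "h = (1 - p) * p ^ n"
  have h: "h > 0" using p by (simp add: h_def)
  have P0: "complex_of_real p \<noteq> 0" using p by simp
  define w where "w = complex_of_real p powr c"
  have w0: "w \<noteq> 0" using P0 by (simp add: w_def)
  have a: "of_real (1 - p) * x / of_real h + of_real p = y / of_real p ^ n"
  proof -
    have "of_real (1 - p) * x / of_real h = x / of_real p ^ n"
      using p by (simp add: h_def del: of_real_diff)
    then show ?thesis using P0 by (simp add: y_def add_divide_distrib)
  qed
  have hp: "h / (1 - p) = p ^ n" using p by (simp add: h_def)
  have wn: "complex_of_real (p ^ n) powr c = w ^ n"
  proof -
    have "complex_of_real (p ^ n) powr c = exp (c * of_real (ln (p ^ n)))"
      using p by (simp add: powr_def Ln_of_real del: of_real_power)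
    also have "\<dots> = exp (of_nat n * (c * of_real (ln p)))" using p by (simp add: ln_realpow mult_ac)
    also have "\<dots> = w ^ n" using p by (simp add: exp_of_nat_mult w_def powr_def Ln_of_real)
    finally show ?thesis .
  qed
  have "e_fun q h c x = of_real (h / (1 - p)) powr c * qpoch_inf p (of_real (1 - p) * x / of_real h + of_real p)
      / qpoch_inf p (of_real p powr c * (of_real (1 - p) * x / of_real h + of_real p))"
    using q h by (simp add: e_fun_def Let_def p_def)
  then have "e_fun q h c x = w ^ n * qpoch_inf p (y / of_real p ^ n) / qpoch_inf p (w * (y / of_real p ^ n))"
    unfolding hp a wn w_def .
  also have "w * (y / of_real p ^ n) = (w * y) / of_real p ^ n" by simp
  also have "qpoch_inf p ((w * y) / of_real p ^ n) = w ^ n * (\<Prod>j<n. - (y / of_real p ^ Suc j)) * theta_partial p n (w * y)"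
  proof -
    have "(\<Prod>j<n. - (w * y / of_real p ^ Suc j)) = (\<Prod>j<n. w * - (y / of_real p ^ Suc j))" by simp
    then show ?thesis using w0 y by (subst qpoch_inf_shift[OF p]) (simp_all only: prod.distrib prod_constant card_lessThan mult_eq_0_iff not_False_eq_True simp_thms)
  qed
  finally have "e_fun q h c x = theta_partial p n y / theta_partial p n (w * y)"
    unfolding qpoch_inf_shift[OF p y] using w0 y P0 by simp
  then show ?thesis by (simp add: h_def p_def w_def)
qed

lemma theta_partial_uniform_limit:
  fixes z :: "nat \<Rightarrow> 'x::metric_space \<Rightarrow> complex"
  assumes p: "0 < p" "p < 1" and X: "compact X" and cont: "continuous_on X z0"
    and nz: "\<forall>x\<in>X. z0 x \<noteq> 0" and lim: "uniform_limit X z z0 sequentially"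
  shows "uniform_limit X (\<lambda>n x. theta_partial p n (z n x)) (\<lambda>x. theta_prod p (z0 x)) sequentially"
    and "\<forall>\<^sub>F n in sequentially. \<forall>x\<in>X. z n x \<noteq> 0"
    and "continuous_on X (\<lambda>x. theta_prod p (z0 x))"
proof -
  have cq: "continuous_on S (qpoch_inf p)" for S
    by (rule holomorphic_on_imp_continuous_on[OF holomorphic_qpoch_inf[OF p]])
  have ct: "continuous_on S (theta_prod p)" if "0 \<notin> S" for S
    unfolding theta_prod_def[abs_def] using that
    by (intro continuous_intros cq continuous_on_compose2[OF cq[of UNIV]]) auto
  show "continuous_on X (\<lambda>x. theta_prod p (z0 x))"
    using nz by (intro continuous_on_compose2[OF ct[of "- {0}"] cont]) auto
  have "uniform_limit X (\<lambda>n x. theta_partial p n (z n x)) (\<lambda>x. theta_prod p (z0 x)) sequentially \<and>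
    (\<forall>\<^sub>F n in sequentially. \<forall>x\<in>X. z n x \<noteq> 0)"
  proof (cases "X = {}")
    case False
    have "continuous_on X (\<lambda>x. cmod (z0 x))" by (intro continuous_intros cont)
    then obtain x0 where x0: "x0 \<in> X" "\<And>x. x \<in> X \<Longrightarrow> cmod (z0 x0) \<le> cmod (z0 x)"
      using continuous_attains_inf[OF X False] by blast
    define m where "m = cmod (z0 x0) / 2"
    have m: "m > 0" using nz x0(1) by (simp add: m_def)
    have "bounded (z0 ` X)" by (intro compact_imp_bounded compact_continuous_image cont X)
    then obtain M where M: "\<And>x. x \<in> X \<Longrightarrow> cmod (z0 x) \<le> M" unfolding bounded_iff by auto
    \<comment> \<open>A closed annulus containing the values of \<open>z0\<close> with margin
      \<open>m\<close>. It stays away from 0 because of the argument \<open>p/a\<close> of the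
      second product.\<close>
    define A where "A = cball 0 (M + m) - ball (0::complex) m"
    have A: "compact A" unfolding A_def by (intro compact_diff) auto
    have A0: "cmod a \<ge> m" "a \<noteq> 0" if "a \<in> A" for a using that m by (auto simp: A_def)
    have evA: "\<forall>\<^sub>F n in sequentially. \<forall>x\<in>X. z n x \<in> A"
      using uniform_limitD[OF lim m]
    proof eventually_elim
      case (elim n)
      show ?case
      proof
        fix x assume x: "x \<in> X"
        have "cmod (z n x - z0 x) < m" using elim x by (simp add: dist_norm)
        then show "z n x \<in> A"
          using x0(2)[OF x] M[OF x] norm_triangle_ineq2[of "z n x" "z0 x"] norm_triangle_ineq3[of "z n x" "z0 x"]
          by (auto simp: A_def m_def)
      qed
    qed
    have "uniform_limit A (\<lambda>n a. \<Prod>j<n. 1 - of_real p ^ j * (of_real p / a)) (\<lambda>a. qpoch_inf p (of_real p / a)) sequentially"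
    proof (rule uniform_limit_compose'[OF qpoch_partial_uniform_limit[OF p, of "p / m"]])
      show "(\<lambda>a. of_real p / a) \<in> A \<rightarrow> cball 0 (p / m)"
      proof
        fix a assume "a \<in> A"
        then show "of_real p / a \<in> cball 0 (p / m)"
          using A0[of a] m p by (auto simp: norm_divide intro!: divide_left_mono)
      qed
    qed
    then have "uniform_limit A (\<lambda>n a. qpoch_inf p a * (\<Prod>j<n. 1 - of_real p ^ j * (of_real p / a))) (\<lambda>a. qpoch_inf p a * qpoch_inf p (of_real p / a)) sequentially"
      by (intro uniform_lim_mult uniform_limit_const compact_imp_bounded compact_continuous_image A cq
          continuous_on_compose2[OF cq[of UNIV]] continuous_intros) (use A0 in auto)
    then have "uniform_limit A (theta_partial p) (theta_prod p) sequentially"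
      by (simp add: theta_partial_def[abs_def] theta_prod_def[abs_def])
    moreover have "continuous_on A (theta_prod p)" using A0 by (intro ct) auto
    ultimately have "uniform_limit X (\<lambda>n x. theta_partial p n (z n x)) (\<lambda>x. theta_prod p (z0 x)) sequentially"
      using uniform_limit_compose_varying[OF _ _ A lim evA] by blast
    moreover have "\<forall>\<^sub>F n in sequentially. \<forall>x\<in>X. z n x \<noteq> 0"
      using evA by eventually_elim (use A0 in blast)
    ultimately show ?thesis by blast
  qed simp
  then show "uniform_limit X (\<lambda>n x. theta_partial p n (z n x)) (\<lambda>x. theta_prod p (z0 x)) sequentially"
    "\<forall>\<^sub>F n in sequentially. \<forall>x\<in>X. z n x \<noteq> 0" by auto
qed

lemma holomorphic_theta_partial:
  assumes p: "0 < p" "p < 1" and f: "f holomorphic_on S" and nz: "\<And>x. x \<in> S \<Longrightarrow> f x \<noteq> 0"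
  shows "(\<lambda>x. theta_partial p n (f x)) holomorphic_on S" "(\<lambda>x. theta_prod p (f x)) holomorphic_on S"
proof -
  have q: "(\<lambda>x. qpoch_inf p (g x)) holomorphic_on S" if "g holomorphic_on S" for g
    using holomorphic_on_compose_gen[OF that holomorphic_qpoch_inf[OF p, of UNIV]] by (simp add: o_def)
  show "(\<lambda>x. theta_partial p n (f x)) holomorphic_on S" "(\<lambda>x. theta_prod p (f x)) holomorphic_on S"
    unfolding theta_partial_def theta_prod_def using nz by (intro holomorphic_intros q f; simp)+
qed

text \<open>Zeros of the first product give \<open>q^(c+k)\<close> with \<open>k \<ge> 0\<close>,
  zeros of the second those with \<open>k < 0\<close>.\<close>

lemma theta_prod_eq_0_imp:
  assumes q: "q > 1" and x: "x \<noteq> 0" and eq: "theta_prod (1 / q) (of_real (1 / q) powr c * x) = 0"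
  shows "x \<in> spiral_poles q c"
proof -
  define p where "p = 1 / q"
  have p: "0 < p" "p < 1" using q by (auto simp: p_def)
  define w where "w = complex_of_real q powr c"
  have w: "of_real (1 / q) powr c = inverse w"
    using q unfolding w_def by (subst powr_of_real_inverse) (auto simp: powr_minus)
  have w0: "w \<noteq> 0" using q by (simp add: w_def)
  have pole: "w * of_real q powi k \<in> spiral_poles q c" for k
  proof -
    have "w * of_real q powi k = of_real q powr (c + of_int k)"
      using q by (simp add: w_def powr_add powr_of_int power_int_def power_inverse)
    then show ?thesis unfolding spiral_poles_def by blast
  qed
  from eq[unfolded w] have "qpoch_inf p (inverse w * x) = 0 \<or> qpoch_inf p (of_real p / (inverse w * x)) = 0"
    by (auto simp: theta_prod_def p_def)
  then show ?thesis
  proof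
    assume "qpoch_inf p (inverse w * x) = 0"
    then obtain k where "of_real p ^ k * (inverse w * x) = 1" using qpoch_inf_eq_0D[OF p] by blast
    then have "x = w * of_real q powi int k" using w0 q by (simp add: p_def field_simps)
    then show ?thesis using pole[of "int k"] by simp
  next
    assume "qpoch_inf p (of_real p / (inverse w * x)) = 0"
    then obtain k where "of_real p ^ k * (of_real p / (inverse w * x)) = 1" using qpoch_inf_eq_0D[OF p] by blast
    then have "x = w * of_real p ^ Suc k" using w0 x by (simp add: field_simps)
    also have "complex_of_real p ^ Suc k = of_real q powi (- int (Suc k))"
      unfolding power_int_minus power_int_of_nat by (simp add: p_def power_one_over divide_inverse power_inverse)
    finally show ?thesis using pole by simp
  qed
qed

lemma e_fun_converges_to_h_0:
  assumes K: "compact K" and out: "K \<inter> spiral_poles q c = {}" and K0: "0 \<notin> K" and q: "q > 1"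
  shows "e_fun_converges (\<lambda>_. q) (\<lambda>n. (1 - 1 / q) * (1 / q) ^ n) q 0 c K sequentially"
proof -
  define p where "p = 1 / q"
  have p: "0 < p" "p < 1" using q by (auto simp: p_def)
  have P0: "complex_of_real p \<noteq> 0" using p by simp
  define y where "y n x = x + complex_of_real (p ^ Suc n)" for n x
  have pn: "(\<lambda>n. p ^ Suc n) \<longlonglongrightarrow> 0" using p by (intro LIMSEQ_Suc[OF LIMSEQ_realpow_zero]) auto
  have ylim: "uniform_limit (cball c 1 \<times> K) (\<lambda>n z. y n (snd z)) (\<lambda>z. snd z) sequentially"
  proof -
    have "uniform_limit (cball c 1 \<times> K) (\<lambda>n z. snd z + complex_of_real (p ^ Suc n)) (\<lambda>z. snd z + of_real 0) sequentially"
      by (intro uniform_limit_add uniform_limit_const uniform_limit_of_tendsto tendsto_of_real pn)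
    then show ?thesis by (simp add: y_def)
  qed
  have X: "compact (cball c 1 \<times> K)" by (intro compact_Times K) auto
  have cw: "continuous_on (cball c 1 \<times> K) (\<lambda>z. of_real p powr fst z)"
    using P0 unfolding powr_def by (auto intro!: continuous_intros)
  have bw: "bounded ((\<lambda>z. of_real p powr fst z) ` (cball c 1 \<times> K))"
    by (rule compact_imp_bounded[OF compact_continuous_image[OF cw X]])
  have wlim: "uniform_limit (cball c 1 \<times> K) (\<lambda>n z. of_real p powr fst z * y n (snd z)) (\<lambda>z. of_real p powr fst z * snd z) sequentially"
    by (intro uniform_lim_mult uniform_limit_const ylim bw) (rule bounded_subset[OF compact_imp_bounded[OF K]], auto)
  have nzy: "\<forall>z\<in>cball c 1 \<times> K. snd z \<noteq> 0" using K0 by auto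
  have nzw: "\<forall>z\<in>cball c 1 \<times> K. of_real p powr fst z * snd z \<noteq> 0" using nzy P0 by simp
  note N = theta_partial_uniform_limit[OF p X continuous_on_snd[OF continuous_on_id] nzy ylim]
  note D = theta_partial_uniform_limit[OF p X continuous_on_mult[OF cw continuous_on_snd[OF continuous_on_id]] nzw wlim]
  have hol: "(\<lambda>c'. of_real p powr c' * u) holomorphic_on ball c 1" for u
    using P0 by (intro holomorphic_intros)
  show ?thesis
  proof (rule e_fun_convergesI[OF K zero_less_one N(1) D(1) N(3) D(3)])
    fix x assume x: "x \<in> K"
    then have x0: "x \<noteq> 0" using K0 by auto
    show "theta_prod p (of_real p powr fst (c, x) * snd (c, x)) \<noteq> 0"
      using theta_prod_eq_0_imp[OF q x0, of c] out x unfolding p_def by auto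
    show "(\<lambda>c'. theta_prod p (snd (c', x))) holomorphic_on ball c 1" by simp
    show "(\<lambda>c'. theta_prod p (of_real p powr fst (c', x) * snd (c', x))) holomorphic_on ball c 1"
      unfolding fst_conv snd_conv by (rule holomorphic_theta_partial(2)[OF p hol]) (use P0 x0 in auto)
    fix c'
    have w: "complex_of_real q powr (- c') = of_real p powr c'"
      using powr_of_real_inverse[of q c'] q by (simp add: p_def)
    \<comment> \<open>The constant \<open>(p;p)\<close> of the triple product identity cancels in
      the quotient.\<close>
    have "Theta q x / Theta q (of_real p powr c' * x) = theta_prod p x / theta_prod p (of_real p powr c' * x)"
      using Theta_eq_theta_prod[OF q, folded p_def] qpoch_inf_self_nonzero[OF p] x0 P0 by simp
    then show "e_fun q 0 c' x = theta_prod p (snd (c', x)) / theta_prod p (of_real p powr fst (c', x) * snd (c', x))"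
      using q by (simp add: e_fun_def w)
  next
    show "\<forall>\<^sub>F n in sequentially. \<forall>c'\<in>cball c 1. \<forall>x\<in>K. e_fun q ((1 - 1 / q) * (1 / q) ^ n) c' x =
      theta_partial p n (y n (snd (c', x))) / theta_partial p n (of_real p powr fst (c', x) * y n (snd (c', x)))"
      using N(2)
    proof eventually_elim
      case (elim n)
      show ?case
      proof (intro ballI)
        fix c' x assume "c' \<in> cball c 1" "x \<in> K"
        then have "y n x \<noteq> 0" using elim by auto
        then show "e_fun q ((1 - 1 / q) * (1 / q) ^ n) c' x =
            theta_partial p n (y n (snd (c', x))) / theta_partial p n (of_real p powr fst (c', x) * y n (snd (c', x)))"
          unfolding fst_conv snd_conv y_def p_def by (rule e_fun_eq_theta_partial[OF q])
      qed
    qed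
    show "\<forall>\<^sub>F n in sequentially. \<forall>x\<in>K. (\<lambda>c'. theta_partial p n (y n (snd (c', x)))) holomorphic_on ball c 1 \<and>
        (\<lambda>c'. theta_partial p n (of_real p powr fst (c', x) * y n (snd (c', x)))) holomorphic_on ball c 1"
      using N(2)
    proof eventually_elim
      case (elim n)
      show ?case
        unfolding fst_conv snd_conv
      proof (intro ballI conjI holomorphic_on_const holomorphic_theta_partial(1)[OF p hol])
        fix x u assume "x \<in> K"
        then have "y n x \<noteq> 0" using bspec[OF elim, of "(c, x)"] by simp
        then show "of_real p powr u * y n x \<noteq> 0" using P0 by simp
      qed
    qed
  qed
qed


section \<open>Convergence of the canonical solutions\<close>

lemma uniform_limit_sum:
  fixes f :: "'k \<Rightarrow> 'i \<Rightarrow> 'x \<Rightarrow> 'b::real_normed_vector"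
  assumes "\<And>k. k \<in> S \<Longrightarrow> uniform_limit X (f k) (g k) \<Phi>"
  shows "uniform_limit X (\<lambda>i x. \<Sum>k\<in>S. f k i x) (\<lambda>x. \<Sum>k\<in>S. g k x) \<Phi>"
  using assms by (induction S rule: infinite_finite_induct) (auto intro: uniform_limit_const uniform_limit_add)

definition unit_matrix :: "'n \<Rightarrow> 'n \<Rightarrow> complex^'n^'n" where
  "unit_matrix i j = (\<chi> a b. if a = i \<and> b = j then 1 else 0)"

lemma matrix_decomp: "(A :: complex^'n^'n) = (\<Sum>i\<in>UNIV. \<Sum>j\<in>UNIV. mscale (A $ i $ j) (unit_matrix i j))"
proof -
  have "(\<Sum>i\<in>UNIV. \<Sum>j\<in>UNIV. mscale (A $ i $ j) (unit_matrix i j)) $ a $ b = A $ a $ b" for a b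
  proof -
    have "(\<Sum>i\<in>UNIV. \<Sum>j\<in>UNIV. mscale (A $ i $ j) (unit_matrix i j)) $ a $ b
      = (\<Sum>i\<in>UNIV. \<Sum>j\<in>UNIV. if i = a then (if j = b then A $ i $ j else 0) else 0)"
      by (simp add: mscale_def unit_matrix_def if_distrib[of "\<lambda>x. _ * x"] cong: if_cong)
        (intro sum.cong refl; auto)
    also have "\<dots> = (\<Sum>i\<in>UNIV. if i = a then (\<Sum>j\<in>UNIV. if j = b then A $ i $ j else 0) else 0)"
      by (intro sum.cong refl) auto
    also have "\<dots> = A $ a $ b" by simp
    finally show ?thesis .
  qed
  then show ?thesis by (simp add: vec_eq_iff)
qed

lemma bounded_linear_mscale_left: "bounded_linear (\<lambda>a. mscale a A)"
proof (rule bounded_linear_intro[of _ "norm A"])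
  show "mscale (r *\<^sub>R x) A = r *\<^sub>R mscale x A" for r x by (simp add: mscale_def vec_eq_iff)
qed (simp_all add: mscale_add_left norm_mscale)

lemma bounded_image_sum:
  fixes f :: "'k \<Rightarrow> 'x \<Rightarrow> 'b::real_normed_vector"
  assumes "\<And>k. k \<in> S \<Longrightarrow> bounded (f k ` X)"
  shows "bounded ((\<lambda>x. \<Sum>k\<in>S. f k x) ` X)"
proof -
  have z: "bounded ((\<lambda>x. 0 :: 'b) ` X)" by (rule bounded_subset[of "{0}"]) auto
  show ?thesis
    using assms by (induction S rule: infinite_finite_induct) (auto intro: bounded_plus_comp z)
qed

lemma uniform_limit_matrix:
  fixes f :: "'i \<Rightarrow> 'x \<Rightarrow> complex^'n^'n"
  assumes "\<And>a b. uniform_limit X (\<lambda>i x. f i x $ a $ b) (\<lambda>x. g x $ a $ b) \<Phi>"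
  shows "uniform_limit X f g \<Phi>"
proof -
  have "uniform_limit X (\<lambda>i x. \<Sum>a\<in>UNIV. \<Sum>b\<in>UNIV. mscale (f i x $ a $ b) (unit_matrix a b))
      (\<lambda>x. \<Sum>a\<in>UNIV. \<Sum>b\<in>UNIV. mscale (g x $ a $ b) (unit_matrix a b)) \<Phi>"
    by (intro uniform_limit_sum bounded_linear.uniform_limit[OF bounded_linear_mscale_left] assms)
  then show ?thesis unfolding matrix_decomp[symmetric] .
qed

lemma bounded_matrix:
  fixes g :: "'x \<Rightarrow> complex^'n^'n"
  assumes "\<And>a b. bounded ((\<lambda>x. g x $ a $ b) ` X)"
  shows "bounded (g ` X)"
proof -
  have "bounded ((\<lambda>x. mscale (g x $ a $ b) (unit_matrix a b)) ` X)" for a b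
    using bounded_linear_image[OF assms bounded_linear_mscale_left] by (simp add: image_image)
  then have "bounded ((\<lambda>x. \<Sum>a\<in>UNIV. \<Sum>b\<in>UNIV. mscale (g x $ a $ b) (unit_matrix a b)) ` X)"
    by (intro bounded_image_sum)
  then show ?thesis unfolding matrix_decomp[symmetric] .
qed

text \<open>\<open>nM\<close> is a mere function with the properties of a norm, so its equivalence
  with the built-in norm is derived: subadditivity on elementary matrices gives a Lipschitz bound,
  and the minimum of \<open>nM\<close> on the unit sphere gives the converse inequality.\<close>

lemma compatible_norms_equiv:
  assumes "compatible_norms nM nV"
  shows "continuous_on UNIV nM" "\<exists>B\<ge>0. \<forall>A. norm A \<le> B * nM A"
proof -
  have z: "nM A = 0 \<longleftrightarrow> A = 0" and s: "nM (mscale a A) = cmod a * nM A" and t: "nM (A + B) \<le> nM A + nM B" for a A B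
    using assms by (auto simp: compatible_norms_def)
  have neg: "nM (- A) = nM A" for A
  proof -
    have "- A = mscale (-1) A" by (simp add: mscale_def vec_eq_iff)
    then show ?thesis using s[of "-1" A] by simp
  qed
  have n0: "nM A \<ge> 0" for A using t[of A "- A"] neg[of A] z[of 0] by simp
  have ts: "nM (sum f S) \<le> (\<Sum>k\<in>S. nM (f k))" for f :: "'b \<Rightarrow> complex^'a^'a" and S
  proof (induction S rule: infinite_finite_induct)
    case (insert x F)
    then show ?case using t[of "f x" "sum f F"] by simp
  qed (simp_all add: z[of 0, THEN iffD2])
  define b where "b = (\<Sum>i\<in>(UNIV::'a set). \<Sum>j\<in>(UNIV::'a set). nM (unit_matrix i j))"
  have ub: "nM A \<le> b * norm A" for A
  proof -
    have "nM A \<le> (\<Sum>i\<in>UNIV. \<Sum>j\<in>UNIV. nM (mscale (A $ i $ j) (unit_matrix i j)))"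
      by (subst (1) matrix_decomp[of A]) (intro order_trans[OF ts] sum_mono ts)
    also have "\<dots> \<le> (\<Sum>i\<in>UNIV. \<Sum>j\<in>UNIV. norm A * nM (unit_matrix i j))"
      unfolding s by (intro sum_mono mult_right_mono n0 order_trans[OF Finite_Cartesian_Product.norm_nth_le Finite_Cartesian_Product.norm_nth_le])
    also have "\<dots> = b * norm A" by (simp add: b_def sum_distrib_left[symmetric] mult.commute)
    finally show ?thesis .
  qed
  have b0: "b \<ge> 0" unfolding b_def by (intro sum_nonneg n0)
  have lip: "\<bar>nM A - nM B\<bar> \<le> b * norm (A - B)" for A B
    using t[of "A - B" B] t[of "B - A" A] neg[of "A - B"] ub[of "A - B"] by simp
  show cont: "continuous_on UNIV nM"
    unfolding continuous_on_iff
  proof (intro ballI allI impI)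
    fix A :: "complex^'a^'a" and e :: real assume e: "e > 0"
    show "\<exists>d>0. \<forall>x'\<in>UNIV. dist x' A < d \<longrightarrow> dist (nM x') (nM A) < e"
    proof (intro exI[of _ "e / (b + 1)"] conjI ballI impI)
      fix B assume "dist B A < e / (b + 1)"
      then have "(b + 1) * norm (B - A) < e" using b0 by (simp add: dist_norm field_simps)
      moreover have "b * norm (B - A) \<le> (b + 1) * norm (B - A)" by (simp add: mult_right_mono)
      ultimately show "dist (nM B) (nM A) < e" using lip[of B A] by (simp add: dist_real_def)
    qed (use e b0 in auto)
  qed
  have "compact (sphere (0 :: complex^'a^'a) 1)" by simp
  moreover have "sphere (0 :: complex^'a^'a) 1 \<noteq> {}" by simp
  ultimately obtain A0 where A0: "A0 \<in> sphere 0 1" "\<And>A. A \<in> sphere 0 1 \<Longrightarrow> nM A0 \<le> nM A"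
    using continuous_attains_inf[of "sphere 0 1" nM] continuous_on_subset[OF cont] by (metis subset_UNIV)
  have a: "nM A0 > 0" using n0[of A0] z[of A0] A0(1) by (cases "A0 = 0") auto
  have "norm A \<le> (1 / nM A0) * nM A" for A
  proof (cases "A = 0")
    case False
    have "nM A0 \<le> nM (mscale (of_real (1 / norm A)) A)"
      using False by (intro A0(2)) (simp add: norm_mscale norm_divide)
    also have "\<dots> = nM A / norm A" unfolding s by (simp add: norm_divide)
    finally show ?thesis using a False by (simp add: field_simps)
  qed (simp add: z[of 0, THEN iffD2])
  then show "\<exists>B\<ge>0. \<forall>A. norm A \<le> B * nM A" using a by (intro exI[of _ "1 / nM A0"]) auto
qed

lemma matrix_inv_right: "invertible (A :: 'a::semiring_1^'n^'n) \<Longrightarrow> A ** matrix_inv A = mat 1"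
  unfolding invertible_def matrix_inv_def by (rule someI2_ex) auto

text \<open>The inverse solves the Sylvester equation with \<open>V = 0\<close> and right-hand side
  1; the only eigenvalue of the zero matrix is 0, which an invertible \<open>P0\<close> does not
  have.\<close>

lemma matrix_inv_tendsto:
  fixes P :: "'i \<Rightarrow> complex^'n^'n"
  assumes P: "(P \<longlongrightarrow> P0) \<Phi>" and inv: "\<forall>\<^sub>F i in \<Phi>. invertible (P i)" "invertible P0"
  shows "((\<lambda>i. matrix_inv (P i)) \<longlongrightarrow> matrix_inv P0) \<Phi>"
proof (rule sylvester_tendsto[OF P tendsto_const[of 0]])
  have z: "M ** (0 :: complex^'n^'n) = 0" for M :: "complex^'n^'n"
    by (rule bounded_bilinear.zero_right[OF bounded_bilinear_matrix_mul])
  have "\<forall>\<^sub>F i in \<Phi>. P i ** matrix_inv (P i) - matrix_inv (P i) ** 0 = mat 1"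
    using inv(1) by eventually_elim (simp add: z matrix_inv_right)
  then show "((\<lambda>i. P i ** matrix_inv (P i) - matrix_inv (P i) ** 0) \<longlongrightarrow> P0 ** matrix_inv P0 - matrix_inv P0 ** 0) \<Phi>"
    unfolding z matrix_inv_right[OF inv(2)] by (simp add: z tendsto_eventually)
  fix c assume c: "eigenval P0 c" "eigenval (0 :: complex^'n^'n) c"
  obtain v where v: "v \<noteq> 0" "(0 :: complex^'n^'n) *v v = c *s v" using c(2) unfolding eigenval_def by blast
  then have "c = 0" by (auto simp: vec_eq_iff matrix_vector_mult_def)
  obtain u where u: "u \<noteq> 0" "P0 *v u = c *s u" using c(1) unfolding eigenval_def by blast
  obtain B where "B ** P0 = mat 1" using inv(2) unfolding invertible_def by blast
  then have "u = B *v (P0 *v u)" by (simp add: matrix_vector_mul_assoc)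
  also have "\<dots> = 0" unfolding u(2) \<open>c = 0\<close> by simp
  finally show False using u(1) by simp
qed

text \<open>The entries of \<open>E_J0\<close> are finite combinations of the
  \<open>ell_fun\<close>. The bounds on the limits are carried along because products of uniform
  limits require them.\<close>

lemma X_can_uniform_limit:
  fixes F :: "'i \<Rightarrow> nat \<Rightarrow> complex^'n^'n" and \<iota> :: "'n \<Rightarrow> nat \<times> nat"
  assumes F: "uniform_limit K (\<lambda>i. fseries_sum (q i) (h i) (F i)) (fseries_sum q0 h0 F0) \<Phi>" "bounded (fseries_sum q0 h0 F0 ` K)"
    and e: "\<And>a. e_fun_converges q h q0 h0 (c (fst (\<iota> a))) K \<Phi>"
    and P: "(P \<longlongrightarrow> P0) \<Phi>" "\<forall>\<^sub>F i in \<Phi>. invertible (P i)" "invertible P0"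
  shows "uniform_limit K (\<lambda>i. X_can \<iota> c r (q i) (h i) (F i) (P i)) (X_can \<iota> c r q0 h0 F0 P0) \<Phi>"
proof -
  note ell = ell_fun_uniform_limit[OF e]
  have L: "uniform_limit K (\<lambda>i x. E_J0 \<iota> c r (q i) (h i) x $ a $ b) (\<lambda>x. E_J0 \<iota> c r q0 h0 x $ a $ b) \<Phi>" for a b
  proof (cases "fst (\<iota> a) = fst (\<iota> b)")
    case True
    have *: "E_J0 \<iota> c r q h x $ a $ b = (\<Sum>k<r (fst (\<iota> a)). ell_fun q h (c (fst (\<iota> a))) k x * N_pow (r (fst (\<iota> a))) k (snd (\<iota> a)) (snd (\<iota> b)))" for q h x
      using True by (simp add: E_J0_def block_diag_def L_block_def)
    show ?thesis unfolding *
      by (intro uniform_limit_sum uniform_lim_mult ell uniform_limit_const) (auto intro: bounded_subset[of "{_}"])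
  qed (simp add: E_J0_def block_diag_def uniform_limit_const)
  have B: "bounded ((\<lambda>x. E_J0 \<iota> c r q0 h0 x $ a $ b) ` K)" for a b
  proof (cases "fst (\<iota> a) = fst (\<iota> b)")
    case True
    have *: "E_J0 \<iota> c r q h x $ a $ b = (\<Sum>k<r (fst (\<iota> a)). ell_fun q h (c (fst (\<iota> a))) k x * N_pow (r (fst (\<iota> a))) k (snd (\<iota> a)) (snd (\<iota> b)))" for q h x
      using True by (simp add: E_J0_def block_diag_def L_block_def)
    have "bounded ((\<lambda>x. ell_fun q0 h0 (c (fst (\<iota> a))) k x * y) ` K)" for k y
      using bounded_linear_image[OF ell(2) bounded_linear_mult_left[of y]] by (simp add: image_image)
    then show ?thesis unfolding * by (intro bounded_image_sum)
  next
    case False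
    then show ?thesis by (auto simp: E_J0_def block_diag_def intro: bounded_subset[of "{0}"])
  qed
  note E = uniform_limit_matrix[OF L] and bE = bounded_matrix[OF B]
  interpret bb: bounded_bilinear "(**) :: complex^'n^'n \<Rightarrow> complex^'n^'n \<Rightarrow> complex^'n^'n"
    by (rule bounded_bilinear_matrix_mul)
  have bc: "bounded ((\<lambda>_. M) ` K)" for M :: "complex^'n^'n" by (rule bounded_subset[of "{M}"]) auto
  have bm: "bounded ((\<lambda>x. M ** g x) ` K)" "bounded ((\<lambda>x. g x ** M) ` K)" if "bounded (g ` K)"
    for M :: "complex^'n^'n" and g :: "complex \<Rightarrow> complex^'n^'n"
    using bounded_linear_image[OF that bb.bounded_linear_right[of M]] bounded_linear_image[OF that bb.bounded_linear_left[of M]]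
    by (simp_all add: image_image)
  show ?thesis
    unfolding X_can_def
    by (intro bb.bounded_uniform_limit F E bE bc bm uniform_limit_of_tendsto P matrix_inv_tendsto)
qed

section \<open>Passage to the limit in the bounds, and assembly along a filter\<close>

lemma tendsto_fuchsian_bound:
  assumes "(q \<longlongrightarrow> q0) \<Phi>" "(h \<longlongrightarrow> h0) \<Phi>" "\<forall>\<^sub>F i in \<Phi>. q i \<ge> 1" "q0 \<ge> 1"
  shows "((\<lambda>i. C * q i ^ s * qh_fact (q i) (h i) s (lam::real)) \<longlongrightarrow> C * q0 ^ s * qh_fact q0 h0 s lam) \<Phi>"
proof -
  have qn: "((\<lambda>i. qnum (q i) k) \<longlongrightarrow> qnum q0 k) \<Phi>" for k
    unfolding qnum_def by (intro tendsto_intros assms)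
  have "((\<lambda>i. C * q i ^ s * (\<Prod>k<s. q i ^ k * lam + h i * qnum (q i) k)) \<longlongrightarrow> C * q0 ^ s * qh_fact q0 h0 s lam) \<Phi>"
    unfolding qh_fact_real[OF assms(4)] by (intro tendsto_intros assms qn)
  then show ?thesis
    by (rule tendsto_cong[THEN iffD1, rotated]) (use assms(3) in \<open>eventually_elim, simp add: qh_fact_real\<close>)
qed

text \<open>\<open>nM\<close> is continuous and the majorant is polynomial in \<open>(q, h)\<close>,
  so the inequality survives along a non-trivial filter; the limit series thus has the constants of
  the family.\<close>

lemma fuchsian_bound_limit:
  fixes M :: "'i \<Rightarrow> nat \<Rightarrow> complex^'n^'n"
  assumes norms: "compatible_norms nM nV" and "\<Phi> \<noteq> bot"
    and lim: "(q \<longlongrightarrow> q0) \<Phi>" "(h \<longlongrightarrow> h0) \<Phi>" "\<forall>\<^sub>F i in \<Phi>. q i \<ge> 1" "q0 \<ge> 1"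
    and M: "((\<lambda>i. M i (Suc s)) \<longlongrightarrow> M0 (Suc s)) \<Phi>"
    and le: "\<forall>\<^sub>F i in \<Phi>. \<forall>s\<ge>1. nM (M i s) \<le> C * q i ^ (s - 1) * qh_fact (q i) (h i) (s - 1) lam"
  shows "nM (M0 (Suc s)) \<le> C * q0 ^ s * qh_fact q0 h0 s lam"
proof (rule tendsto_le[OF \<open>\<Phi> \<noteq> bot\<close> tendsto_fuchsian_bound[OF lim]])
  show "((\<lambda>i. nM (M i (Suc s))) \<longlongrightarrow> nM (M0 (Suc s))) \<Phi>"
    by (rule continuous_on_tendsto_compose[OF compatible_norms_equiv(1)[OF norms] M]) auto
  show "\<forall>\<^sub>F i in \<Phi>. nM (M i (Suc s)) \<le> C * q i ^ s * qh_fact (q i) (h i) s lam"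
    using le by eventually_elim (force dest: spec[of _ "Suc s"])
qed

lemma X_can_confluence:
  fixes A F :: "'i \<Rightarrow> nat \<Rightarrow> complex^'n^'n" and \<iota> :: "'n \<Rightarrow> nat \<times> nat"
  assumes norms: "compatible_norms nM nV" and ne: "\<Phi> \<noteq> bot" and C: "C \<ge> 0" and lam: "0 \<le> lam" "lam < X"
    and lim: "(q \<longlongrightarrow> q0) \<Phi>" "(h \<longlongrightarrow> h0) \<Phi>" "\<forall>\<^sub>F i in \<Phi>. q i \<ge> 1 \<and> h i \<ge> 0" "q0 \<ge> 1" "h0 \<ge> 0"
    and A: "\<And>s. ((\<lambda>i. A i s) \<longlongrightarrow> A0 s) \<Phi>"
    and g: "\<forall>\<^sub>F i in \<Phi>. canonical_gauge (q i) (h i) (A i) (F i)" "canonical_gauge q0 h0 A0 F0"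
    and nr: "nonresonant {(q0, h0)} (\<lambda>_ _. A0)"
    and le: "\<forall>\<^sub>F i in \<Phi>. \<forall>s\<ge>1. nM (F i s) \<le> C * q i ^ (s - 1) * qh_fact (q i) (h i) (s - 1) lam"
    and P: "(P \<longlongrightarrow> P0) \<Phi>" "\<forall>\<^sub>F i in \<Phi>. invertible (P i)" "invertible P0"
    and K: "compact K" and dom: "\<forall>\<^sub>F i in \<Phi>. \<forall>x\<in>K. factors_ge (q i) (h i) X x" "\<And>x. x \<in> K \<Longrightarrow> factors_ge q0 h0 X x"
    and e: "\<And>a. e_fun_converges q h q0 h0 (c (fst (\<iota> a))) K \<Phi>"
  shows "uniform_limit K (\<lambda>i. X_can \<iota> c r (q i) (h i) (F i) (P i)) (X_can \<iota> c r q0 h0 F0 P0) \<Phi>"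
proof -
  have q1: "\<forall>\<^sub>F i in \<Phi>. q i \<ge> 1" using lim(3) by eventually_elim simp
  have Flim: "((\<lambda>i. F i s) \<longlongrightarrow> F0 s) \<Phi>" for s
    by (rule canonical_gauge_tendsto[OF lim(1,2) q1 lim(4) A g nr])
  obtain B where B: "B \<ge> 0" "\<And>M. norm M \<le> B * nM M" using compatible_norms_equiv(2)[OF norms] by blast
  \<comment> \<open>Supplies the upper bound \<open>H = h0 + 1\<close> of the common majorant, which
    is positive even when \<open>h0 = 0\<close>.\<close>
  have "\<forall>\<^sub>F i in \<Phi>. h i < h0 + 1" using lim(2) by (intro order_tendstoD) auto
  then have ev: "\<forall>\<^sub>F i in \<Phi>. q i \<ge> 1 \<and> h i \<ge> 0 \<and> h i \<le> h0 + 1 \<and> (\<forall>x\<in>K. factors_ge (q i) (h i) X x)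
       \<and> (\<forall>s. norm (F i (Suc s)) \<le> B * C * (q i ^ s * qh_fact (q i) (h i) s lam))"
    using lim(3) dom(1) le
  proof eventually_elim
    case (elim i)
    have "norm (F i (Suc s)) \<le> B * C * (q i ^ s * qh_fact (q i) (h i) s lam)" for s
    proof -
      have "nM (F i (Suc s)) \<le> C * q i ^ s * qh_fact (q i) (h i) s lam" using elim(4)[rule_format, of "Suc s"] by simp
      then have "B * nM (F i (Suc s)) \<le> B * (C * q i ^ s * qh_fact (q i) (h i) s lam)" using B(1) by (rule mult_left_mono)
      then show ?thesis using B(2)[of "F i (Suc s)"] by (simp add: mult.assoc)
    qed
    then show ?case using elim by simp
  qed
  have F0: "norm (F0 (Suc s)) \<le> B * C * (q0 ^ s * qh_fact q0 h0 s lam)" for s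
  proof -
    have "B * nM (F0 (Suc s)) \<le> B * (C * q0 ^ s * qh_fact q0 h0 s lam)"
      by (intro mult_left_mono B(1) fuchsian_bound_limit[where M = F and ?M0.0 = F0 and s = s, OF norms ne lim(1,2) q1 lim(4) Flim le])
    then show ?thesis using B(2)[of "F0 (Suc s)"] by (simp add: mult.assoc)
  qed
  have BC: "B * C \<ge> 0" using B C by simp
  have h01: "h0 \<le> h0 + 1" "h0 + 1 > 0" using lim(5) by auto
  have S: "uniform_limit K (\<lambda>i. fseries_sum (q i) (h i) (F i)) (fseries_sum q0 h0 F0) \<Phi>"
    "bounded (fseries_sum q0 h0 F0 ` K)"
    by (rule uniform_limit_fseries_sum[OF K lam BC lim(1,2) Flim ev lim(4,5) h01(1) _ F0 h01(2)], rule dom(2), assumption)+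
  show ?thesis by (intro X_can_uniform_limit S e P)
qed

lemma summable_fseries_term:
  fixes M :: "nat \<Rightarrow> complex^'n^'n"
  assumes norms: "compatible_norms nM nV" and C: "C \<ge> 0" and lam: "0 \<le> lam" "lam < X"
    and q: "q \<ge> 1" and h: "h \<ge> 0" and x: "factors_ge q h X x"
    and le: "\<And>s. nM (M (Suc s)) \<le> C * q ^ s * qh_fact q h s lam"
  shows "summable (fseries_term q h M x)"
proof -
  obtain B where B: "B \<ge> 0" "\<And>M. norm M \<le> B * nM M" using compatible_norms_equiv(2)[OF norms] by blast
  have M: "norm (M (Suc s)) \<le> B * C * (q ^ s * qh_fact q h s lam)" for s
    using order_trans[OF B(2) mult_left_mono[OF le B(1)]] by (simp add: mult.assoc)
  have "B * C \<ge> 0" "h \<le> h + 1" using B C by auto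
  then have "summable (\<lambda>k. fseries_term q h M x (Suc k))"
    by (intro suminf_tail_bound(1)[OF fseries_tail[OF q h _ lam x _ M]])
  then show ?thesis by (subst (asm) summable_Suc_iff)
qed

text \<open>On \<open>K\<close> the strict inequality has a margin \<open>2 d\<close>. Half of it
  defines \<open>X\<close>; the other half absorbs the moving centre, whose displacement, below
  \<open>d / 2\<close>, enters once through the modulus and once through the subtracted
  \<open>L i\<close>.\<close>

lemma disc_bound_eventually:
  assumes K: "compact K" and l: "l \<ge> 0" and L: "(L \<longlongrightarrow> l) \<Phi>"
    and gt: "\<And>x. x \<in> K \<Longrightarrow> lam + l < cmod (x + of_real l)"
  obtains X where "lam < X" "\<forall>\<^sub>F i in \<Phi>. \<forall>x\<in>K. X \<le> cmod (x + of_real (L i)) - L i"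
    "\<And>x. x \<in> K \<Longrightarrow> X \<le> cmod (x + of_real l) - l"
proof (cases "K = {}")
  case True then show ?thesis by (intro that[of "lam + 1"]) auto
next
  case False
  have "continuous_on K (\<lambda>x. cmod (x + of_real l))" by (intro continuous_intros)
  then obtain x0 where x0: "x0 \<in> K" "\<And>x. x \<in> K \<Longrightarrow> cmod (x0 + of_real l) \<le> cmod (x + of_real l)"
    using continuous_attains_inf[OF K False] by blast
  define d where "d = (cmod (x0 + of_real l) - l - lam) / 2"
  have d: "d > 0" "cmod (x0 + of_real l) = 2 * d + l + lam" using gt[OF x0(1)] by (simp_all add: d_def field_simps)
  show ?thesis
  proof (rule that[of "lam + d"])
    have "\<forall>\<^sub>F i in \<Phi>. dist (L i) l < d / 2" using L d by (intro tendstoD) auto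
    then show "\<forall>\<^sub>F i in \<Phi>. \<forall>x\<in>K. lam + d \<le> cmod (x + of_real (L i)) - L i"
    proof eventually_elim
      case (elim i)
      show ?case
      proof
        fix x assume x: "x \<in> K"
        have a: "\<bar>L i - l\<bar> < d / 2" using elim by (simp add: dist_real_def)
        have "x + of_real l = (x + of_real (L i)) - of_real (L i - l)" by simp
        then have "cmod (x + of_real l) \<le> cmod (x + of_real (L i)) + \<bar>L i - l\<bar>"
          by (metis norm_of_real norm_triangle_ineq4)
        then show "lam + d \<le> cmod (x + of_real (L i)) - L i"
          using x0(2)[OF x] a abs_ge_self[of "L i - l"] d(2) by linarith
      qed
    qed
    show "lam + d \<le> cmod (x + of_real l) - l" if "x \<in> K" for x
      using x0(2)[OF that] d by linarith
  qed (use d in simp)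
qed

lemma confluence_filterD:
  shows "(fst \<longlongrightarrow> q0) (confluence_filter \<Lambda> q0 h0 l)" "(snd \<longlongrightarrow> h0) (confluence_filter \<Lambda> q0 h0 l)"
    and "\<forall>\<^sub>F z in confluence_filter \<Lambda> q0 h0 l. z \<in> \<Lambda>"
    and "(q0, h0) = (1, 0) \<Longrightarrow> ((\<lambda>z. snd z / (fst z - 1)) \<longlongrightarrow> l) (confluence_filter \<Lambda> q0 h0 l)"
proof -
  have le: "confluence_filter \<Lambda> q0 h0 l \<le> inf (nhds (q0, h0)) (principal \<Lambda>)"
    by (cases "(q0, h0) = (1, 0)") (simp_all only: confluence_filter_def if_True if_False inf_le1 order_refl simp_thms)
  then have nhds: "((\<lambda>z. z) \<longlongrightarrow> (q0, h0)) (confluence_filter \<Lambda> q0 h0 l)"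
    unfolding filterlim_def filtermap_ident by simp
  show "(fst \<longlongrightarrow> q0) (confluence_filter \<Lambda> q0 h0 l)" "(snd \<longlongrightarrow> h0) (confluence_filter \<Lambda> q0 h0 l)"
    using tendsto_fst[OF nhds] tendsto_snd[OF nhds] by simp_all
  show "\<forall>\<^sub>F z in confluence_filter \<Lambda> q0 h0 l. z \<in> \<Lambda>"
    using le by (simp add: le_principal)
  show "((\<lambda>z. snd z / (fst z - 1)) \<longlongrightarrow> l) (confluence_filter \<Lambda> q0 h0 l)" if "(q0, h0) = (1, 0)"
    unfolding filterlim_iff_le_filtercomap using that by (simp add: confluence_filter_def case_prod_unfold)
qed

text \<open>Away from \<open>(1, 0)\<close> membership in the closure makes the filter proper. At
  \<open>(1, 0)\<close> the prescribed limit of \<open>h/(q - 1)\<close> may be unattainable within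
  \<open>\<Lambda>\<close>.\<close>

lemma confluence_filter_not_bot:
  assumes "(q0, h0) \<in> closure \<Lambda>" "(q0, h0) \<noteq> (1, 0)"
  shows "confluence_filter \<Lambda> q0 h0 l \<noteq> bot"
proof
  assume "confluence_filter \<Lambda> q0 h0 l = bot"
  then have "\<forall>\<^sub>F z in nhds (q0, h0). z \<notin> \<Lambda>"
    using assms(2) by (auto simp: confluence_filter_def trivial_limit_def eventually_inf_principal)
  then obtain S where "open S" "(q0, h0) \<in> S" "\<forall>z\<in>S. z \<notin> \<Lambda>" unfolding eventually_nhds by blast
  then show False using assms(1) closure_iff_nhds_not_empty by blast
qed

section \<open>The three situations of confluence\<close>

theorem mainTheorem2:
  fixes \<Lambda> :: "(real \<times> real) set"
    and C lam C' lam' q0 h0 l :: real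
    and nM :: "complex^'n^'n \<Rightarrow> real" and nV :: "complex^'n \<Rightarrow> real"
    and A F :: "real \<Rightarrow> real \<Rightarrow> nat \<Rightarrow> complex^'n^'n"
    and m :: nat and c :: "nat \<Rightarrow> complex" and r :: "nat \<Rightarrow> nat"
    and \<iota> :: "'n \<Rightarrow> nat \<times> nat"
    and P :: "real \<Rightarrow> real \<Rightarrow> complex^'n^'n"
    and Alim :: "nat \<Rightarrow> complex^'n^'n" and P0 :: "complex^'n^'n"
  assumes norms: "compatible_norms nM nV"
    and Lambda: "\<Lambda> \<subseteq> Qplus" "bounded \<Lambda>"
    and nonneg: "C \<ge> 0" "lam \<ge> 0" "C' \<ge> 0" "lam' \<ge> 0"
    and fuchsian: "fuchsian_systems nM \<Lambda> C lam A"
    and nonres: "nonresonant \<Lambda> A"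
    and exponents: "\<And>i j. i < m \<Longrightarrow> j < m \<Longrightarrow> c i - c j \<notin> \<int> - {0}"
    and sizes: "\<And>i. i < m \<Longrightarrow> r i \<ge> 1"
    and blocks: "bij_betw \<iota> UNIV {(i, j). i < m \<and> j < r i}"
    and bounded_conj: "\<exists>B :: real \<Rightarrow> real \<Rightarrow> complex^'n^'n.
      (\<forall>(q, h) \<in> \<Lambda>. conjugates (B q h) (J0 \<iota> c r q) (A q h 0)) \<and>
      bounded ((\<lambda>(q, h). B q h) ` \<Lambda>) \<and> bounded ((\<lambda>(q, h). matrix_inv (B q h)) ` \<Lambda>)"
    and gauge: "\<forall>(q, h) \<in> \<Lambda>. canonical_gauge q h (A q h) (F q h)"
    and gauge_fuchsian: "fuchsian_matrices nM \<Lambda> C' lam' F"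
    and point: "(q0, h0) \<in> closure \<Lambda> \<inter> frontier Qplus"
    and situation: "(q0 > 1 \<and> h0 = 0) \<or> (q0 = 1 \<and> h0 > 0) \<or>
      (q0 = 1 \<and> h0 = 0 \<and> l > 0 \<and> confluence_filter \<Lambda> q0 h0 l \<noteq> bot)"
    and coeff_lim: "\<And>s. ((\<lambda>(q, h). A q h s) \<longlongrightarrow> Alim s) (confluence_filter \<Lambda> q0 h0 l)"
    and conj: "\<forall>(q, h) \<in> \<Lambda>. conjugates (P q h) (J0 \<iota> c r q) (A q h 0)"
    and conj_lim: "((\<lambda>(q, h). P q h) \<longlongrightarrow> P0) (confluence_filter \<Lambda> q0 h0 l)"
    and conj0: "conjugates P0 (J0 \<iota> c r q0) (Alim 0)"
  shows
    "((q0, h0) \<noteq> (1, 0) \<longrightarrow>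
        (\<forall>x \<in> V_dom q0 h0 (of_real lam). summable (fseries_term q0 h0 Alim x))) \<and>
     ((q0, h0) = (1, 0) \<longrightarrow>
        (\<forall>x \<in> V_ell l lam. summable (fseries_term q0 h0 Alim x))) \<and>
     ((\<exists>C1\<ge>0. \<exists>lam1\<ge>0. fuchsian_systems nM {(q0, h0)} C1 lam1 (\<lambda>_ _. Alim)) \<and>
      nonresonant {(q0, h0)} (\<lambda>_ _. Alim) \<longrightarrow>
      (\<forall>F0. canonical_gauge q0 h0 Alim F0 \<longrightarrow>
        (q0 > 1 \<and> h0 = 0 \<and> (\<forall>\<^sub>F n in sequentially. (q0, (1 - 1 / q0) * (1 / q0) ^ n) \<in> \<Lambda>) \<longrightarrow>
          locally_uniform_limit
            ({x. cmod x > lam'} - (\<Union>i<m. spiral_poles q0 (c i)))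
            (\<lambda>n. let h = (1 - 1 / q0) * (1 / q0) ^ n in X_can \<iota> c r q0 h (F q0 h) (P q0 h))
            (X_can \<iota> c r q0 h0 F0 P0) sequentially) \<and>
        (q0 = 1 \<and> h0 > 0 \<longrightarrow>
          locally_uniform_limit
            ({x. Re x > lam'} - (\<Union>i<m. gamma_poles h0 (c i)))
            (\<lambda>(q, h). X_can \<iota> c r q h (F q h) (P q h))
            (X_can \<iota> c r q0 h0 F0 P0) (confluence_filter \<Lambda> q0 h0 l)) \<and>
        (q0 = 1 \<and> h0 = 0 \<longrightarrow>
          locally_uniform_limit
            (V_ell l lam' - of_real ` {0..})
            (\<lambda>(q, h). X_can \<iota> c r q h (F q h) (P q h))
            (X_can \<iota> c r q0 h0 F0 P0) (confluence_filter \<Lambda> q0 h0 l))))"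
proof -
  define \<Phi> where "\<Phi> = confluence_filter \<Lambda> q0 h0 l"
  note \<Phi>D = confluence_filterD[where \<Lambda> = \<Lambda> and ?q0.0 = q0 and ?h0.0 = h0 and l = l, folded \<Phi>_def]
  have ne: "\<Phi> \<noteq> bot"
    using situation confluence_filter_not_bot[of q0 h0 \<Lambda> l] point unfolding \<Phi>_def by auto
  have Q: "\<forall>z\<in>\<Lambda>. fst z \<ge> 1 \<and> snd z \<ge> 0" using Lambda(1) by (auto simp: Qplus_def)
  have evQ: "\<forall>\<^sub>F z in \<Phi>. fst z \<ge> 1 \<and> snd z \<ge> 0" using \<Phi>D(3) by eventually_elim (use Q in auto)
  have evq: "\<forall>\<^sub>F z in \<Phi>. fst z \<ge> 1" using evQ by eventually_elim simp
  have q0: "q0 \<ge> 1" "h0 \<ge> 0" using situation by auto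
  have Alim: "((\<lambda>z. A (fst z) (snd z) s) \<longlongrightarrow> Alim s) \<Phi>" for s
    using coeff_lim[of s] by (simp add: \<Phi>_def case_prod_unfold)
  have Plim: "((\<lambda>z. P (fst z) (snd z)) \<longlongrightarrow> P0) \<Phi>"
    using conj_lim by (simp add: \<Phi>_def case_prod_unfold)
  have LP: "\<forall>z\<in>\<Lambda>. invertible (P (fst z) (snd z))" using conj by (auto simp: conjugates_def)
  have P0: "invertible P0" using conj0 by (simp add: conjugates_def)
  have LF: "\<forall>z\<in>\<Lambda>. \<forall>s\<ge>1. nM (F (fst z) (snd z) s) \<le> C' * fst z ^ (s - 1) * qh_fact (fst z) (snd z) (s - 1) lam'"
    using gauge_fuchsian by (auto simp: fuchsian_matrices_def)
  have LA: "\<forall>z\<in>\<Lambda>. \<forall>s\<ge>1. nM (A (fst z) (snd z) s) \<le> C * fst z ^ (s - 1) * qh_fact (fst z) (snd z) (s - 1) lam"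
    using fuchsian by (auto simp: fuchsian_systems_def fuchsian_matrices_def)
  have Lg: "\<forall>z\<in>\<Lambda>. canonical_gauge (fst z) (snd z) (A (fst z) (snd z)) (F (fst z) (snd z))"
    using gauge by auto
  have Abound: "nM (Alim (Suc s)) \<le> C * q0 ^ s * qh_fact q0 h0 s lam" for s
  proof (rule fuchsian_bound_limit[where M = "\<lambda>z. A (fst z) (snd z)" and ?M0.0 = Alim and s = s,
        OF norms ne \<Phi>D(1,2) evq q0(1) Alim[of "Suc s"]])
    show "\<forall>\<^sub>F z in \<Phi>. \<forall>s\<ge>1. nM (A (fst z) (snd z) s) \<le> C * fst z ^ (s - 1) * qh_fact (fst z) (snd z) (s - 1) lam"
      using \<Phi>D(3) by eventually_elim (use LA in blast)
  qed
  have m: "fst (\<iota> a) < m" for a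
  proof -
    have "\<iota> a \<in> {(i, j). i < m \<and> j < r i}" by (rule bspec[OF bij_betwE[OF blocks] UNIV_I])
    then show ?thesis by (auto simp: case_prod_unfold)
  qed
  have part1: "summable (fseries_term q0 h0 Alim x)" if "lam < X" "factors_ge q0 h0 X x" for X x
    by (rule summable_fseries_term[OF norms nonneg(1,2) that(1) q0 that(2) Abound])
  \<comment> \<open>One argument for all situations: \<open>z\<close> runs along the confluence
    filter, as the sequence \<open>(q0, h_n)\<close> in the first situation and as the identity in
    the other two.\<close>
  have core: "uniform_limit K (\<lambda>i. X_can \<iota> c r (fst (z i)) (snd (z i)) (F (fst (z i)) (snd (z i))) (P (fst (z i)) (snd (z i))))
      (X_can \<iota> c r q0 h0 F0 P0) \<Psi>"
    if nr: "nonresonant {(q0, h0)} (\<lambda>_ _. Alim)" and g0: "canonical_gauge q0 h0 Alim F0"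
      and z: "filterlim z \<Phi> \<Psi>" and ne': "\<Psi> \<noteq> bot" and K: "compact K" and X: "lam' < X"
      and dom: "\<forall>\<^sub>F i in \<Psi>. \<forall>x\<in>K. factors_ge (fst (z i)) (snd (z i)) X x" "\<And>x. x \<in> K \<Longrightarrow> factors_ge q0 h0 X x"
      and e: "\<And>j. j < m \<Longrightarrow> e_fun_converges (\<lambda>i. fst (z i)) (\<lambda>i. snd (z i)) q0 h0 (c j) K \<Psi>"
    for F0 K X and z :: "'k \<Rightarrow> real \<times> real" and \<Psi>
  proof -
    have ev\<Lambda>: "\<forall>\<^sub>F i in \<Psi>. z i \<in> \<Lambda>" using eventually_compose_filterlim[OF \<Phi>D(3) z] .
    show ?thesis
    proof (rule X_can_confluence[where A = "\<lambda>i. A (fst (z i)) (snd (z i))" and F = "\<lambda>i. F (fst (z i)) (snd (z i))"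
          and P = "\<lambda>i. P (fst (z i)) (snd (z i))", OF norms ne' nonneg(3,4) X _ _ _ q0 _ _ g0 nr _ _ _ P0 K dom(1)])
      show "factors_ge q0 h0 X x" if "x \<in> K" for x using dom(2)[OF that] .
      show "e_fun_converges (\<lambda>i. fst (z i)) (\<lambda>i. snd (z i)) q0 h0 (c (fst (\<iota> a))) K \<Psi>" for a using e[OF m] .
      show "((\<lambda>i. fst (z i)) \<longlongrightarrow> q0) \<Psi>" "((\<lambda>i. snd (z i)) \<longlongrightarrow> h0) \<Psi>"
        using filterlim_compose[OF \<Phi>D(1) z] filterlim_compose[OF \<Phi>D(2) z] .
      show "\<forall>\<^sub>F i in \<Psi>. fst (z i) \<ge> 1 \<and> snd (z i) \<ge> 0" using ev\<Lambda> by eventually_elim (use Q in auto)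
      show "((\<lambda>i. A (fst (z i)) (snd (z i)) s) \<longlongrightarrow> Alim s) \<Psi>" for s using filterlim_compose[OF Alim z] .
      show "((\<lambda>i. P (fst (z i)) (snd (z i))) \<longlongrightarrow> P0) \<Psi>" using filterlim_compose[OF Plim z] .
      show "\<forall>\<^sub>F i in \<Psi>. canonical_gauge (fst (z i)) (snd (z i)) (A (fst (z i)) (snd (z i))) (F (fst (z i)) (snd (z i)))"
        using ev\<Lambda> by eventually_elim (use Lg in blast)
      show "\<forall>\<^sub>F i in \<Psi>. \<forall>s\<ge>1. nM (F (fst (z i)) (snd (z i)) s) \<le> C' * fst (z i) ^ (s - 1) * qh_fact (fst (z i)) (snd (z i)) (s - 1) lam'"
        using ev\<Lambda> by eventually_elim (use LF in blast)
      show "\<forall>\<^sub>F i in \<Psi>. invertible (P (fst (z i)) (snd (z i)))"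
        using ev\<Lambda> by eventually_elim (use LP in blast)
    qed
  qed
  have A: "\<forall>x\<in>V_dom q0 h0 (of_real lam). summable (fseries_term q0 h0 Alim x)" if "(q0, h0) \<noteq> (1, 0)"
  proof
    fix x assume x: "x \<in> V_dom q0 h0 (of_real lam)"
    from situation that consider "q0 > 1" "h0 = 0" | "q0 = 1" "h0 > 0" by auto
    then show "summable (fseries_term q0 h0 Alim x)"
    proof cases
      case 1
      then have "lam < cmod x" using x nonneg by (simp add: V_dom_def)
      then show ?thesis by (rule part1) (use 1 in \<open>intro factors_ge_disc; simp\<close>)
    next
      case 2
      then have "lam < Re x" using x by (simp add: V_dom_def)
      then show ?thesis by (rule part1) (use 2 in \<open>simp add: factors_ge_half_plane\<close>)
    qed
  qed
  have l0: "l > 0" if "(q0, h0) = (1, 0)" using situation that by auto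
  \<comment> \<open>The exterior of the disc of centre \<open>- l\<close> and radius
    \<open>lam + l\<close> lies in the exterior of the disc of radius \<open>lam\<close> about 0; so
    the limit at \<open>(1, 0)\<close>, whose factors are all equal to \<open>x\<close>, is
    dominated as well.\<close>
  have ge_abs: "cmod (x + of_real l) - l \<le> cmod x" if "l > 0" for x
    using norm_triangle_ineq[of x "of_real l"] that by simp
  have B: "\<forall>x\<in>V_ell l lam. summable (fseries_term q0 h0 Alim x)" if e10: "(q0, h0) = (1, 0)"
  proof
    fix x assume x: "x \<in> V_ell l lam"
    show "summable (fseries_term q0 h0 Alim x)"
    proof (rule part1)
      show "lam < cmod (x + of_real l) - l" using x by (simp add: V_ell_def)
      show "factors_ge q0 h0 (cmod (x + of_real l) - l) x"
        using e10 ge_abs[OF l0[OF e10]] by (simp add: factors_ge_at_1_0)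
    qed
  qed
  have C1: "locally_uniform_limit
            ({x. cmod x > lam'} - (\<Union>i<m. spiral_poles q0 (c i)))
            (\<lambda>n. let h = (1 - 1 / q0) * (1 / q0) ^ n in X_can \<iota> c r q0 h (F q0 h) (P q0 h))
            (X_can \<iota> c r q0 h0 F0 P0) sequentially"
    if nr: "nonresonant {(q0, h0)} (\<lambda>_ _. Alim)" and g0: "canonical_gauge q0 h0 Alim F0"
      and q: "q0 > 1" and h: "h0 = 0" and ev: "\<forall>\<^sub>F n in sequentially. (q0, (1 - 1 / q0) * (1 / q0) ^ n) \<in> \<Lambda>" for F0
    unfolding locally_uniform_limit_def
  proof (intro allI impI)
    fix K assume K: "compact K \<and> K \<subseteq> {x. cmod x > lam'} - (\<Union>i<m. spiral_poles q0 (c i))"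
    define hn where "hn n = (1 - 1 / q0) * (1 / q0) ^ n" for n
    have "(\<lambda>n. (1 - 1 / q0) * (1 / q0) ^ n) \<longlonglongrightarrow> (1 - 1 / q0) * 0"
      using q by (intro tendsto_intros LIMSEQ_realpow_zero) auto
    then have hn: "hn \<longlonglongrightarrow> 0" by (simp add: hn_def[abs_def])
    have hn0: "hn n \<ge> 0" for n using q by (simp add: hn_def)
    have "((\<lambda>n. (q0, hn n)) \<longlongrightarrow> (q0, h0)) sequentially" unfolding h by (intro tendsto_intros hn)
    then have zlim: "filterlim (\<lambda>n. (q0, hn n)) \<Phi> sequentially"
      using q ev by (simp add: \<Phi>_def confluence_filter_def filterlim_inf filterlim_principal hn_def)
    have "(\<lambda>n. hn n / (q0 - 1)) \<longlonglongrightarrow> 0 / (q0 - 1)" using q by (intro tendsto_intros hn) auto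
    then have L: "(\<lambda>n. hn n / (q0 - 1)) \<longlonglongrightarrow> 0" by simp
    have gt: "lam' + 0 < cmod (x + of_real 0)" if "x \<in> K" for x using K that by auto
    obtain X where X: "lam' < X" "\<forall>\<^sub>F n in sequentially. \<forall>x\<in>K. X \<le> cmod (x + of_real (hn n / (q0 - 1))) - hn n / (q0 - 1)"
      "\<And>x. x \<in> K \<Longrightarrow> X \<le> cmod (x + of_real 0) - 0"
      using disc_bound_eventually[OF _ order_refl L gt] K by blast
    have "uniform_limit K (\<lambda>n. X_can \<iota> c r (fst (q0, hn n)) (snd (q0, hn n)) (F (fst (q0, hn n)) (snd (q0, hn n))) (P (fst (q0, hn n)) (snd (q0, hn n))))
      (X_can \<iota> c r q0 h0 F0 P0) sequentially"
    proof (rule core[OF nr g0 zlim _ _ X(1)])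
      show "compact K" using K by simp
      show "\<forall>\<^sub>F n in sequentially. \<forall>x\<in>K. factors_ge (fst (q0, hn n)) (snd (q0, hn n)) X x"
        using X(2) by eventually_elim (use q hn0 in \<open>auto intro: factors_ge_disc\<close>)
      show "factors_ge q0 h0 X x" if "x \<in> K" for x
        using X(3)[OF that] q h by (intro factors_ge_disc) auto
      show "e_fun_converges (\<lambda>n. fst (q0, hn n)) (\<lambda>n. snd (q0, hn n)) q0 h0 (c j) K sequentially" if "j < m" for j
        unfolding fst_conv snd_conv h hn_def
        by (rule e_fun_converges_to_h_0) (use K that q nonneg in auto)
    qed simp
    then show "uniform_limit K (\<lambda>n. let h = (1 - 1 / q0) * (1 / q0) ^ n in X_can \<iota> c r q0 h (F q0 h) (P q0 h))
            (X_can \<iota> c r q0 h0 F0 P0) sequentially"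
      by (simp add: hn_def Let_def)
  qed
  have C2: "locally_uniform_limit
            ({x. Re x > lam'} - (\<Union>i<m. gamma_poles h0 (c i)))
            (\<lambda>(q, h). X_can \<iota> c r q h (F q h) (P q h))
            (X_can \<iota> c r q0 h0 F0 P0) \<Phi>"
    if nr: "nonresonant {(q0, h0)} (\<lambda>_ _. Alim)" and g0: "canonical_gauge q0 h0 Alim F0"
      and q: "q0 = 1" and h: "h0 > 0" for F0
    unfolding locally_uniform_limit_def
  proof (intro allI impI)
    fix K assume K: "compact K \<and> K \<subseteq> {x. Re x > lam'} - (\<Union>i<m. gamma_poles h0 (c i))"
    obtain X where X: "lam' < X" "\<And>x. x \<in> K \<Longrightarrow> X \<le> Re x"
    proof (cases "K = {}")
      case True then show ?thesis by (intro that[of "lam' + 1"]) auto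
    next
      case False
      have "continuous_on K Re" by (intro continuous_intros)
      then obtain x0 where "x0 \<in> K" "\<And>x. x \<in> K \<Longrightarrow> Re x0 \<le> Re x"
        using continuous_attains_inf[of K Re] K False by blast
      then show ?thesis using K by (intro that[of "Re x0"]) auto
    qed
    \<comment> \<open>Near \<open>q = 1\<close> the family has half-planes and exteriors of discs as
      domains. The disc of centre \<open>- h/(q - 1)\<close> with \<open>X\<close> as its rightmost
      point lies to the left of \<open>X\<close>, so a real part at least \<open>X\<close> serves
      for both.\<close>
    have fg: "factors_ge q h X x" if "q \<ge> 1" "h \<ge> 0" "x \<in> K" for q h x
    proof (cases "q = 1")
      case True then show ?thesis using X(2) that by (simp add: factors_ge_half_plane)
    next
      case False
      have "X \<le> Re x" using X(2) that by simp
      also have "\<dots> \<le> cmod (x + of_real (h / (q - 1))) - h / (q - 1)"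
        using complex_Re_le_cmod[of "x + of_real (h / (q - 1))"] by simp
      finally show ?thesis using that False by (intro factors_ge_disc) auto
    qed
    have "uniform_limit K (\<lambda>z. X_can \<iota> c r (fst z) (snd z) (F (fst z) (snd z)) (P (fst z) (snd z))) (X_can \<iota> c r q0 h0 F0 P0) \<Phi>"
    proof (rule core[OF nr g0 filterlim_ident ne _ X(1)])
      show "compact K" using K by simp
      show "\<forall>\<^sub>F z in \<Phi>. \<forall>x\<in>K. factors_ge (fst z) (snd z) X x"
        using evQ by eventually_elim (use fg in auto)
      show "factors_ge q0 h0 X x" if "x \<in> K" for x using fg q h that by auto
      show "e_fun_converges fst snd q0 h0 (c j) K \<Phi>" if "j < m" for j
        unfolding q by (rule e_fun_converges_to_q_1[OF _ _ h _ _ evq]) (use K that \<Phi>D q in auto)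
    qed
    then show "uniform_limit K (\<lambda>(q, h). X_can \<iota> c r q h (F q h) (P q h)) (X_can \<iota> c r q0 h0 F0 P0) \<Phi>"
      by (simp add: case_prod_unfold)
  qed
  have C3: "locally_uniform_limit
            (V_ell l lam' - of_real ` {0..})
            (\<lambda>(q, h). X_can \<iota> c r q h (F q h) (P q h))
            (X_can \<iota> c r q0 h0 F0 P0) \<Phi>"
    if nr: "nonresonant {(q0, h0)} (\<lambda>_ _. Alim)" and g0: "canonical_gauge q0 h0 Alim F0"
      and q: "q0 = 1" and h: "h0 = 0" for F0
    unfolding locally_uniform_limit_def
  proof (intro allI impI)
    fix K assume K: "compact K \<and> K \<subseteq> V_ell l lam' - complex_of_real ` {0..}"
    have l: "l > 0" using l0 q h by simp
    have L: "((\<lambda>z. snd z / (fst z - 1)) \<longlongrightarrow> l) \<Phi>" using \<Phi>D(4) q h by simp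
    have "\<forall>\<^sub>F z in \<Phi>. snd z / (fst z - 1) > 0" using L l by (intro order_tendstoD) auto
    \<comment> \<open>A positive quotient excludes \<open>h = 0\<close> and, as division by 0 gives
      0, also \<open>q = 1\<close>.\<close>
    with evQ have evpos: "\<forall>\<^sub>F z in \<Phi>. fst z > 1 \<and> snd z > 0"
      by eventually_elim (auto simp: zero_less_divide_iff)
    have gt: "lam' + l < cmod (x + of_real l)" if "x \<in> K" for x using K that by (auto simp: V_ell_def)
    obtain X where X: "lam' < X" "\<forall>\<^sub>F z in \<Phi>. \<forall>x\<in>K. X \<le> cmod (x + of_real (snd z / (fst z - 1))) - snd z / (fst z - 1)"
      "\<And>x. x \<in> K \<Longrightarrow> X \<le> cmod (x + of_real l) - l"
      using disc_bound_eventually[OF _ less_imp_le[OF l] L gt] K by blast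
    have "uniform_limit K (\<lambda>z. X_can \<iota> c r (fst z) (snd z) (F (fst z) (snd z)) (P (fst z) (snd z))) (X_can \<iota> c r q0 h0 F0 P0) \<Phi>"
    proof (rule core[OF nr g0 filterlim_ident ne _ X(1)])
      show "compact K" using K by simp
      show "\<forall>\<^sub>F z in \<Phi>. \<forall>x\<in>K. factors_ge (fst z) (snd z) X x"
        using X(2) evpos by eventually_elim (auto intro!: factors_ge_disc)
      show "factors_ge q0 h0 X x" if "x \<in> K" for x
        using order_trans[OF X(3)[OF that] ge_abs[OF l]] q h by (simp add: factors_ge_at_1_0)
      show "e_fun_converges fst snd q0 h0 (c j) K \<Phi>" if "j < m" for j
        unfolding q h by (rule e_fun_converges_to_1_0[OF _ _ l _ L evpos]) (use K \<Phi>D q in auto)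
    qed
    then show "uniform_limit K (\<lambda>(q, h). X_can \<iota> c r q h (F q h) (P q h)) (X_can \<iota> c r q0 h0 F0 P0) \<Phi>"
      by (simp add: case_prod_unfold)
  qed
  show ?thesis
    using A B C1 C2 C3 unfolding \<Phi>_def by blast
qed

end
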